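(* Let $N=2n$ be a positive even integer and let $k$ be a positive integer. For every $u\in\mathbb{C}$ the element $$D_k(u)=\sum_{1\le\alpha_1\le\cdots\le\alpha_k\le N}\frac{1}{\alpha!}\operatorname{per}\Bigl(\widetilde F_\alpha+u\mathbf{1}_\alpha-\mathbf{1}_\alpha\operatorname{diag}\bigl(\tfrac k2-1,\tfrac k2-2,\ldots,-\tfrac k2\bigr)\Bigr)$$ is central in the universal enveloping algebra $U(\mathfrak{sp}(J_0))$.
   Context: Let $N=2n$ be a positive even integer. Put $i'=N+1-i$, and $\varepsilon(i)=-1$ for $1\le i\le n$, $\varepsilon(i)=+1$ for $n+1\le i\le N$. Let $J_0$ be the $N\times N$ alternating matrix with $(i,j)$ entry $\varepsilon(j)\delta_{i,j'}$, and $\mathfrak{sp}(J_0)=\{Z\in\mathfrak{gl}_N(\mathbb{C}) : {}^tZJ_0+J_0Z=0\}$. With $E_{ij}$ the standard basis (matrix units) of $\mathfrak{gl}_N(\mathbb{C})$, put $F_{ij}=E_{ij}-\varepsilon(i)\varepsilon(j)E_{j'i'}\in\mathfrak{sp}(J_0)$ (equivalently $F_{ij}=E_{ij}-J_0^{-1}E_{ji}J_0$), and let $F=(F_{ij})_{1\le i,j\le N}$, regarded as an $N\times N$ matrix with entries in $U(\mathfrak{sp}(J_0))$. Put $\widetilde F=F-\operatorname{diag}(0,\ldots,0,1,\ldots,1)$ with $n$ zeros and $n$ ones. $\mathbf{1}$ is the $N\times N$ unit matrix. For an $N\times N$ matrix $Z=(Z_{ij})$ and $\alpha=(\alpha_1,\ldots,\alpha_k)$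 non-decreasing with values in $\{1,\ldots,N\}$, $Z_\alpha=(Z_{\alpha_i\alpha_j})_{1\le i,j\le k}$ (a $k\times k$ matrix; indices may be repeated, so e.g. $\mathbf 1_\alpha=(\delta_{\alpha_i\alpha_j})$), and $\alpha!=m_1!\cdots m_N!$ where $m_i$ is the multiplicity of $i$ in $\alpha$. For a $k\times k$ matrix $Z$ over a possibly non-commutative algebra, the column-permanent is $\operatorname{per}Z=\sum_{\sigma\in\mathfrak{S}_k}Z_{\sigma(1)1}Z_{\sigma(2)2}\cdots Z_{\sigma(k)k}$. *)

theory Defs
  imports Complex_Main "HOL-Library.Poly_Mapping" "HOL-Algebra.QuotRing"
    "HOL-Combinatorics.Permutations" "Jordan_Normal_Form.Matrix"
begin

section \<open>Free associative algebras\<close>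

text \<open>The free monoid over \<open>'a\<close>, so that the monoid algebra \<open>'a free_word \<Rightarrow>\<^sub>0 complex\<close>
  (with the multiplication of \<^theory>\<open>HOL-Library.Poly_Mapping\<close>) is the free unital associative
  algebra on the letters.\<close>

datatype 'a free_word = Word (letters: "'a list")

instantiation free_word :: (type) monoid_add
begin

definition zero_free_word :: "'a free_word"
  where "0 = Word []"

definition plus_free_word :: "'a free_word \<Rightarrow> 'a free_word \<Rightarrow> 'a free_word"
  where "v + w = Word (letters v @ letters w)"

instance
  by standard (simp_all add: zero_free_word_def plus_free_word_def)

end

definition free_algebra :: "'a set \<Rightarrow> ('a free_word \<Rightarrow>\<^sub>0 complex) ring"
  where "free_algebra S =
    \<lparr>carrier = {p. \<forall>w \<in> Poly_Mapping.keys p. set (letters w) \<subseteq> S},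
     monoid.mult = (*), one = 1, ring.zero = 0, add = (+)\<rparr>"

definition letter :: "'a \<Rightarrow> 'a free_word \<Rightarrow>\<^sub>0 complex"
  where "letter x = Poly_Mapping.single (Word [x]) 1"

definition scalar :: "complex \<Rightarrow> 'a free_word \<Rightarrow>\<^sub>0 complex"
  where "scalar c = Poly_Mapping.single 0 c"

section \<open>Universal enveloping algebras of matrix Lie algebras\<close>

text \<open>For a set \<open>g\<close> of complex square matrices of a fixed size that is closed under linear
  combinations and commutators, \<open>uea g\<close> is the quotient of the free algebra on the set \<open>g\<close> by the
  two-sided ideal which forces the generators to depend linearly on the elements of \<open>g\<close> (this gives
  the tensor algebra of the vector space \<open>g\<close>) and the commutator of two generators to be the
  generator belonging to the Lie bracket.\<close>

definition uea_relations :: "complex mat set \<Rightarrow> (complex mat free_word \<Rightarrow>\<^sub>0 complex) set"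
  where "uea_relations g =
    {letter (X + Y) - letter X - letter Y | X Y. X \<in> g \<and> Y \<in> g} \<union>
    {letter (c \<cdot>\<^sub>m X) - scalar c * letter X | c X. X \<in> g} \<union>
    {letter X * letter Y - letter Y * letter X - letter (X * Y - Y * X) | X Y. X \<in> g \<and> Y \<in> g}"

definition uea_ideal :: "complex mat set \<Rightarrow> (complex mat free_word \<Rightarrow>\<^sub>0 complex) set"
  where "uea_ideal g = Idl\<^bsub>free_algebra g\<^esub> (uea_relations g)"

definition uea :: "complex mat set \<Rightarrow> (complex mat free_word \<Rightarrow>\<^sub>0 complex) set ring"
  where "uea g = free_algebra g Quot uea_ideal g"

definition uea_class ::
    "complex mat set \<Rightarrow> (complex mat free_word \<Rightarrow>\<^sub>0 complex) \<Rightarrow> (complex mat free_word \<Rightarrow>\<^sub>0 complex) set"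
  where "uea_class g p = uea_ideal g +>\<^bsub>free_algebra g\<^esub> p"

definition uea_embed :: "complex mat set \<Rightarrow> complex mat \<Rightarrow> (complex mat free_word \<Rightarrow>\<^sub>0 complex) set"
  where "uea_embed g X = uea_class g (letter X)"

definition uea_scalar :: "complex mat set \<Rightarrow> complex \<Rightarrow> (complex mat free_word \<Rightarrow>\<^sub>0 complex) set"
  where "uea_scalar g c = uea_class g (scalar c)"

definition ring_center :: "('a, 'b) ring_scheme \<Rightarrow> 'a set"
  where "ring_center R = {z \<in> carrier R. \<forall>x \<in> carrier R. z \<otimes>\<^bsub>R\<^esub> x = x \<otimes>\<^bsub>R\<^esub> z}"

section \<open>The symplectic Lie algebra\<close>

text \<open>All row and column indices \<open>i, j\<close> below are 1-based, ranging over \<open>{1..2 * n}\<close>; only the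
  functions given to the matrix constructor \<^const>\<open>mat\<close> receive 0-based positions.\<close>

definition mirror :: "nat \<Rightarrow> nat \<Rightarrow> nat"
  where "mirror n i = 2 * n + 1 - i"

definition sp_sign :: "nat \<Rightarrow> nat \<Rightarrow> complex"
  where "sp_sign n i = (if i \<le> n then -1 else 1)"

definition J0 :: "nat \<Rightarrow> complex mat"
  where "J0 n = mat (2 * n) (2 * n)
    (\<lambda>(r, c). if Suc r = mirror n (Suc c) then sp_sign n (Suc c) else 0)"

definition sp :: "nat \<Rightarrow> complex mat set"
  where "sp n = {Z \<in> carrier_mat (2 * n) (2 * n).
    transpose_mat Z * J0 n + J0 n * Z = 0\<^sub>m (2 * n) (2 * n)}"

definition E_mat :: "nat \<Rightarrow> nat \<Rightarrow> nat \<Rightarrow> complex mat"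
  where "E_mat n i j = mat (2 * n) (2 * n) (\<lambda>(r, c). if Suc r = i \<and> Suc c = j then 1 else 0)"

definition F_mat :: "nat \<Rightarrow> nat \<Rightarrow> nat \<Rightarrow> complex mat"
  where "F_mat n i j = E_mat n i j - (sp_sign n i * sp_sign n j) \<cdot>\<^sub>m E_mat n (mirror n j) (mirror n i)"

section \<open>Column permanents and the elements \<open>D\<^sub>k(u)\<close>\<close>

text \<open>A \<open>k \<times> k\<close> matrix over \<open>R\<close> is a function on the index set \<open>{1..k}\<close>. The factors of each
  product are multiplied in the order of their column index.\<close>

definition column_permanent :: "('a, 'b) ring_scheme \<Rightarrow> nat \<Rightarrow> (nat \<Rightarrow> nat \<Rightarrow> 'a) \<Rightarrow> 'a"
  where "column_permanent R k Z =
    (\<Oplus>\<^bsub>R\<^esub>\<sigma> \<in> {\<sigma>. \<sigma> permutes {1..k}}.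
      foldr (\<lambda>j p. Z (\<sigma> j) j \<otimes>\<^bsub>R\<^esub> p) [1..<Suc k] \<one>\<^bsub>R\<^esub>)"

definition multi_indices :: "nat \<Rightarrow> nat \<Rightarrow> nat list set"
  where "multi_indices N k = {\<alpha>. length \<alpha> = k \<and> sorted \<alpha> \<and> set \<alpha> \<subseteq> {1..N}}"

definition multi_fact :: "nat \<Rightarrow> nat list \<Rightarrow> complex"
  where "multi_fact N \<alpha> = (\<Prod>i = 1..N. fact (count_list \<alpha> i))"

definition F_tilde :: "nat \<Rightarrow> nat \<Rightarrow> nat \<Rightarrow> (complex mat free_word \<Rightarrow>\<^sub>0 complex) set"
  where "F_tilde n i j =
    uea_embed (sp n) (F_mat n i j)
      \<ominus>\<^bsub>uea (sp n)\<^esub> uea_scalar (sp n) (if i = j \<and> n < i then 1 else 0)"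

text \<open>The matrix whose permanent enters \<open>D\<^sub>k(u)\<close>; the \<open>j\<close>-th entry of
  \<open>diag(k/2 - 1, k/2 - 2, \<dots>, -k/2)\<close> is \<open>k/2 - j\<close>.\<close>

definition D_matrix ::
    "nat \<Rightarrow> nat \<Rightarrow> complex \<Rightarrow> nat list \<Rightarrow> nat \<Rightarrow> nat \<Rightarrow> (complex mat free_word \<Rightarrow>\<^sub>0 complex) set"
  where "D_matrix n k u \<alpha> i j =
    (let a = \<alpha> ! (i - 1); b = \<alpha> ! (j - 1); \<delta> = (if a = b then 1 else 0) in
      F_tilde n a b \<oplus>\<^bsub>uea (sp n)\<^esub> uea_scalar (sp n) (u * \<delta>)
        \<ominus>\<^bsub>uea (sp n)\<^esub> uea_scalar (sp n) (\<delta> * (of_nat k / 2 - of_nat j)))"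

definition D_elem :: "nat \<Rightarrow> nat \<Rightarrow> complex \<Rightarrow> (complex mat free_word \<Rightarrow>\<^sub>0 complex) set"
  where "D_elem n k u =
    (\<Oplus>\<^bsub>uea (sp n)\<^esub>\<alpha> \<in> multi_indices (2 * n) k.
      uea_scalar (sp n) (1 / multi_fact (2 * n) \<alpha>)
        \<otimes>\<^bsub>uea (sp n)\<^esub> column_permanent (uea (sp n)) k (D_matrix n k u \<alpha>))"

section \<open>Well-definedness\<close>

lemma sp_iff:
  "Z \<in> sp n \<longleftrightarrow> Z \<in> carrier_mat (2 * n) (2 * n) \<and> transpose_mat Z * J0 n = - (J0 n * Z)"
proof -
  have J: "J0 n \<in> carrier_mat (2 * n) (2 * n)"
    by (simp add: J0_def)
  have "A + B = 0\<^sub>m (2 * n) (2 * n) \<longleftrightarrow> A = - B"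
    if "A \<in> carrier_mat (2 * n) (2 * n)" "B \<in> carrier_mat (2 * n) (2 * n)" for A B :: "complex mat"
    using that by (auto simp: mat_eq_iff add_eq_0_iff2)
  from this[of "transpose_mat Z * J0 n" "J0 n * Z"] show ?thesis
    using J by (auto simp: sp_def)
qed

lemma sp_add:
  assumes X: "X \<in> sp n" and Y: "Y \<in> sp n"
  shows "X + Y \<in> sp n"
proof -
  have J: "J0 n \<in> carrier_mat (2 * n) (2 * n)"
    by (simp add: J0_def)
  have XY: "X \<in> carrier_mat (2 * n) (2 * n)" "Y \<in> carrier_mat (2 * n) (2 * n)"
    and eq: "transpose_mat X * J0 n = - (J0 n * X)" "transpose_mat Y * J0 n = - (J0 n * Y)"
    using X Y by (auto simp: sp_iff)
  have "transpose_mat (X + Y) * J0 n = transpose_mat X * J0 n + transpose_mat Y * J0 n"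
    using J XY by (simp add: transpose_add add_mult_distrib_mat[where nr = "2 * n" and n = "2 * n" and nc = "2 * n"])
  also have "\<dots> = - (J0 n * (X + Y))"
    unfolding eq mult_add_distrib_mat[OF J XY] using J XY by (intro eq_matI) auto
  finally show ?thesis
    using XY by (simp add: sp_iff)
qed

lemma sp_smult:
  assumes X: "X \<in> sp n"
  shows "c \<cdot>\<^sub>m X \<in> sp n"
proof -
  have J: "J0 n \<in> carrier_mat (2 * n) (2 * n)"
    by (simp add: J0_def)
  have XX: "X \<in> carrier_mat (2 * n) (2 * n)" and eq: "transpose_mat X * J0 n = - (J0 n * X)"
    using X by (auto simp: sp_iff)
  have "transpose_mat (c \<cdot>\<^sub>m X) = c \<cdot>\<^sub>m transpose_mat X"
    by (intro eq_matI) auto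
  then have "transpose_mat (c \<cdot>\<^sub>m X) * J0 n = c \<cdot>\<^sub>m (transpose_mat X * J0 n)"
    using J XX by (simp add: mult_smult_assoc_mat[where nr = "2 * n" and n = "2 * n" and nc = "2 * n"])
  also have "\<dots> = - (J0 n * (c \<cdot>\<^sub>m X))"
    unfolding eq mult_smult_distrib[OF J XX] using J XX by (intro eq_matI) auto
  finally show ?thesis
    using XX by (simp add: sp_iff)
qed

lemma sp_bracket:
  assumes X: "X \<in> sp n" and Y: "Y \<in> sp n"
  shows "X * Y - Y * X \<in> sp n"
proof -
  let ?C = "carrier_mat (2 * n) (2 * n) :: complex mat set"
  have J: "J0 n \<in> ?C"
    by (simp add: J0_def)
  have prod: "transpose_mat (A * B) * J0 n = J0 n * (B * A)" if "A \<in> sp n" "B \<in> sp n" for A B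
  proof -
    have A: "A \<in> ?C" and B: "B \<in> ?C"
      and eA: "transpose_mat A * J0 n = - (J0 n * A)" and eB: "transpose_mat B * J0 n = - (J0 n * B)"
      using that by (auto simp: sp_iff)
    have At: "transpose_mat A \<in> ?C" and Bt: "transpose_mat B \<in> ?C"
      using A B by auto
    have "transpose_mat (A * B) * J0 n = transpose_mat B * (transpose_mat A * J0 n)"
      using transpose_mult[OF A B] assoc_mult_mat[OF Bt At J] by simp
    also have "\<dots> = - ((transpose_mat B * J0 n) * A)"
      unfolding eA using uminus_mult_right_mat[of "transpose_mat B" "J0 n * A"] assoc_mult_mat[OF Bt J A] J A B
      by simp
    also have "\<dots> = (J0 n * B) * A"
      unfolding eB using uminus_mult_left_mat[of "J0 n * B" A] J A B by simp
    also have "\<dots> = J0 n * (B * A)"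
      using assoc_mult_mat[OF J B A] .
    finally show ?thesis .
  qed
  have XC: "X \<in> ?C" and YC: "Y \<in> ?C"
    using X Y by (auto simp: sp_iff)
  have P: "X * Y \<in> ?C" "Y * X \<in> ?C"
    using XC YC by auto
  then have PT: "transpose_mat (X * Y) \<in> ?C" "transpose_mat (Y * X) \<in> ?C"
    by auto
  have "transpose_mat (X * Y - Y * X) * J0 n
      = transpose_mat (X * Y) * J0 n - transpose_mat (Y * X) * J0 n"
    using minus_mult_distrib_mat[OF PT J] transpose_minus[OF P] by simp
  also have "\<dots> = J0 n * (Y * X) - J0 n * (X * Y)"
    by (simp only: prod[OF X Y] prod[OF Y X])
  also have "\<dots> = - (J0 n * (X * Y - Y * X))"
  proof -
    have "C - B = - (B - C)" if "B \<in> ?C" "C \<in> ?C" for B C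
      using that by (intro eq_matI) auto
    from this[OF mult_carrier_mat[OF J P(1)] mult_carrier_mat[OF J P(2)]] show ?thesis
      by (simp only: mult_minus_distrib_mat[OF J P])
  qed
  finally show ?thesis
    using minus_carrier_mat[OF P(2)] by (simp add: sp_iff)
qed

lemma F_mat_in_sp:
  assumes "i \<in> {1..2 * n}" "j \<in> {1..2 * n}"
  shows "F_mat n i j \<in> sp n"
proof -
  have dims: "dim_row (J0 n) = 2 * n" "dim_col (J0 n) = 2 * n"
      "dim_row (E_mat n a b) = 2 * n" "dim_col (E_mat n a b) = 2 * n" for a b
    by (simp_all add: J0_def E_mat_def)
  have EJ: "(transpose_mat (E_mat n a b) * J0 n) $$ (r, c)
      = (if Suc r = b then J0 n $$ (a - 1, c) else 0)"
    if "a \<in> {1..2 * n}" "r < 2 * n" "c < 2 * n" for a b r c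
  proof -
    have "(transpose_mat (E_mat n a b) * J0 n) $$ (r, c)
        = (\<Sum>s \<in> {0..<2 * n}. E_mat n a b $$ (s, r) * J0 n $$ (s, c))"
      using that by (simp add: scalar_prod_def dims)
    also have "\<dots> = (\<Sum>s \<in> {0..<2 * n}.
        (if s = a - 1 then if Suc r = b then J0 n $$ (s, c) else 0 else 0))"
      using that by (intro sum.cong) (auto simp: E_mat_def)
    finally show ?thesis
      using that by (auto simp: sum.delta)
  qed
  have JE: "(J0 n * E_mat n a b) $$ (r, c) = (if Suc c = b then J0 n $$ (r, a - 1) else 0)"
    if "a \<in> {1..2 * n}" "r < 2 * n" "c < 2 * n" for a b r c
  proof -
    have "(J0 n * E_mat n a b) $$ (r, c)
        = (\<Sum>s \<in> {0..<2 * n}. J0 n $$ (r, s) * E_mat n a b $$ (s, c))"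
      using that by (simp add: scalar_prod_def dims)
    also have "\<dots> = (\<Sum>s \<in> {0..<2 * n}.
        (if s = a - 1 then if Suc c = b then J0 n $$ (r, s) else 0 else 0))"
      using that by (intro sum.cong) (auto simp: E_mat_def)
    finally show ?thesis
      using that by (auto simp: sum.delta)
  qed
  let ?C = "carrier_mat (2 * n) (2 * n) :: complex mat set"
  define s where "s = sp_sign n i * sp_sign n j"
  define A where "A = E_mat n i j"
  define B where "B = E_mat n (mirror n j) (mirror n i)"
  have J: "J0 n \<in> ?C" and A: "A \<in> ?C" and B: "B \<in> ?C"
    by (simp_all add: J0_def A_def B_def E_mat_def)
  have sB: "s \<cdot>\<^sub>m B \<in> ?C" and At: "transpose_mat A \<in> ?C" and Bt: "transpose_mat B \<in> ?C"
    using A B by auto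
  have F: "F_mat n i j = A - s \<cdot>\<^sub>m B"
    by (simp add: F_mat_def A_def B_def s_def)
  have m: "mirror n j \<in> {1..2 * n}"
    using assms by (auto simp: mirror_def)
  have tr: "transpose_mat (F_mat n i j) = transpose_mat A - s \<cdot>\<^sub>m transpose_mat B"
    unfolding F using A B by (intro eq_matI) auto
  have 1: "transpose_mat (F_mat n i j) * J0 n
      = transpose_mat A * J0 n - s \<cdot>\<^sub>m (transpose_mat B * J0 n)"
    unfolding tr
    using minus_mult_distrib_mat[OF At _ J, of "s \<cdot>\<^sub>m transpose_mat B"] mult_smult_assoc_mat[OF Bt J] Bt
    by simp
  have 2: "J0 n * F_mat n i j = J0 n * A - s \<cdot>\<^sub>m (J0 n * B)"
    unfolding F using mult_minus_distrib_mat[OF J A sB] mult_smult_distrib[OF J B] by simp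
  have "transpose_mat (F_mat n i j) * J0 n + J0 n * F_mat n i j = 0\<^sub>m (2 * n) (2 * n)"
  proof (rule eq_matI)
    fix r c
    assume "r < dim_row (0\<^sub>m (2 * n) (2 * n) :: complex mat)" "c < dim_col (0\<^sub>m (2 * n) (2 * n) :: complex mat)"
    then have rc: "r < 2 * n" "c < 2 * n"
      by auto
    have "(transpose_mat (F_mat n i j) * J0 n + J0 n * F_mat n i j) $$ (r, c)
        = (transpose_mat A * J0 n) $$ (r, c) - s * (transpose_mat B * J0 n) $$ (r, c)
          + ((J0 n * A) $$ (r, c) - s * (J0 n * B) $$ (r, c))"
      unfolding 1 2 using rc J A B by (simp del: index_mult_mat(1))
    also have "\<dots> = 0"
    proof -
      define p q where "p = Suc r" and "q = Suc c"
      have pq: "p \<in> {1..2 * n}" "q \<in> {1..2 * n}"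
        using rc by (auto simp: p_def q_def)
      have J1: "J0 n $$ (a - 1, c) = (if a = mirror n q then sp_sign n q else 0)"
        if "a \<in> {1..2 * n}" for a
        using that rc by (cases a) (auto simp: J0_def q_def)
      have J2: "J0 n $$ (r, a - 1) = (if p = mirror n a then sp_sign n a else 0)"
        if "a \<in> {1..2 * n}" for a
        using that rc by (cases a) (auto simp: J0_def p_def)
      have mm: "mirror n (mirror n j) = j" "i = mirror n q \<longleftrightarrow> q = mirror n i"
        "mirror n j = mirror n q \<longleftrightarrow> q = j"
        using assms pq by (auto simp: mirror_def)
      have sg: "sp_sign n (mirror n a) = - sp_sign n a" if "a \<in> {1..2 * n}" for a
        using that by (auto simp: sp_sign_def mirror_def)
      have sq: "sp_sign n a * sp_sign n a = 1" for a
        by (simp add: sp_sign_def)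
      have sj: "s * sp_sign n j = sp_sign n i"
        by (simp add: s_def mult.assoc sq)
      have ij: "mirror n i = j \<Longrightarrow> sp_sign n i + sp_sign n j = 0"
        using sg[OF assms(1)] by simp
      show ?thesis
        unfolding A_def B_def EJ[OF assms(1) rc] EJ[OF m rc] JE[OF assms(1) rc] JE[OF m rc]
          J1[OF assms(1)] J1[OF m] J2[OF assms(1)] J2[OF m] p_def[symmetric] q_def[symmetric] mm
        using sj sg[OF assms(1)] sg[OF assms(2)] ij by simp
    qed
    finally show "(transpose_mat (F_mat n i j) * J0 n + J0 n * F_mat n i j) $$ (r, c)
        = 0\<^sub>m (2 * n) (2 * n) $$ (r, c)"
      using rc by simp
  qed (use J A B sB F in auto)
  then show ?thesis
    using A B F by (auto simp: sp_def)
qed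

lemma free_algebra_ring: "ring (free_algebra S)"
proof -
  have cl: "p * q \<in> carrier (free_algebra S)"
    if "p \<in> carrier (free_algebra S)" "q \<in> carrier (free_algebra S)" for p q
    using that keys_mult[of p q] by (fastforce simp: free_algebra_def plus_free_word_def)
  have ad: "p + q \<in> carrier (free_algebra S)"
    if "p \<in> carrier (free_algebra S)" "q \<in> carrier (free_algebra S)" for p q
    using that keys_add[of p q] by (fastforce simp: free_algebra_def)
  have on: "1 \<in> carrier (free_algebra S)"
    by (simp add: free_algebra_def zero_free_word_def)
  have ze: "0 \<in> carrier (free_algebra S)"
    by (simp add: free_algebra_def)
  have ne: "- p \<in> carrier (free_algebra S)" if "p \<in> carrier (free_algebra S)" for p
    using that by (simp add: free_algebra_def in_keys_iff)
  have ops: "p \<otimes>\<^bsub>free_algebra S\<^esub> q = p * q" "p \<oplus>\<^bsub>free_algebra S\<^esub> q = p + q"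
    "\<one>\<^bsub>free_algebra S\<^esub> = 1" "\<zero>\<^bsub>free_algebra S\<^esub> = 0" for p q
    by (simp_all add: free_algebra_def)
  show ?thesis
  proof (rule ringI)
    show "abelian_group (free_algebra S)"
    proof (rule abelian_groupI)
      fix p assume p: "p \<in> carrier (free_algebra S)"
      show "\<exists>q \<in> carrier (free_algebra S). q \<oplus>\<^bsub>free_algebra S\<^esub> p = \<zero>\<^bsub>free_algebra S\<^esub>"
        by (rule bexI[OF _ ne[OF p]]) (simp add: ops)
    qed (simp_all add: ops ad ze add_ac)
    show "Group.monoid (free_algebra S)"
      by (rule monoidI) (simp_all add: ops cl on mult.assoc)
  qed (simp_all add: ops distrib_left distrib_right)
qed

lemma uea_relations_carrier: "uea_relations (sp n) \<subseteq> carrier (free_algebra (sp n))"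
proof -
  interpret ring "free_algebra (sp n)"
    by (rule free_algebra_ring)
  let ?C = "carrier (free_algebra (sp n))"
  have letter: "letter X \<in> ?C" if "X \<in> sp n" for X
    using that by (simp add: letter_def free_algebra_def)
  have scalar: "scalar c \<in> ?C" for c
    by (simp add: scalar_def free_algebra_def zero_free_word_def)
  have mult: "p * q \<in> ?C" if "p \<in> ?C" "q \<in> ?C" for p q
    using m_closed[OF that] by (simp add: free_algebra_def)
  have diff: "p - q \<in> ?C" if "p \<in> ?C" "q \<in> ?C" for p q
    using that keys_diff[of p q] by (fastforce simp: free_algebra_def)
  show ?thesis
    unfolding uea_relations_def
    by (auto intro!: letter scalar mult diff sp_add sp_smult sp_bracket)
qed

lemma uea_ideal_ideal: "ideal (uea_ideal (sp n)) (free_algebra (sp n))"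
  unfolding uea_ideal_def
  by (intro ring.genideal_ideal free_algebra_ring uea_relations_carrier)

lemma uea_ring: "ring (uea (sp n))"
  unfolding uea_def by (intro ideal.quotient_is_ring uea_ideal_ideal)

end

theory Submission
  imports Defs "HOL-Combinatorics.Multiset_Permutations"
begin

text \<open>Let \<open>x\<^sub>1, \<dots>, x\<^sub>N\<close> be central variables and \<open>\<eta>\<^sub>j = \<Sum>\<^sub>i x\<^sub>i F\<^sub>i\<^sub>j\<close>. The summand of \<open>D\<^sub>k(u)\<close> belonging to
  \<open>\<alpha>\<close> is the coefficient of \<open>x\<^sub>\<alpha>\<close> in a product of shifted letters \<open>\<eta>\<^sub>j + s x\<^sub>j\<close> with \<open>j\<close> running through \<open>\<alpha>\<close>,
  so \<open>D\<^sub>k(u)\<close> is a trace over \<open>S\<^sup>k(\<complex>\<^sup>N)\<close>. With \<open>s\<close> growing by one from factor to factor the letters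
  commute except for \<open>j\<close> and \<open>j' = N + 1 - j\<close>, whose commutator is \<open>\<plusminus>\<Theta>\<close> with \<open>\<Theta> = \<Sum>\<^sub>j \<epsilon>(j) x\<^sub>j\<^sub>' \<eta>\<^sub>j\<close> central.
  Let \<open>T(\<alpha>)\<close> be the product with the indices \<open>\<le> n\<close> in front. The shift of the diagonal by one in
  the last \<open>n\<close> places replaces \<open>T\<close> by \<open>T~ = T - \<Sum>\<^sub>h\<^sub>>\<^sub>n x\<^sub>h T \<partial>\<^sub>h\<close>.
  The operator \<open>T\<close> commutes with the Levi subalgebra \<open>\<gg>\<ll>\<^sub>n\<close>, and its commutator with a long root
  vector \<open>F\<^sub>a\<^sub>a\<^sub>'\<close> is \<open>T \<partial>\<^sub>a\<^sup>2\<close> times \<open>\<Theta>\<close>. Expanding \<open>\<Theta>\<close> in letters shows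
  \<open>(T \<Theta>)~ = \<Sum>\<^sub>j \<epsilon>(j) x\<^sub>j\<^sub>' T x\<^sub>j\<close>; under the trace \<open>x\<^sub>j\<^sub>'\<close> can be moved cyclically to the right, where
  the antisymmetry of \<open>\<epsilon>\<close> leaves only a first-order term, and it cancels the commutator
  of \<open>F\<^sub>a\<^sub>a\<^sub>'\<close> with the correction \<open>T~ - T\<close>.\<close>

section \<open>Products of shifted letters\<close>

text \<open>\<Theta> does not commute with a single letter: by \<open>\<Theta>_y\<close> it passes a
  letter while changing its shift by two. That is exactly the gap left behind when a mirror pair
  disappears from a word, so a contraction yields a gapless shorter word times \<Theta>, and in this
  sense \<Theta> is central. Words without mirror pairs then depend only on their multiset, and
  putting the indices \<le> n first gives a normal form. Substitutions from gl_n keep every index in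
  its half and preserve this form; a long root vector replaces an index by its mirror image, and the
  ensuing reordering is the only source of \<Theta>. The chosen order treats the two halves
  unequally, and the diagonal correction by one compensates for that: it supplies the term that
  cancels the remainder 2 \<open>count P a\<close> of the trace. Levi and long root vectors suffice,
  because [F_ab, F_bb'] = 2 F_ab' for distinct a, b \<le> n, and similarly for the negative roots;
  this division by 2 is why \<open>commutes_all\<close> assumes a ring without 2-torsion.\<close>

lemma mirror_in: "i \<in> {1..2 * n} \<Longrightarrow> mirror n i \<in> {1..2 * n}"
  by (auto simp: mirror_def)

lemma mirror_mirror: "i \<in> {1..2 * n} \<Longrightarrow> mirror n (mirror n i) = i"
  by (auto simp: mirror_def)

lemma mirror_low_iff: "i \<in> {1..2 * n} \<Longrightarrow> mirror n i \<le> n \<longleftrightarrow> n < i"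
  by (auto simp: mirror_def)

lemma bij_betw_mirror: "bij_betw (mirror n) {1..2 * n} {1..2 * n}"
  by (rule bij_betw_byWitness[where f' = "mirror n"]) (auto simp: mirror_def)

lemma sum_mirror: "(\<Sum>i\<in>{1..2 * n}. f (mirror n i)) = (\<Sum>i\<in>{1..2 * n}. f i)"
  by (rule sum.reindex_bij_betw[OF bij_betw_mirror])

text \<open>The relations are those of the matrices F_ij, imposed on elements of an arbitrary ring.
  The central parameter \<open>c\<close> later carries the complex part of the diagonal shift, so
  that only integers vary from factor to factor.\<close>

locale sp_relations =
  fixes n :: nat
    and x :: "nat \<Rightarrow> 'b :: ring_1"
    and F :: "nat \<Rightarrow> nat \<Rightarrow> 'b"
    and c :: 'b
  assumes x_central: "x i * p = p * x i"
    and c_central: "c * p = p * c"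
    and F_bracket: "\<lbrakk>i \<in> {1..2 * n}; j \<in> {1..2 * n}; k \<in> {1..2 * n}; l \<in> {1..2 * n}\<rbrakk> \<Longrightarrow>
      F i j * F k l - F k l * F i j
        = (if j = k then F i l else 0) - (if i = l then F k j else 0)
          - (if k = mirror n i then of_int (if i \<le> n then -1 else 1) * of_int (if j \<le> n then -1 else 1) * F (mirror n j) l else 0)
          + (if l = mirror n j then of_int (if i \<le> n then -1 else 1) * of_int (if j \<le> n then -1 else 1) * F k (mirror n i) else 0)"
begin

abbreviation I :: "nat set" where "I \<equiv> {1..2 * n}"

abbreviation m :: "nat \<Rightarrow> nat" where "m \<equiv> mirror n"

definition e :: "nat \<Rightarrow> 'b" where "e i = of_int (if i \<le> n then -1 else 1)"

lemma e_central: "e i * p = p * e i"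
  by (simp add: e_def)

lemma e_mirror: "i \<in> I \<Longrightarrow> e (m i) = - e i"
  by (auto simp: e_def mirror_def)

lemma e_sq: "e i * e i = 1" "e i * (e i * p) = p"
  by (simp_all add: e_def)

lemma F_comm:
  assumes "i \<in> I" "j \<in> I" "k \<in> I" "l \<in> I"
  shows "F i j * F k l - F k l * F i j
        = (if j = k then F i l else 0) - (if i = l then F k j else 0)
          - (if k = m i then e i * e j * F (m j) l else 0)
          + (if l = m j then e i * e j * F k (m i) else 0)"
  unfolding e_def by (rule F_bracket[OF assms])

section \<open>The linear forms \<open>\<eta> j\<close> and their Heisenberg relations\<close>

definition \<eta> :: "nat \<Rightarrow> 'b" where "\<eta> j = (\<Sum>i\<in>I. x i * F i j)"

text \<open>All failure of the \<open>\<eta>\<close>s to commute, beyond that of \<open>\<gg>\<ll>\<^sub>N\<close>, is a multiple of \<open>\<Theta>\<close>, and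
  \<open>\<Theta>\<close> passes through the shifted letters \<open>y j z\<close> below: they satisfy Heisenberg relations.\<close>

definition \<Theta> :: 'b where "\<Theta> = (\<Sum>i\<in>I. e i * x (m i) * \<eta> i)"

lemma x_left: "p * (x i * q) = x i * (p * q)"
  by (metis x_central mult.assoc)

lemma e_left: "p * (e i * q) = e i * (p * q)"
  by (metis e_central mult.assoc)

lemma x_pull:
  "F a b * x i = x i * F a b" "F a b * (x i * q) = x i * (F a b * q)"
  "\<eta> a * x i = x i * \<eta> a" "\<eta> a * (x i * q) = x i * (\<eta> a * q)"
  "\<Theta> * x i = x i * \<Theta>" "\<Theta> * (x i * q) = x i * (\<Theta> * q)"
  "e a * x i = x i * e a" "e a * (x i * q) = x i * (e a * q)"
  by (rule x_central[symmetric] x_left)+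

lemma x_commute: "x i * x j = x j * x i" "x i * (x j * q) = x j * (x i * q)"
  by (rule x_central x_left)+

lemma e_pull:
  "F a b * e i = e i * F a b" "F a b * (e i * q) = e i * (F a b * q)"
  "\<eta> a * e i = e i * \<eta> a" "\<eta> a * (e i * q) = e i * (\<eta> a * q)"
  "\<Theta> * e i = e i * \<Theta>" "\<Theta> * (e i * q) = e i * (\<Theta> * q)"
  by (rule e_central[symmetric] e_left)+

lemma e_commute: "e i * e j = e j * e i" "e i * (e j * q) = e j * (e i * q)"
  by (rule e_central[symmetric] e_left)+

lemmas pull = mult.assoc x_pull x_commute e_pull e_commute e_sq

text \<open>The terms of i and \<open>m i\<close> cancel. Splitting \<open>I\<close> into its two
  halves proves this in any ring, whereas passing from S = - S to S = 0 would require the absence of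
  2-torsion.\<close>

lemma antisym_sum_zero:
  assumes "\<And>i. i \<in> I \<Longrightarrow> f (m i) = (f i :: 'b)"
  shows "(\<Sum>i\<in>I. e i * f i) = 0"
proof -
  have split: "I = {1..n} \<union> m ` {1..n}"
  proof -
    have "j \<in> m ` {1..n}" if "j \<in> I" "\<not> j \<le> n" for j
      using that by (intro image_eqI[of _ _ "m j"]) (auto simp: mirror_def)
    then show ?thesis by (fastforce simp: mirror_def)
  qed
  have inj: "inj_on m {1..n}" by (auto simp: inj_on_def mirror_def)
  have "(\<Sum>i\<in>I. e i * f i) = (\<Sum>i\<in>{1..n}. e i * f i) + (\<Sum>i\<in>m ` {1..n}. e i * f i)"
    unfolding split by (rule sum.union_disjoint) (auto simp: mirror_def)
  also have "(\<Sum>i\<in>m ` {1..n}. e i * f i) = (\<Sum>i\<in>{1..n}. e (m i) * f (m i))"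
    using inj by (simp add: sum.reindex)
  also have "\<dots> = (\<Sum>i\<in>{1..n}. - (e i * f i))"
    by (rule sum.cong) (auto simp: e_mirror assms)
  finally show ?thesis by (simp add: sum_negf)
qed

text \<open>Each of the four terms of the bracket is summed against x_a x_b. The first two give the
  gl_N part, the third vanishes by antisymmetry of the signs, and the fourth assembles to
  \<Theta>.\<close>

lemma \<eta>_comm:
  assumes i: "i \<in> I" and j: "j \<in> I"
  shows "\<eta> i * \<eta> j - \<eta> j * \<eta> i = x i * \<eta> j - x j * \<eta> i - (if j = m i then e i * \<Theta> else 0)"
proof -
  have "\<eta> i * \<eta> j - \<eta> j * \<eta> i
      = (\<Sum>a\<in>I. \<Sum>b\<in>I. x a * F a i * (x b * F b j)) - (\<Sum>a\<in>I. \<Sum>b\<in>I. x b * F b j * (x a * F a i))"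
    unfolding \<eta>_def by (simp only: sum_product) (subst sum.swap, rule refl)
  also have "\<dots> = (\<Sum>a\<in>I. \<Sum>b\<in>I. x a * (x b * (F a i * F b j - F b j * F a i)))"
    by (simp add: sum_subtractf[symmetric] right_diff_distrib pull)
  also have "\<dots> = (\<Sum>a\<in>I. \<Sum>b\<in>I. (if i = b then x a * (x b * F a j) else 0)
      - (if a = j then x a * (x b * F b i) else 0)
      - (if b = m a then x a * (x b * (e a * (e i * F (m i) j))) else 0)
      + (if j = m i then x a * (x b * (e a * (e i * F b (m a)))) else 0))"
    by (intro sum.cong refl) (use i j in \<open>simp add: F_comm distrib_left right_diff_distrib pull split del: if_split cong: if_cong\<close>, simp add: x_commute)
  also have "\<dots> = (\<Sum>a\<in>I. \<Sum>b\<in>I. if i = b then x a * (x b * F a j) else 0)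
      - (\<Sum>a\<in>I. \<Sum>b\<in>I. if a = j then x a * (x b * F b i) else 0)
      - (\<Sum>a\<in>I. \<Sum>b\<in>I. if b = m a then x a * (x b * (e a * (e i * F (m i) j))) else 0)
      + (\<Sum>a\<in>I. \<Sum>b\<in>I. if j = m i then x a * (x b * (e a * (e i * F b (m a)))) else 0)"
    by (simp only: sum.distrib sum_subtractf)
  also have "(\<Sum>a\<in>I. \<Sum>b\<in>I. if i = b then x a * (x b * F a j) else 0) = x i * \<eta> j"
    using i by (simp add: \<eta>_def sum_distrib_left pull)
  also have "(\<Sum>a\<in>I. \<Sum>b\<in>I. if a = j then x a * (x b * F b i) else 0) = x j * \<eta> i"
    using j by (subst sum.swap) (simp add: \<eta>_def sum_distrib_left pull)
  also have "(\<Sum>a\<in>I. \<Sum>b\<in>I. if b = m a then x a * (x b * (e a * (e i * F (m i) j))) else 0)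
      = (\<Sum>a\<in>I. e a * (x a * (x (m a) * (e i * F (m i) j))))"
    by (intro sum.cong refl) (use mirror_in in \<open>simp add: pull\<close>)
  \<comment> \<open>The product of x_a and x_(m a) is symmetric under the mirror map, the sign is
    not.\<close>
  also have "\<dots> = 0"
    by (rule antisym_sum_zero) (simp add: mirror_mirror pull)
  also have "(\<Sum>a\<in>I. \<Sum>b\<in>I. if j = m i then x a * (x b * (e a * (e i * F b (m a)))) else 0)
      = - (if j = m i then e i * \<Theta> else 0)"
  proof -
    have "(\<Sum>a\<in>I. \<Sum>b\<in>I. x a * (x b * (e a * (e i * F b (m a)))))
        = (\<Sum>a\<in>I. \<Sum>b\<in>I. x (m a) * (x b * (e (m a) * (e i * F b (m (m a))))))"
      by (rule sum_mirror[symmetric])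
    also have "\<dots> = (\<Sum>a\<in>I. - (e i * (e a * x (m a) * \<eta> a)))"
      by (intro sum.cong refl) (simp add: mirror_mirror e_mirror \<eta>_def sum_distrib_left pull sum_negf)
    finally show ?thesis by (simp add: \<Theta>_def sum_distrib_left sum_negf)
  qed
  finally show ?thesis by simp
qed

text \<open>The coefficient 2 has two sources: the gl_N part of the commutator contributes x_j
  \<Theta> once, and the summand i = m j, where two forms fail to commute by \<Theta>, contributes
  it again.\<close>

lemma \<eta>_\<Theta>:
  assumes j: "j \<in> I"
  shows "\<eta> j * \<Theta> = \<Theta> * \<eta> j + 2 * (x j * \<Theta>)"
proof -
  have "\<eta> j * \<Theta> - \<Theta> * \<eta> j = (\<Sum>i\<in>I. e i * (x (m i) * (\<eta> j * \<eta> i - \<eta> i * \<eta> j)))"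
    unfolding \<Theta>_def by (simp add: sum_distrib_left sum_distrib_right sum_subtractf[symmetric] right_diff_distrib pull)
  also have "\<dots> = (\<Sum>i\<in>I. e i * x (m i) * (x j * \<eta> i)) - (\<Sum>i\<in>I. e i * (x (m i) * (x i * \<eta> j)))
      - (\<Sum>i\<in>I. if i = m j then e i * (x (m i) * (e j * \<Theta>)) else 0)"
    unfolding sum_subtractf[symmetric]
    by (intro sum.cong refl) (simp only: \<eta>_comm[OF j] right_diff_distrib, simp add: mult.assoc)
  also have "(\<Sum>i\<in>I. e i * x (m i) * (x j * \<eta> i)) = x j * \<Theta>"
    by (simp add: \<Theta>_def sum_distrib_left pull)
  also have "(\<Sum>i\<in>I. e i * (x (m i) * (x i * \<eta> j))) = 0"
    by (rule antisym_sum_zero) (simp add: mirror_mirror pull)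
  also have "(\<Sum>i\<in>I. if i = m j then e i * (x (m i) * (e j * \<Theta>)) else 0) = - (x j * \<Theta>)"
    using mirror_in[OF j] j by (simp add: mirror_mirror e_mirror pull)
  finally show ?thesis by (simp add: algebra_simps mult_2)
qed

definition y :: "nat \<Rightarrow> int \<Rightarrow> 'b" where "y j z = \<eta> j + (c + of_int z) * x j"

lemma shift_left: "p * ((c + of_int z) * q) = (c + of_int z) * (p * q)"
  by (metis (no_types, lifting) c_central distrib_left distrib_right mult.assoc mult_of_int_commute)

text \<open>Raising the shift of the second factor by one adds \<eta>_i x_j on one side and \<eta>_j
  x_i on the other. Their difference cancels the gl_N part of \<open>\<eta>_comm\<close>, so only
  \<Theta> survives.\<close>

lemma y_swap:
  assumes "i \<in> I" "j \<in> I"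
  shows "y i z * y j (z + 1) = y j z * y i (z + 1) - (if j = m i then e i * \<Theta> else 0)"
proof -
  define s where "s = c + of_int z"
  have s: "\<eta> a * (s * q) = s * (\<eta> a * q)" "x a * (s * q) = s * (x a * q)" "\<Theta> * (s * q) = s * (\<Theta> * q)" for a q
    unfolding s_def by (rule shift_left)+
  have y: "y j z = \<eta> j + s * x j" "y j (z + 1) = \<eta> j + s * x j + x j" for j
    by (simp_all add: y_def s_def algebra_simps)
  have 1: "\<eta> i * \<eta> j = \<eta> j * \<eta> i + x i * \<eta> j - x j * \<eta> i - (if j = m i then e i * \<Theta> else 0)"
    using \<eta>_comm[OF assms] by (simp add: algebra_simps)
  show ?thesis
    unfolding y using 1 by (simp add: distrib_left distrib_right mult.assoc s x_pull x_commute)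
qed

lemma \<Theta>_y:
  assumes "j \<in> I"
  shows "\<Theta> * y j (z + 2) = y j z * \<Theta>"
proof -
  define s where "s = c + of_int z"
  have s: "\<eta> a * (s * q) = s * (\<eta> a * q)" "x a * (s * q) = s * (x a * q)" "\<Theta> * (s * q) = s * (\<Theta> * q)" for a q
    unfolding s_def by (rule shift_left)+
  have y: "y j z = \<eta> j + s * x j" "y j (z + 2) = \<eta> j + s * x j + 2 * x j" for j
    by (simp_all add: y_def s_def algebra_simps)
  show ?thesis
    unfolding y using \<eta>_\<Theta>[OF assms] by (simp add: distrib_left distrib_right mult.assoc s x_pull x_commute mult_2)
qed

section \<open>Words in the shifted letters\<close>

fun Y :: "int \<Rightarrow> nat list \<Rightarrow> 'b" where
  "Y z [] = 1"
| "Y z (j # w) = y j z * Y (z + 1) w"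

lemma Y_append: "Y z (u @ w) = Y z u * Y (z + int (length u)) w"
  by (induction u arbitrary: z) (simp_all add: mult.assoc add.assoc)

lemma \<Theta>_Y: "set w \<subseteq> I \<Longrightarrow> \<Theta> * Y (z + 2) w = Y z w * \<Theta>"
proof (induction w arbitrary: z)
  case (Cons j w)
  have "\<Theta> * Y (z + 2) (j # w) = y j z * (\<Theta> * Y (z + 1 + 2) w)"
    using \<Theta>_y[of j z] Cons.prems by (simp add: mult.assoc[symmetric] add_ac)
  also have "\<Theta> * Y (z + 1 + 2) w = Y (z + 1) w * \<Theta>"
    by (rule Cons.IH) (use Cons.prems in auto)
  finally show ?case by (simp add: mult.assoc)
qed simp

text \<open>When a mirror pair contracts to \<Theta>, the tail \<open>w\<close> is left two shifts
  too high. Carrying \<Theta> through the tail to the right end closes this gap, so the contracted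
  term is again a word with consecutive shifts.\<close>

lemma Y_swap:
  assumes "set u \<subseteq> I" "set w \<subseteq> I" "i \<in> I" "j \<in> I"
  shows "Y z (u @ i # j # w) = Y z (u @ j # i # w) - (if j = m i then e i * Y z (u @ w) * \<Theta> else 0)"
proof -
  define t where "t = z + int (length u)"
  have "Y z (u @ i # j # w) = Y z u * (y i t * y j (t + 1)) * Y (t + 2) w"
    by (simp add: Y_append t_def mult.assoc add_ac)
  also have "y i t * y j (t + 1) = y j t * y i (t + 1) - (if j = m i then e i * \<Theta> else 0)"
    by (rule y_swap[OF assms(3,4)])
  finally have 1: "Y z (u @ i # j # w) = Y z (u @ j # i # w)
      - (if j = m i then e i * (Y z u * (\<Theta> * Y (t + 2) w)) else 0)"
    by (cases "j = m i") (simp_all add: left_diff_distrib right_diff_distrib mult.assoc Y_append t_def e_left add_ac)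
  show ?thesis unfolding 1 \<Theta>_Y[OF assms(2)] by (simp add: Y_append t_def mult.assoc)
qed

lemma Y_front:
  assumes "set p \<subseteq> I" "set w \<subseteq> I" "a \<in> I" "m a \<notin> set p"
  shows "Y z (p @ a # w) = Y z (a # p @ w)"
  using assms
proof (induction p arbitrary: w rule: rev_induct)
  case (snoc i p)
  have "i \<noteq> m a" "a \<noteq> m i" using snoc.prems mirror_mirror by auto
  then have "Y z (p @ i # a # w) = Y z (p @ a # i # w)"
    using snoc.prems by (subst Y_swap) auto
  then show ?case using snoc by simp
qed simp

text \<open>In the absence of mirror pairs every transposition is exact, so each letter can be
  brought to the front by \<open>Y_front\<close>.\<close>

lemma Y_perm:
  assumes "mset w = mset w'" "set w \<subseteq> I" "\<forall>i\<in>set w. m i \<notin> set w"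
  shows "Y z w = Y z w'"
  using assms
proof (induction w arbitrary: w' z)
  case (Cons a w)
  have "a \<in> set w'" using Cons.prems(1) by (metis list.set_intros(1) set_mset_mset)
  then obtain p q where w': "w' = p @ a # q" by (meson split_list)
  have ms: "mset w = mset (p @ q)" using Cons.prems(1) w' by simp
  have st: "set w' = set (a # w)" using Cons.prems(1) by (metis set_mset_mset)
  have "Y z w' = Y z (a # p @ q)" unfolding w'
    using st Cons.prems w' by (intro Y_front) auto
  also have "\<dots> = Y z (a # w)" using Cons.IH[OF ms] Cons.prems by simp
  finally show ?case by simp
qed simp

end

section \<open>Derivations of a non-commutative ring\<close>

definition derivation :: "('b :: ring_1 \<Rightarrow> 'b) \<Rightarrow> bool"
  where "derivation d \<longleftrightarrow> (\<forall>p q. d (p + q) = d p + d q \<and> d (p * q) = d p * q + p * d q)"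

lemma derivation_simps:
  assumes "derivation d"
  shows "d (p + q) = d p + d q" "d (p * q) = d p * q + p * d q" "d 0 = 0" "d 1 = 0"
    "d (- p) = - d p" "d (p - q) = d p - d q" "d (of_nat k * p) = of_nat k * d p"
    "d (sum f A) = (\<Sum>a\<in>A. d (f a))"
proof -
  show add: "d (p + q) = d p + d q" for p q using assms by (simp add: derivation_def)
  show mul: "d (p * q) = d p * q + p * d q" for p q using assms by (simp add: derivation_def)
  show zero: "d 0 = 0" using add[of 0 0] by simp
  show one: "d 1 = 0" using mul[of 1 1] by simp
  show neg: "d (- p) = - d p" for p using add[of p "- p"] zero by (simp add: eq_neg_iff_add_eq_0 add.commute)
  show "d (p - q) = d p - d q" using add[of p "- q"] neg by simp
  have "d (of_nat k) = 0" for k by (induction k) (simp_all add: add zero one)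
  then show "d (of_nat k * p) = of_nat k * d p" by (simp add: mul)
  show "d (sum f A) = (\<Sum>a\<in>A. d (f a))"
    by (induction A rule: infinite_finite_induct) (simp_all add: add zero)
qed

lemma mset_replicate_removeAll:
  "mset (replicate (count (mset w) a) a @ removeAll a w) = mset w"
  by (induction w) auto

lemma of_nat_left: "p * (of_nat k * q) = of_nat k * (p * q :: 'b :: ring_1)"
  by (metis mult.assoc mult_of_nat_commute)

section \<open>Normally ordered words and the boundary correction\<close>

context sp_relations
begin

abbreviation H :: "nat set" where "H \<equiv> {n + 1..2 * n}"

definition lw :: "nat multiset \<Rightarrow> nat list"
  where "lw M = sorted_list_of_multiset (filter_mset (\<lambda>i. i \<le> n) M)"

definition hw :: "nat multiset \<Rightarrow> nat list"
  where "hw M = sorted_list_of_multiset (filter_mset (\<lambda>i. n < i) M)"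

definition T :: "nat multiset \<Rightarrow> 'b" where "T M = Y 0 (lw M @ hw M)"

text \<open>If \<open>h\<close> does not occur in \<open>M\<close>, the multiset difference is
  \<open>M\<close> itself, but then the factor \<open>count M h\<close> is zero; so the sum is that
  of all h-derivatives of the monomial.\<close>

definition tilde :: "(nat multiset \<Rightarrow> 'b) \<Rightarrow> nat multiset \<Rightarrow> 'b"
  where "tilde G M = G M - (\<Sum>h\<in>H. of_nat (count M h) * (x h * G (M - {#h#})))"

lemma mset_lw: "mset (lw M) = filter_mset (\<lambda>i. i \<le> n) M"
  by (simp add: lw_def)

lemma mset_hw: "mset (hw M) = filter_mset (\<lambda>i. n < i) M"
  by (simp add: hw_def)

lemma mset_lw_hw: "mset (lw M @ hw M) = M"
  by (simp add: mset_lw mset_hw) (metis (mono_tags, lifting) filter_mset_cong multiset_partition not_le)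

lemma set_lw: "set (lw M) = {i \<in> set_mset M. i \<le> n}"
  by (metis mset_lw set_mset_filter set_mset_mset)

lemma set_hw: "set (hw M) = {i \<in> set_mset M. n < i}"
  by (metis mset_hw set_mset_filter set_mset_mset)

lemma Y_perm_low:
  assumes "mset u = mset u'" "set u \<subseteq> {1..n}"
  shows "Y z u = Y z u'"
proof (rule Y_perm[OF assms(1)])
  show "set u \<subseteq> I" using assms(2) by fastforce
  show "\<forall>i\<in>set u. m i \<notin> set u" 
  proof
    fix i assume "i \<in> set u"
    then have "i \<in> {1..n}" using assms(2) by blast
    then have "m i \<notin> {1..n}" by (auto simp: mirror_def)
    then show "m i \<notin> set u" using assms(2) by blast
  qed
qed

lemma Y_perm_high:
  assumes "mset u = mset u'" "set u \<subseteq> H"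
  shows "Y z u = Y z u'"
proof (rule Y_perm[OF assms(1)])
  show "set u \<subseteq> I" using assms(2) by fastforce
  show "\<forall>i\<in>set u. m i \<notin> set u" 
  proof
    fix i assume "i \<in> set u"
    then have "i \<in> H" using assms(2) by blast
    then have "m i \<notin> H" by (auto simp: mirror_def)
    then show "m i \<notin> set u" using assms(2) by blast
  qed
qed

text \<open>Neither half of the index set contains a mirror pair, so the order within each half is
  free. This lemma recognises any word with the low letters in front as a value of
  \<open>T\<close>.\<close>

lemma T_eq:
  assumes u: "set u \<subseteq> {1..n}" and w: "set w \<subseteq> H" and M: "M = mset u + mset w"
  shows "Y 0 (u @ w) = T M"
proof -
  have "filter_mset (\<lambda>i. i \<le> n) (mset u) = mset u" "filter_mset (\<lambda>i. i \<le> n) (mset w) = {#}"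
    "filter_mset (\<lambda>i. n < i) (mset u) = {#}" "filter_mset (\<lambda>i. n < i) (mset w) = mset w"
    using u w by (auto simp: filter_mset_eq_conv)
  then have ms: "mset u = mset (lw M)" "mset w = mset (hw M)"
    unfolding mset_lw mset_hw M by simp_all
  show ?thesis
    unfolding T_def Y_append Y_perm_low[OF ms(1) u] Y_perm_high[OF ms(2) w]
    using mset_eq_length[OF ms(1)] by simp
qed

text \<open>Lower the letters one after the other. Where a letter is replaced by - x_h, the letters
  behind it are still lowered, which is exactly the consecutive numbering of the word without that
  letter. Hence the expansion is exact at first order.\<close>

lemma Y_high_shift:
  assumes "set w \<subseteq> H"
  shows "Y (z - 1) w = Y z w - (\<Sum>h\<in>H. of_nat (count (mset w) h) * (x h * Y z (remove1 h w)))"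
  using assms
proof (induction w arbitrary: z)
  case (Cons j w)
  define S where "S z = (\<Sum>h\<in>H. of_nat (count (mset w) h) * (x h * Y z (remove1 h w)))" for z
  have j: "j \<in> H" and w: "set w \<subseteq> H" using Cons.prems by auto
  have y1: "y j (z - 1) = y j z - x j" by (simp add: y_def algebra_simps)
  have yx: "y j z * (x h * q) = x h * (y j z * q)" for h q by (rule x_left)
  have 1: "of_nat (count (mset (j # w)) h) * (x h * Y z (remove1 h (j # w)))
      = of_nat (count (mset w) h) * (x h * (y j z * Y (z + 1) (remove1 h w))) + (if h = j then x j * Y z w else 0)" for h
  proof (cases "h = j")
    case True
    have "y j z * Y (z + 1) (remove1 j w) = Y z w" if "j \<in> set w"
    proof -
      have "Y z (j # remove1 j w) = Y z w"
        by (rule Y_perm_high) (use that j w in \<open>auto dest: notin_set_remove1\<close>)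
      then show ?thesis by simp
    qed
    moreover have c0: "count (mset w) j = 0" if "j \<notin> set w" using that by simp
    ultimately show ?thesis using True by (cases "j \<in> set w") (simp_all add: distrib_right c0)
  qed simp
  have 2: "(\<Sum>h\<in>H. of_nat (count (mset (j # w)) h) * (x h * Y z (remove1 h (j # w))))
     = y j z * S (z + 1) + x j * Y z w"
    unfolding 1 sum.distrib using j by (simp add: S_def sum_distrib_left of_nat_left yx)
  have IH: "Y z w = Y (z + 1) w - S (z + 1)"
    using Cons.IH[OF w, of "z + 1"] by (simp add: S_def)
  have "Y (z - 1) (j # w) = y j z * Y z w - x j * Y z w"
    by (simp add: y1 left_diff_distrib)
  also have "y j z * Y z w = Y z (j # w) - y j z * S (z + 1)"
    by (subst IH) (simp add: right_diff_distrib)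
  finally show ?case unfolding 2 by (simp add: algebra_simps)
qed simp

text \<open>On the left, the first high letter repeats the shift of the last low letter instead of
  increasing it. This is the effect of subtracting 1 from the diagonal in the last n places.\<close>

lemma tilde_T:
  assumes "set_mset M \<subseteq> I"
  shows "Y 0 (lw M) * Y (int (length (lw M)) - 1) (hw M) = tilde T M"
proof -
  have h: "set (hw M) \<subseteq> H" using assms by (auto simp: set_hw)
  have "Y 0 (lw M) * Y (int (length (lw M)) - 1) (hw M) = T M -
      (\<Sum>h\<in>H. Y 0 (lw M) * (of_nat (count (mset (hw M)) h) * (x h * Y (int (length (lw M))) (remove1 h (hw M)))))"
    unfolding Y_high_shift[OF h] T_def Y_append by (simp add: right_diff_distrib sum_distrib_left)
  also have "(\<Sum>h\<in>H. Y 0 (lw M) * (of_nat (count (mset (hw M)) h) * (x h * Y (int (length (lw M))) (remove1 h (hw M)))))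
     = (\<Sum>h\<in>H. of_nat (count M h) * (x h * T (M - {#h#})))"
  proof (rule sum.cong)
    fix i assume i: "i \<in> H"
    have ct: "count (mset (hw M)) i = count M i" using i by (simp add: mset_hw)
    show "Y 0 (lw M) * (of_nat (count (mset (hw M)) i) * (x i * Y (int (length (lw M))) (remove1 i (hw M))))
        = of_nat (count M i) * (x i * T (M - {#i#}))"
    proof (cases "i \<in># M")
      case True
      then have ih: "i \<in># mset (hw M)" using i by (simp add: mset_hw)
      have "mset (lw M) + mset (remove1 i (hw M)) = mset (lw M @ hw M) - {#i#}"
        using ih by simp
      then have "Y 0 (lw M @ remove1 i (hw M)) = T (M - {#i#})"
        unfolding mset_lw_hw using assms subset_trans[OF set_remove1_subset h, of i]
        by (intro T_eq) (auto simp: set_lw)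
      then show ?thesis unfolding ct by (simp add: Y_append of_nat_left[of "Y 0 (lw M)"] x_left[of "Y 0 (lw M)"])
    next
      case False
      then have "count M i = 0" by (simp add: count_eq_zero_iff)
      then show ?thesis by (simp only: ct of_nat_0 mult_zero_left mult_zero_right)
    qed
  qed simp
  finally show ?thesis by (simp add: tilde_def)
qed

text \<open>Each of the r transpositions of \<open>m h\<close> with a copy of \<open>h\<close>
  contracts one pair. All contractions leave the same word, with r - 1 copies of \<open>h\<close>,
  so they add up to a multiple of r.\<close>

lemma Y_move:
  assumes "set u \<subseteq> I" "set v \<subseteq> I" "h \<in> I"
  shows "Y z (u @ replicate r h @ m h # v)
    = Y z (u @ m h # replicate r h @ v) - of_nat r * (e h * (Y z (u @ replicate (r - 1) h @ v) * \<Theta>))"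
  using assms(2)
proof (induction r arbitrary: v)
  case (Suc r)
  have "Y z ((u @ replicate r h) @ h # m h # v)
      = Y z ((u @ replicate r h) @ m h # h # v) - e h * Y z ((u @ replicate r h) @ v) * \<Theta>"
    by (subst Y_swap) (use assms Suc.prems mirror_in in \<open>auto simp: mirror_mirror split: if_splits\<close>)
  moreover have "Y z (u @ replicate r h @ m h # h # v)
    = Y z (u @ m h # replicate r h @ h # v) - of_nat r * (e h * (Y z (u @ replicate (r - 1) h @ h # v) * \<Theta>))"
    using Suc assms by simp
  moreover have "replicate (Suc r) h @ w = replicate r h @ h # w" for w
    by (simp add: replicate_append_same replicate_app_Cons_same)
  moreover have "of_nat r * (e h * (Y z (u @ replicate (r - 1) h @ h # v) * \<Theta>)) = of_nat r * (e h * (Y z (u @ replicate r h @ v) * \<Theta>))"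
    by (cases r) (simp_all add: replicate_app_Cons_same)
  ultimately show ?case
    by (simp add: algebra_simps mult.assoc del: replicate_Suc)
qed simp

lemma T_y_high:
  assumes "set_mset M \<subseteq> I" "i \<in> H"
  shows "T M * y i (int (size M)) = T (add_mset i M)"
proof -
  have sz: "int (size M) = int (length (lw M @ hw M))" by (metis mset_lw_hw size_mset)
  have "T M * y i (int (size M)) = Y 0 (lw M @ (hw M @ [i]))"
    unfolding sz T_def by (simp add: Y_append mult.assoc)
  also have "\<dots> = T (add_mset i M)"
    using assms mset_lw_hw[of M] by (intro T_eq) (auto simp: set_lw set_hw)
  finally show ?thesis .
qed

text \<open>The appended low letter has to travel to the end of the low block. The only high letter
  that obstructs it is its mirror image \<open>h\<close>; the copies of \<open>h\<close> are
  therefore collected at the front of the high block, and each of them contracts once.\<close>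

lemma T_y_low:
  assumes M: "set_mset M \<subseteq> I" and i: "i \<in> {1..n}"
  shows "T M * y i (int (size M)) = T (add_mset i M) - of_nat (count M (m i)) * (T (M - {#m i#}) * \<Theta>)"
proof -
  define h where "h = m i"
  have h: "h \<in> H" "h \<in> I" "m h = i" "e h = 1" using i by (auto simp: h_def mirror_def e_def)
  define r where "r = count M h"
  define w where "w = removeAll h (hw M)"
  have rr: "r = count (mset (hw M)) h" using h by (simp add: r_def mset_hw)
  have mw: "mset (replicate r h @ w) = mset (hw M)"
    unfolding rr w_def by (rule mset_replicate_removeAll)
  have sw: "set w \<subseteq> H" "set (lw M) \<subseteq> {1..n}" using M by (auto simp: w_def set_hw set_lw)
  have swI: "set w \<subseteq> I" "set (lw M) \<subseteq> I" using sw by fastforce+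
  have sz: "int (size M) = int (length (lw M @ (replicate r h @ w)))"
    using mset_lw_hw[of M] mset_eq_length[OF mw] by (metis length_append size_mset)
  have ms: "M = mset (lw M) + mset (replicate r h @ w)"
    unfolding mw using mset_lw_hw[of M] by simp
  have "T M * y i (int (size M)) = Y 0 (lw M @ (replicate r h @ w)) * y i (int (size M))"
    by (subst T_eq[OF _ _ ms]) (use sw h in auto)
  also have "\<dots> = Y 0 ((lw M @ replicate r h) @ w @ i # [])"
    unfolding sz by (simp add: Y_append mult.assoc add_ac)
  \<comment> \<open>All copies of the mirror image of \<open>i\<close> have been removed from
    \<open>w\<close>, so \<open>i\<close> passes \<open>w\<close> without a contraction.\<close>
  also have "\<dots> = Y 0 (lw M @ replicate r h @ (i # w))"
  proof -
    have "Y (int (length (lw M @ replicate r h))) (w @ i # []) = Y (int (length (lw M @ replicate r h))) (i # w @ [])"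
      by (rule Y_front) (use swI i in \<open>auto simp: w_def h_def\<close>)
    then show ?thesis by (simp only: Y_append append_Nil2 append_assoc) (simp add: Y_append mult.assoc)
  qed
  also have "\<dots> = Y 0 (lw M @ i # replicate r h @ w) - of_nat r * (Y 0 (lw M @ replicate (r - 1) h @ w) * \<Theta>)"
    using Y_move[OF swI(2) swI(1) h(2), of 0 r] h by simp
  also have "Y 0 (lw M @ i # replicate r h @ w) = T (add_mset i M)"
    using T_eq[of "lw M @ [i]" "replicate r h @ w" "add_mset i M"] sw h i ms
    by (simp add: set_replicate_conv_if)
  also have "of_nat r * (Y 0 (lw M @ replicate (r - 1) h @ w) * \<Theta>) = of_nat r * (T (M - {#h#}) * \<Theta>)"
  proof (cases r)
    case (Suc r')
    have "Y 0 (lw M @ replicate (r - 1) h @ w) = T (M - {#h#})"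
      by (rule T_eq) (use sw h in \<open>auto\<close>, subst ms, simp add: Suc)
    then show ?thesis by simp
  qed simp
  finally show ?thesis by (simp add: r_def h_def)
qed

text \<open>Write \<Theta> as a combination of letters and append each letter to \<open>T M\<close>.
  High letters are already in place; the contractions of the low letters add up to precisely the sum
  that \<open>tilde\<close> subtracts.\<close>

lemma tilde_T_\<Theta>:
  assumes M: "set_mset M \<subseteq> I"
  shows "tilde (\<lambda>M. T M * \<Theta>) M = (\<Sum>i\<in>I. e i * (x (m i) * T (add_mset i M)))"
proof -
  define K where "K h = of_nat (count M h) * (x h * (T (M - {#h#}) * \<Theta>))" for h
  \<comment> \<open>The multiples of x_i in the letters cancel by antisymmetry, so every shift z is
    allowed. Below it is \<open>size M\<close>, the next one after the word of
    \<open>M\<close>.\<close>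
  have "(\<Sum>i\<in>I. e i * (x (m i) * y i z)) = \<Theta>" for z
  proof -
    have "(\<Sum>i\<in>I. e i * (x (m i) * ((c + of_int z) * x i))) = (\<Sum>i\<in>I. e i * ((c + of_int z) * (x (m i) * x i)))"
      by (intro sum.cong refl) (simp only: shift_left[of "x _"])
    also have "\<dots> = 0" by (rule antisym_sum_zero) (simp add: mirror_mirror x_commute)
    finally show ?thesis
      by (simp add: \<Theta>_def y_def distrib_left sum.distrib mult.assoc)
  qed
  then have "T M * \<Theta> = T M * (\<Sum>i\<in>I. e i * (x (m i) * y i (int (size M))))" by simp
  also have "\<dots> = (\<Sum>i\<in>I. e i * (x (m i) * (T M * y i (int (size M)))))"
    by (simp add: sum_distrib_left e_left[of "T M"] x_left[of "T M"])
  also have "\<dots> = (\<Sum>i\<in>I. e i * (x (m i) * T (add_mset i M)) + (if i \<le> n then K (m i) else 0))"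
  proof (rule sum.cong)
    fix i assume i: "i \<in> I"
    show "e i * (x (m i) * (T M * y i (int (size M)))) = e i * (x (m i) * T (add_mset i M)) + (if i \<le> n then K (m i) else 0)"
    proof (cases "i \<le> n")
      case True
      then have "e i = -1" by (simp add: e_def)
      then show ?thesis using True i T_y_low[OF M, of i]
        by (simp add: K_def right_diff_distrib of_nat_left)
    qed (use i T_y_high[OF M, of i] in auto)
  qed simp
  also have "\<dots> = (\<Sum>i\<in>I. e i * (x (m i) * T (add_mset i M))) + (\<Sum>i\<in>I. if i \<le> n then K (m i) else 0)"
    by (rule sum.distrib)
  also have "(\<Sum>i\<in>I. if i \<le> n then K (m i) else 0) = (\<Sum>i\<in>I. if m i \<le> n then K (m (m i)) else 0)"
    by (rule sum_mirror[symmetric])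
  also have "\<dots> = (\<Sum>i\<in>I. if i \<in> H then K i else 0)"
    by (rule sum.cong) (simp_all add: mirror_low_iff mirror_mirror)
  also have "\<dots> = (\<Sum>i\<in>H. K i)"
    by (subst sum.inter_restrict[symmetric]) (auto intro: sum.cong)
  finally show ?thesis by (simp add: tilde_def K_def)
qed

end

text \<open>A function \<open>G\<close> on multisets stands for the operator \<open>x\<^sub>M \<mapsto> G M\<close> on polynomials; then
  \<open>subst_index i j G\<close> is \<open>G\<close> composed with \<open>x\<^sub>j \<partial>\<^sub>i\<close>.\<close>

definition subst_index :: "nat \<Rightarrow> nat \<Rightarrow> (nat multiset \<Rightarrow> 'b :: ring_1) \<Rightarrow> nat multiset \<Rightarrow> 'b"
  where "subst_index i j G M = of_nat (count M i) * G (add_mset j (M - {#i#}))"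

text \<open>The arithmetic of the induction steps of \<open>derivation_Y_low\<close> and
  \<open>derivation_Y_high\<close>: \<open>A\<close> is the contracted word times \<Theta>,
  \<open>B\<close> the word with the mirrored letter in its final place, and \<open>w\<close> the
  number k (k - 1) accumulated so far.\<close>

lemma combine_moves:
  fixes A B :: "'b :: ring_1"
  shows "- 2 * (B - of_nat k * A) + (of_nat w * A - 2 * (of_nat k * B)) = of_nat (2 * k + w) * A - 2 * (of_nat (Suc k) * B)"
  using of_nat_left[of 2 k A] by (simp add: algebra_simps)

section \<open>Derivations of normally ordered words\<close>

context sp_relations
begin

text \<open>By Leibniz each occurrence of \<open>a\<close> is replaced by \<open>b\<close> in turn.
  Inside a class without mirror pairs the place of the replacement is irrelevant, so all occurrences
  give the same word and only their number remains.\<close>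

lemma derivation_Y_class:
  assumes d: "derivation d"
    and A: "A \<subseteq> I" "\<And>i. i \<in> A \<Longrightarrow> m i \<notin> A"
    and ab: "a \<in> A" "b \<in> A"
    and dy: "\<And>j z. j \<in> A \<Longrightarrow> d (y j z) = (if j = a then of_int \<kappa> * y b z else 0)"
    and w: "set w \<subseteq> A"
  shows "d (Y z w) = of_int \<kappa> * (of_nat (count (mset w) a) * Y z (b # remove1 a w))"
  using w
proof (induction w arbitrary: z)
  case Nil
  then show ?case by (simp add: derivation_simps[OF d])
next
  case (Cons j w)
  have w: "set w \<subseteq> A" "j \<in> A" using Cons.prems by auto
  have perm: "Y z u = Y z u'" if "mset u = mset u'" "set u \<subseteq> A" for u u' z
    by (rule Y_perm) (use that A in auto)
  have c0: "count (mset w) a = 0" if "a \<notin> set w" using that by simp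
  have "y j z * d (Y (z + 1) w) = of_int \<kappa> * (of_nat (count (mset w) a) * Y z (j # b # remove1 a w))"
    unfolding Cons.IH[OF w(1)] by (simp add: of_nat_left mult.assoc[symmetric] mult_of_int_commute[symmetric])
      (simp add: mult.assoc of_nat_left)
  also have "\<dots> = of_int \<kappa> * (of_nat (count (mset w) a) * Y z (b # (if j = a then w else j # remove1 a w)))"
  proof (cases "a \<in> set w")
    case True
    have "Y z (j # b # remove1 a w) = Y z (b # (if j = a then w else j # remove1 a w))"
      by (rule perm) (use True w ab set_remove1_subset[of a w] in \<open>auto simp: insert_DiffM\<close>)
    then show ?thesis by simp
  qed (simp add: c0)
  finally show ?case
    using w by (simp add: derivation_simps[OF d] dy distrib_left distrib_right mult.assoc)
qed

lemma Y_remove_append: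
  assumes "set_mset M \<subseteq> I" "0 < count M a" "b \<in> I" "a \<le> n \<longleftrightarrow> b \<le> n"
  shows "Y 0 ((if a \<le> n then b # remove1 a (lw M) else lw M) @ (if a \<le> n then hw M else b # remove1 a (hw M)))
    = T (add_mset b (M - {#a#}))"
proof (rule T_eq)
  have aM: "a \<in># M" using assms(2) by simp
  have l: "set (lw M) \<subseteq> {1..n}" and h: "set (hw M) \<subseteq> H" using assms(1) by (auto simp: set_lw set_hw)
  show "set (if a \<le> n then b # remove1 a (lw M) else lw M) \<subseteq> {1..n}"
    "set (if a \<le> n then hw M else b # remove1 a (hw M)) \<subseteq> H"
    using assms l h subset_trans[OF set_remove1_subset l, of a] subset_trans[OF set_remove1_subset h, of a] by auto
  have "M = mset (lw M) + mset (hw M)" using mset_lw_hw[of M] by simp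
  moreover have "a \<le> n \<Longrightarrow> a \<in># mset (lw M)" "\<not> a \<le> n \<Longrightarrow> a \<in># mset (hw M)"
    using aM by (simp_all add: mset_lw mset_hw)
  ultimately have "M - {#a#} = mset (if a \<le> n then remove1 a (lw M) else lw M) + mset (if a \<le> n then hw M else remove1 a (hw M))"
    by (cases "a \<le> n") (simp_all add: diff_union_single_conv add.commute[of _ "mset (hw M)"])
  then show "add_mset b (M - {#a#}) = mset (if a \<le> n then b # remove1 a (lw M) else lw M)
      + mset (if a \<le> n then hw M else b # remove1 a (hw M))"
    by auto
qed

text \<open>The two substitutions, a by b and m b by m a, respect the halves. No letter crosses the
  boundary, hence no contraction occurs and the result is a combination of values of
  \<open>T\<close>.\<close>

lemma derivation_T_levi:
  assumes d: "derivation d" and a: "a \<in> {1..n}" and b: "b \<in> {1..n}"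
    and dy: "\<And>j z. j \<in> I \<Longrightarrow> d (y j z) = (if j = m b then y (m a) z else 0) - (if j = a then y b z else 0)"
    and M: "set_mset M \<subseteq> I"
  shows "d (T M) = subst_index (m b) (m a) T M - subst_index a b T M"
proof -
  have mab: "m a \<in> H" "m b \<in> H" "m a \<in> I" "m b \<in> I" using a b by (auto simp: mirror_def)
  have abI: "a \<in> I" "b \<in> I" using a b by auto
  have l: "set (lw M) \<subseteq> {1..n}" and h: "set (hw M) \<subseteq> H" using M by (auto simp: set_lw set_hw)
  have 1: "d (Y z (lw M)) = of_int (-1) * (of_nat (count (mset (lw M)) a) * Y z (b # remove1 a (lw M)))" for z
    by (rule derivation_Y_class[OF d _ _ a b _ l]) (use mab in \<open>auto simp: dy\<close>, auto simp: mirror_def)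
  have 2: "d (Y z (hw M)) = of_int 1 * (of_nat (count (mset (hw M)) (m b)) * Y z (m a # remove1 (m b) (hw M)))" for z
    by (rule derivation_Y_class[OF d _ _ mab(2,1) _ h]) (use a in \<open>auto simp: dy\<close>, auto simp: mirror_def)
  have ct: "count (mset (lw M)) a = count M a" "count (mset (hw M)) (m b) = count M (m b)"
    using a mab by (simp_all add: mset_lw mset_hw)
  have A: "of_nat (count M a) * (Y 0 (b # remove1 a (lw M)) * Y (int (length (lw M))) (hw M)) = subst_index a b T M"
  proof (cases "count M a = 0")
    case False
    then have "a \<in> set (lw M)" using a by (auto simp: set_lw)
    \<comment> \<open>Replacing \<open>a\<close> by \<open>b\<close> keeps the length of the low
      word, so the high word retains its starting shift.\<close>
    then have "Y 0 (b # remove1 a (lw M)) * Y (int (length (lw M))) (hw M) = Y 0 ((b # remove1 a (lw M)) @ hw M)"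
      using length_pos_if_in_set[of a "lw M"] by (subst Y_append) (simp add: length_remove1 of_nat_diff Suc_le_eq)
    then show ?thesis using Y_remove_append[OF M _ abI(2), of a] False a b by (simp add: subst_index_def)
  qed (simp only: subst_index_def of_nat_0 mult_zero_left)
  have B: "of_nat (count M (m b)) * (Y 0 (lw M) * Y (int (length (lw M))) (m a # remove1 (m b) (hw M))) = subst_index (m b) (m a) T M"
  proof (cases "count M (m b) = 0")
    case False
    then show ?thesis using Y_remove_append[OF M _ mab(3), of "m b"] False mab
      by (simp add: subst_index_def Y_append del: Y.simps)
  qed (simp only: subst_index_def of_nat_0 mult_zero_left)
  have "d (T M) = of_nat (count M (m b)) * (Y 0 (lw M) * Y (int (length (lw M))) (m a # remove1 (m b) (hw M)))
      - of_nat (count M a) * (Y 0 (b # remove1 a (lw M)) * Y (int (length (lw M))) (hw M))"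
    unfolding T_def Y_append derivation_simps(2)[OF d] 1 2 ct
    by (simp add: of_nat_left[of "Y 0 (lw M)"] mult.assoc del: Y.simps)
  then show ?thesis unfolding A B .
qed

text \<open>Each mirrored letter is moved to the right end of the block, towards the high letters,
  and contracts with every \<open>a\<close> behind it. This happens 0 + 1 + ... + (k - 1) times, and
  the factor 2, which stems from F_aa' = 2 E_aa', turns the total into k (k - 1).\<close>

lemma derivation_Y_low:
  assumes d: "derivation d" and a: "a \<in> {1..n}"
    and dy: "\<And>z. d (y a z) = - 2 * y (m a) z"
  shows "d (Y z (replicate k a)) = of_nat (k * (k - 1)) * (Y z (replicate (k - 2) a) * \<Theta>)
    - 2 * (of_nat k * Y z (replicate (k - 1) a @ [m a]))"
proof (induction k arbitrary: z)
  case 0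
  then show ?case by (simp add: derivation_simps[OF d])
next
  case (Suc k)
  have aI: "a \<in> I" "m a \<in> I" using a by (auto simp: mirror_def)
  have ea: "e a = -1" using a by (simp add: e_def)
  have swap: "Y z (m a # replicate k a) = Y z (replicate k a @ [m a]) - of_nat k * (Y z (replicate (k - 1) a) * \<Theta>)"
    using Y_move[of "[]" "[]" a z k] aI ea by simp
  have 1: "y a z * (of_nat k * Y (z + 1) (replicate (k - 1) a @ [m a])) = of_nat k * Y z (replicate k a @ [m a])"
    by (cases k) (simp_all add: of_nat_left[of "y a z"] del: of_nat_Suc)
  have 2: "y a z * (of_nat (k * (k - 1)) * (Y (z + 1) (replicate (k - 2) a) * \<Theta>))
     = of_nat (k * (k - 1)) * (Y z (replicate (k - 1) a) * \<Theta>)"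
  proof (cases "k \<le> 1")
    case False
    then obtain l where "k = Suc (Suc l)" by (metis One_nat_def Suc_le_D not_le not_less_eq_eq)
    then show ?thesis by (simp only: of_nat_left[of "y a z"]) (simp add: mult.assoc)
  qed (auto simp: le_Suc_eq)
  have "d (Y z (replicate (Suc k) a)) = - 2 * Y z (m a # replicate k a) + y a z * d (Y (z + 1) (replicate k a))"
    by (simp add: derivation_simps[OF d] dy mult.assoc)
  also have "y a z * d (Y (z + 1) (replicate k a))
      = of_nat (k * (k - 1)) * (Y z (replicate (k - 1) a) * \<Theta>) - 2 * (of_nat k * Y z (replicate k a @ [m a]))"
    unfolding Suc.IH right_diff_distrib 2 1[symmetric] using of_nat_left[of "y a z" 2] by simp
  finally have step: "d (Y z (replicate (Suc k) a)) = of_nat (2 * k + k * (k - 1)) * (Y z (replicate (k - 1) a) * \<Theta>)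
    - 2 * (of_nat (Suc k) * Y z (replicate k a @ [m a]))"
    unfolding swap combine_moves .
  have "2 * k + k * (k - 1) = Suc k * (Suc k - 1)" by (cases k) (simp_all add: algebra_simps)
  then show ?case unfolding step by (simp only: diff_Suc_1 Suc_1[symmetric] diff_Suc_Suc diff_zero One_nat_def)
qed

text \<open>The counterpart for high letters: the mirrored letter is low and moves to the left end
  of the block. Direction and the sign \<open>e a\<close> are both reversed, so the outcome has the
  same sign; the induction peels off the last letter instead of the first.\<close>

lemma derivation_Y_high:
  assumes d: "derivation d" and a: "a \<in> H"
    and dy: "\<And>z. d (y a z) = - 2 * y (m a) z"
  shows "d (Y z (replicate k a)) = of_nat (k * (k - 1)) * (Y z (replicate (k - 2) a) * \<Theta>)
    - 2 * (of_nat k * Y z (m a # replicate (k - 1) a))"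
proof (induction k)
  case 0
  then show ?case by (simp add: derivation_simps[OF d])
next
  case (Suc k)
  have aI: "a \<in> I" "m a \<in> I" using a by (auto simp: mirror_def)
  have ea: "e a = 1" using a by (simp add: e_def)
  have app: "replicate (Suc k) a = replicate k a @ [a]" by (simp add: replicate_append_same)
  have swap: "Y z (replicate k a @ [m a]) = Y z (m a # replicate k a) - of_nat k * (Y z (replicate (k - 1) a) * \<Theta>)"
    using Y_move[of "[]" "[]" a z k] aI ea by simp
  have 1: "of_nat k * Y z (m a # replicate (k - 1) a) * y a (z + int k) = of_nat k * Y z (m a # replicate k a)"
  proof (cases k)
    case (Suc l)
    have "Y z (m a # replicate l a @ [a]) = Y z (m a # replicate l a) * y a (z + int k)"
      using Y_append[of z "m a # replicate l a" "[a]"] Suc by (simp add: mult.assoc add_ac)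
    then show ?thesis using Suc by (simp add: mult.assoc replicate_append_same del: Y.simps)
  qed simp
  have 2: "of_nat (k * (k - 1)) * (Y z (replicate (k - 2) a) * \<Theta>) * y a (z + int k)
     = of_nat (k * (k - 1)) * (Y z (replicate (k - 1) a) * \<Theta>)"
  proof (cases "k \<le> 1")
    case False
    then obtain l where k: "k = Suc (Suc l)" by (metis One_nat_def Suc_le_D not_le not_less_eq_eq)
    \<comment> \<open>Here k = l + 2: passing \<Theta> lowers the last letter to the shift that
      continues a word of l letters.\<close>
    have "\<Theta> * y a (z + int k) = y a (z + int l) * \<Theta>"
      using \<Theta>_y[OF aI(1), of "z + int l"] k by (simp add: add_ac)
    moreover have "Y z (replicate (Suc l) a) = Y z (replicate l a) * y a (z + int l)"
      using Y_append[of z "replicate l a" "[a]"] by (simp add: replicate_append_same del: Y.simps(2)) simp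
    ultimately show ?thesis using k by (simp add: mult.assoc del: Y.simps replicate_Suc)
  qed (auto simp: le_Suc_eq)
  have "d (Y z (replicate (Suc k) a)) = d (Y z (replicate k a)) * y a (z + int k) - 2 * Y z (replicate k a @ [m a])"
    unfolding app Y_append using of_nat_left[of "Y z (replicate k a)" 2]
    by (simp add: derivation_simps[OF d] dy mult.assoc)
  also have "d (Y z (replicate k a)) * y a (z + int k)
      = of_nat (k * (k - 1)) * (Y z (replicate (k - 1) a) * \<Theta>) - 2 * (of_nat k * Y z (m a # replicate k a))"
    unfolding Suc.IH left_diff_distrib 2 mult.assoc[of 2] 1 ..
  also have "\<dots> - 2 * Y z (replicate k a @ [m a]) = - 2 * Y z (replicate k a @ [m a]) + \<dots>" by simp
  finally have step: "d (Y z (replicate (Suc k) a)) = of_nat (2 * k + k * (k - 1)) * (Y z (replicate (k - 1) a) * \<Theta>)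
    - 2 * (of_nat (Suc k) * Y z (m a # replicate k a))"
    unfolding swap combine_moves .
  have "2 * k + k * (k - 1) = Suc k * (Suc k - 1)" by (cases k) (simp_all add: algebra_simps)
  then show ?case unfolding step by (simp only: diff_Suc_1 Suc_1[symmetric] diff_Suc_Suc diff_zero One_nat_def)
qed

text \<open>Composing with x_j d_i commutes with the correction Sum_h x_h G d_h except for the
  Leibniz term of d_h x_j at h = j. That term exists only for a high index j.\<close>

lemma tilde_subst_index:
  assumes i: "i \<in> I" and j: "j \<in> I"
  shows "tilde (subst_index i j G) M = subst_index i j (tilde G) M
    + (if n < j then of_nat (count M i) * (x j * G (M - {#i#})) else 0)"
proof (cases "i \<in># M")
  case False
  then have 0: "count M i = 0" by (simp add: count_eq_zero_iff)
  then have "count (M - {#h#}) i = 0" for h by simp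
  with 0 have "count M i = 0" "\<And>h. count (M - {#h#}) i = 0" .
  then show ?thesis by (simp add: tilde_def subst_index_def)
next
  case True
  then obtain N where M: "M = add_mset i N" by (metis insert_DiffM)
  define k where "k = count N i"
  have ct: "of_nat (count M h) * (x h * subst_index i j G (M - {#h#}))
      = of_nat (Suc k) * (of_nat (count (add_mset j N) h) * (x h * G (add_mset j N - {#h#})))
        - (if h = j then of_nat (Suc k) * (x j * G N) else 0)" for h
  proof (cases "h = i")
    case True
    have "add_mset j (N - {#i#}) = add_mset j N - {#i#}" if "k > 0"
      using that unfolding k_def by (intro multiset_eqI) auto
    then have s: "subst_index i j G (M - {#i#}) = of_nat k * G (add_mset j N - {#i#})"
      by (cases "k = 0") (simp_all add: subst_index_def M k_def)
    have "count M i = Suc k" "count (add_mset j N) i = (if i = j then Suc k else k)"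
      by (simp_all add: M k_def)
    then show ?thesis
      unfolding True s by (cases "i = j") (simp_all add: of_nat_left[of "x _"] distrib_left distrib_right)
  next
    case hi: False
    show ?thesis
    proof (cases "h \<in># N")
      case True
      then obtain N' where N: "N = add_mset h N'" by (metis insert_DiffM)
      have "count (M - {#h#}) i = Suc k" using hi by (simp add: M k_def)
      moreover have "add_mset j (M - {#h#} - {#i#}) = add_mset j N - {#h#}"
        using hi by (intro multiset_eqI) (auto simp: M N)
      ultimately have s: "subst_index i j G (M - {#h#}) = of_nat (Suc k) * G (add_mset j N - {#h#})"
        by (simp only: subst_index_def)
      have "count M h = count N h" "count (add_mset j N) h = (if h = j then Suc (count N h) else count N h)"
        using hi by (simp_all add: M)
      then show ?thesis
        unfolding s using of_nat_left[of "of_nat (count N h)" "Suc k"]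
        by (cases "h = j") (simp_all add: of_nat_left[of "x _"] distrib_left distrib_right)
    next
      case False
      then have "count N h = 0" by (simp add: count_eq_zero_iff)
      moreover have "add_mset j N - {#h#} = N" if "h = j" using that by simp
      ultimately show ?thesis using hi by (cases "h = j") (simp_all add: M)
    qed
  qed
  have "tilde (subst_index i j G) M = of_nat (Suc k) * G (add_mset j N)
     - (of_nat (Suc k) * (\<Sum>h\<in>H. of_nat (count (add_mset j N) h) * (x h * G (add_mset j N - {#h#})))
        - (\<Sum>h\<in>H. if h = j then of_nat (Suc k) * (x j * G N) else 0))"
    unfolding tilde_def ct sum_subtractf sum_distrib_left by (simp add: subst_index_def M k_def)
  also have "(\<Sum>h\<in>H. if h = j then of_nat (Suc k) * (x j * G N) else 0) = (if n < j then of_nat (Suc k) * (x j * G N) else 0)"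
    using j by simp
  finally show ?thesis
    unfolding subst_index_def tilde_def by (simp add: M k_def right_diff_distrib del: of_nat_Suc)
qed

lemma derivation_tilde:
  assumes d: "derivation d"
  shows "d (tilde G M) = tilde (\<lambda>M. d (G M)) M - (\<Sum>h\<in>H. of_nat (count M h) * (d (x h) * G (M - {#h#})))"
  unfolding tilde_def derivation_simps(6,7,8)[OF d] unfolding derivation_simps(2)[OF d]
  by (simp add: distrib_left sum.distrib)

lemma tilde_diff: "tilde (\<lambda>M. G M - G' M) M = tilde G M - tilde G' M"
  by (simp add: tilde_def right_diff_distrib sum_subtractf)

lemma tilde_2: "tilde (\<lambda>M. 2 * G M) M = 2 * tilde G M"
  by (simp add: tilde_def mult_2 distrib_left sum.distrib)


lemma tilde_cong: "(\<And>N. N \<subseteq># M \<Longrightarrow> G N = G' N) \<Longrightarrow> tilde G M = tilde G' M"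
  by (simp add: tilde_def)

lemma derivation_Y_zero:
  assumes d: "derivation d" and "\<And>j z. j \<in> set w \<Longrightarrow> d (y j z) = 0"
  shows "d (Y z w) = 0"
  using assms(2) by (induction w arbitrary: z) (simp_all add: derivation_simps[OF d])

text \<open>Only the block of copies of \<open>a\<close> is affected. The \<Theta> produced there
  moves through \<open>q\<close> to the right end, which undoes the excess of two in the shifts of
  \<open>q\<close>.\<close>

lemma derivation_Y_long:
  assumes d: "derivation d" and a: "a \<in> I"
    and dy: "\<And>j z. j \<in> I \<Longrightarrow> d (y j z) = (if j = a then - 2 * y (m a) z else 0)"
    and p: "set p \<subseteq> I - {a}" and q: "set q \<subseteq> I - {a}"
  shows "d (Y 0 (p @ replicate k a @ q)) = of_nat (k * (k - 1)) * (Y 0 (p @ replicate (k - 2) a @ q) * \<Theta>)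
    - 2 * (of_nat k * Y 0 (p @ (if a \<le> n then replicate (k - 1) a @ [m a] else m a # replicate (k - 1) a) @ q))"
proof -
  define r where "r = (if a \<le> n then replicate (k - 1) a @ [m a] else m a # replicate (k - 1) a)"
  define z where "z = int (length p)"
  have dr: "d (Y z (replicate k a)) = of_nat (k * (k - 1)) * (Y z (replicate (k - 2) a) * \<Theta>) - 2 * (of_nat k * Y z r)" for z
    using derivation_Y_low[OF d, where a = a and k = k and z = z] derivation_Y_high[OF d, where a = a and k = k and z = z] a by (cases "a \<le> n") (auto simp: dy r_def)
  have dz: "d (y j z) = 0" if "j \<in> I - {a}" for j z
    using that dy[of j z] by auto
  have d0: "d (Y z p) = 0" "d (Y z q) = 0" for z
    by (rule derivation_Y_zero[OF d], rule dz, use p q in blast)+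
  have "d (Y 0 (p @ replicate k a @ q)) = Y 0 p * (d (Y z (replicate k a)) * Y (z + int k) q)"
    by (simp add: Y_append derivation_simps(2)[OF d] d0 z_def mult.assoc)
  also have "\<dots> = of_nat (k * (k - 1)) * (Y 0 p * (Y z (replicate (k - 2) a) * (\<Theta> * Y (z + int k) q)))
      - 2 * (of_nat k * (Y 0 p * (Y z r * Y (z + int k) q)))"
    unfolding dr left_diff_distrib right_diff_distrib mult.assoc of_nat_left[of "Y 0 p"]
    using of_nat_left[of "Y 0 p" 2] by (simp add: of_nat_left[of "Y 0 p"])
  also have "of_nat (k * (k - 1)) * (Y 0 p * (Y z (replicate (k - 2) a) * (\<Theta> * Y (z + int k) q)))
      = of_nat (k * (k - 1)) * (Y 0 (p @ replicate (k - 2) a @ q) * \<Theta>)"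
  proof (cases "k \<le> 1")
    case False
    then have "z + int k = z + int (k - 2) + 2" by (simp add: of_nat_diff)
    moreover have "\<Theta> * Y (z + int (k - 2) + 2) q = Y (z + int (k - 2)) q * \<Theta>"
      by (rule \<Theta>_Y) (use q in auto)
    ultimately have "\<Theta> * Y (z + int k) q = Y (z + int (k - 2)) q * \<Theta>" by (simp only:)
    then show ?thesis by (simp add: Y_append z_def mult.assoc)
  qed (auto simp: le_Suc_eq)
  also have "of_nat k * (Y 0 p * (Y z r * Y (z + int k) q)) = of_nat k * Y 0 (p @ r @ q)"
  proof (cases "k = 0")
    case False
    then have "int (length r) = int k" by (auto simp: r_def)
    then show ?thesis by (simp add: Y_append z_def)
  qed simp
  finally show ?thesis by (simp only: r_def)
qed

text \<open>All copies of \<open>a\<close> can be gathered next to the boundary between the low and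
  the high word. The mirrored letter then leaves the block on the side of the boundary where it
  belongs, so every resulting word is normally ordered.\<close>

lemma derivation_T_long:
  assumes d: "derivation d" and a: "a \<in> I"
    and dy: "\<And>j z. j \<in> I \<Longrightarrow> d (y j z) = (if j = a then - 2 * y (m a) z else 0)"
    and M: "set_mset M \<subseteq> I"
  shows "d (T M) = of_nat (count M a * (count M a - 1)) * (T (M - {#a, a#}) * \<Theta>) - 2 * subst_index a (m a) T M"
proof -
  define k where "k = count M a"
  define u where "u = removeAll a (lw M)"
  define w where "w = removeAll a (hw M)"
  have uw: "set u \<subseteq> {1..n} - {a}" "set w \<subseteq> H - {a}" using M by (auto simp: u_def w_def set_lw set_hw)
  have uwI: "set u \<subseteq> I - {a}" "set w \<subseteq> I - {a}" using uw by fastforce+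
  have "mset u + mset w = filter_mset (\<lambda>i. i \<noteq> a) (mset (lw M @ hw M))"
    by (simp add: u_def w_def removeAll_filter_not_eq neq_commute)
  then have "mset u + mset w = filter_mset (\<lambda>i. i \<noteq> a) M" unfolding mset_lw_hw .
  then have Muw: "M = mset u + mset w + replicate_mset k a"
    unfolding k_def by (metis filter_eq_replicate_mset multiset_partition add.commute)
  have mem: "m a \<in> I" "a \<le> n \<Longrightarrow> m a \<in> H" "\<not> a \<le> n \<Longrightarrow> m a \<in> {1..n}" using a by (auto simp: mirror_def)
  have word: "Y 0 (u @ replicate l a @ w) = T (mset u + mset w + replicate_mset l a)" for l
  proof (cases "a \<le> n")
    case True
    then have "Y 0 ((u @ replicate l a) @ w) = T (mset (u @ replicate l a) + mset w)"
      using uw a by (intro T_eq) (auto simp: set_replicate_conv_if)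
    then show ?thesis by (simp add: add_ac)
  next
    case False
    then have "Y 0 (u @ (replicate l a @ w)) = T (mset u + mset (replicate l a @ w))"
      using uw a by (intro T_eq) (auto simp: set_replicate_conv_if)
    then show ?thesis by (simp add: add_ac)
  qed
  have word': "Y 0 (u @ (if a \<le> n then replicate l a @ [m a] else m a # replicate l a) @ w)
      = T (add_mset (m a) (mset u + mset w + replicate_mset l a))" for l
  proof (cases "a \<le> n")
    case True
    then have "Y 0 ((u @ replicate l a) @ (m a # w)) = T (mset (u @ replicate l a) + mset (m a # w))"
      using uw a mem by (intro T_eq) (auto simp: set_replicate_conv_if)
    then show ?thesis using True by (simp add: add_ac)
  next
    case False
    then have "Y 0 ((u @ [m a]) @ (replicate l a @ w)) = T (mset (u @ [m a]) + mset (replicate l a @ w))"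
      using uw a mem by (intro T_eq) (auto simp: set_replicate_conv_if)
    then show ?thesis using False by (simp add: add_ac del: Y.simps)
  qed
  have M1: "M - {#a#} = mset u + mset w + replicate_mset (k - 1) a" if "k > 0"
    using that by (subst Muw) (cases k; simp)
  have M2: "M - {#a, a#} = mset u + mset w + replicate_mset (k - 2) a" if "k \<noteq> 0" "k \<noteq> 1"
  proof -
    have "replicate_mset k a = replicate_mset (k - 2) a + {#a, a#}"
      using that by (intro multiset_eqI) auto
    then have "M = mset u + mset w + replicate_mset (k - 2) a + {#a, a#}"
      using Muw by (simp only: add.assoc)
    then show ?thesis by (metis add_diff_cancel_right')
  qed
  have "d (T M) = d (Y 0 (u @ replicate k a @ w))" unfolding word Muw[symmetric] ..
  also have "\<dots> = of_nat (k * (k - 1)) * (T (mset u + mset w + replicate_mset (k - 2) a) * \<Theta>)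
     - 2 * (of_nat k * T (add_mset (m a) (mset u + mset w + replicate_mset (k - 1) a)))"
    by (subst derivation_Y_long[OF d a dy uwI]) (simp_all only: word word')
  also have "of_nat (k * (k - 1)) * (T (mset u + mset w + replicate_mset (k - 2) a) * \<Theta>) = of_nat (k * (k - 1)) * (T (M - {#a, a#}) * \<Theta>)"
  proof (cases "k = 0 \<or> k = 1")
    case False
    then show ?thesis using M2 by (simp only: de_Morgan_disj simp_thms)
  qed auto
  also have "of_nat k * T (add_mset (m a) (mset u + mset w + replicate_mset (k - 1) a)) = subst_index a (m a) T M"
  proof (cases "k = 0")
    case False
    then show ?thesis using M1 by (simp only: subst_index_def k_def[symmetric] neq0_conv)
  qed (simp add: subst_index_def k_def[symmetric])
  finally show ?thesis by (simp only: k_def)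
qed

text \<open>In operator terms \<open>tilde\<close> commutes with composition by the second
  derivative with respect to x_a, since partial derivatives commute.\<close>

lemma tilde_double:
  "tilde (\<lambda>M. of_nat (count M a * (count M a - 1)) * G (M - {#a, a#})) M
    = of_nat (count M a * (count M a - 1)) * tilde G (M - {#a, a#})"
proof -
  have "of_nat (count M h) * (x h * (of_nat (count (M - {#h#}) a * (count (M - {#h#}) a - 1)) * G (M - {#h#} - {#a, a#})))
      = of_nat (count M a * (count M a - 1)) * (of_nat (count (M - {#a, a#}) h) * (x h * G (M - {#a, a#} - {#h#})))" for h
  proof -
    have "count M h * (count (M - {#h#}) a * (count (M - {#h#}) a - 1)) = count M a * (count M a - 1) * count (M - {#a, a#}) h"
      by (cases "h = a") (auto simp: numeral_2_eq_2)
    then have "of_nat (count M h) * (of_nat (count (M - {#h#}) a * (count (M - {#h#}) a - 1)) * q)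
      = of_nat (count M a * (count M a - 1)) * (of_nat (count (M - {#a, a#}) h) * q)" for q :: 'b
      by (metis of_nat_mult mult.assoc)
    then show ?thesis
      by (simp only: of_nat_left[of "x h"] diff_right_commute[of M "{#h#}"])
  qed
  then show ?thesis
    by (simp only: tilde_def right_diff_distrib sum_distrib_left)
qed

lemma subset_I: "\<lbrakk>N \<subseteq># M; set_mset M \<subseteq> I\<rbrakk> \<Longrightarrow> set_mset N \<subseteq> I"
  using set_mset_mono by blast

text \<open>The first sum is the \<Theta> term of \<open>derivation_T_long\<close>, rewritten by
  \<open>tilde_T_\<Theta>\<close>. The last term is what remains because the correction in
  \<open>tilde\<close> is not compatible with a substitution that exchanges the halves.\<close>

lemma derivation_tilde_T_long:
  assumes d: "derivation d" and a: "a \<in> I"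
    and dy: "\<And>j z. j \<in> I \<Longrightarrow> d (y j z) = (if j = a then - 2 * y (m a) z else 0)"
    and dx: "\<And>j. j \<in> I \<Longrightarrow> d (x j) = (if j = a then - 2 * x (m a) else 0)"
    and M: "set_mset M \<subseteq> I"
  shows "d (tilde T M) + 2 * subst_index a (m a) (tilde T) M
    = of_nat (count M a * (count M a - 1)) * (\<Sum>i\<in>I. e i * (x (m i) * T (add_mset i (M - {#a, a#}))))
      + 2 * (e a * (of_nat (count M a) * (x (m a) * T (M - {#a#}))))"
proof -
  define Z where "Z = of_nat (count M a) * (x (m a) * T (M - {#a#}))"
  have "tilde (\<lambda>M. d (T M)) M = tilde (\<lambda>M. of_nat (count M a * (count M a - 1)) * (T (M - {#a, a#}) * \<Theta>) - 2 * subst_index a (m a) T M) M"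
    by (rule tilde_cong) (rule derivation_T_long[OF d a dy subset_I[OF _ M]])
  also have "\<dots> = of_nat (count M a * (count M a - 1)) * tilde (\<lambda>M. T M * \<Theta>) (M - {#a, a#}) - 2 * tilde (subst_index a (m a) T) M"
    unfolding tilde_diff tilde_2 tilde_double[of a "\<lambda>M. T M * \<Theta>" M] ..
  also have "tilde (\<lambda>M. T M * \<Theta>) (M - {#a, a#}) = (\<Sum>i\<in>I. e i * (x (m i) * T (add_mset i (M - {#a, a#}))))"
    by (rule tilde_T_\<Theta>) (use M in \<open>auto dest: in_diffD\<close>)
  also have "tilde (subst_index a (m a) T) M = subst_index a (m a) (tilde T) M + (if n < m a then Z else 0)"
    unfolding Z_def by (rule tilde_subst_index[OF a mirror_in[OF a]])
  finally have 1: "tilde (\<lambda>M. d (T M)) M = of_nat (count M a * (count M a - 1)) * (\<Sum>i\<in>I. e i * (x (m i) * T (add_mset i (M - {#a, a#}))))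
    - 2 * (subst_index a (m a) (tilde T) M + (if n < m a then Z else 0))" .
  have "(\<Sum>h\<in>H. of_nat (count M h) * (d (x h) * T (M - {#h#}))) = (\<Sum>h\<in>H. if h = a then - 2 * Z else 0)"
    by (rule sum.cong) (auto simp: dx Z_def mult.assoc mult_2 distrib_left left_diff_distrib right_diff_distrib)
  also have "\<dots> = (if n < a then - 2 * Z else 0)" using a by simp
  finally have 2: "d (tilde T M) = tilde (\<lambda>M. d (T M)) M - (if n < a then - 2 * Z else 0)"
    unfolding derivation_tilde[OF d] by simp
  \<comment> \<open>Exactly one of a and m a is high. A high m a contributes through
    \<open>tilde_subst_index\<close>, a high a through the derivative of x_a, with opposite signs;
    this is recorded by \<open>e a\<close>.\<close>
  have "n < m a \<longleftrightarrow> \<not> n < a" using a by (auto simp: mirror_def)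
  then show ?thesis unfolding 2 1 Z_def[symmetric]
    by (cases "n < a") (simp_all add: e_def algebra_simps)
qed

text \<open>Here the Leibniz term of \<open>tilde_subst_index\<close> at m a and the derivative of
  x_(m b) in the correction are the same \<open>Z\<close>, and they cancel.\<close>

lemma derivation_tilde_T_levi:
  assumes d: "derivation d" and a: "a \<in> {1..n}" and b: "b \<in> {1..n}"
    and dy: "\<And>j z. j \<in> I \<Longrightarrow> d (y j z) = (if j = m b then y (m a) z else 0) - (if j = a then y b z else 0)"
    and dx: "\<And>j. j \<in> I \<Longrightarrow> d (x j) = (if j = m b then x (m a) else 0) - (if j = a then x b else 0)"
    and M: "set_mset M \<subseteq> I"
  shows "d (tilde T M) = subst_index (m b) (m a) (tilde T) M - subst_index a b (tilde T) M"
proof -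
  define Z where "Z = of_nat (count M (m b)) * (x (m a) * T (M - {#m b#}))"
  have mab: "m a \<in> H" "m b \<in> H" "m a \<in> I" "m b \<in> I" using a b by (auto simp: mirror_def)
  have abI: "a \<in> I" "b \<in> I" using a b by auto
  have "tilde (\<lambda>M. d (T M)) M = tilde (\<lambda>M. subst_index (m b) (m a) T M - subst_index a b T M) M"
    by (rule tilde_cong) (rule derivation_T_levi[OF d a b dy subset_I[OF _ M]])
  also have "\<dots> = subst_index (m b) (m a) (tilde T) M + Z - subst_index a b (tilde T) M"
    unfolding tilde_diff tilde_subst_index[OF abI] tilde_subst_index[OF mab(4,3)] Z_def using mab b by simp
  finally have 1: "tilde (\<lambda>M. d (T M)) M = subst_index (m b) (m a) (tilde T) M + Z - subst_index a b (tilde T) M" .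
  have "(\<Sum>h\<in>H. of_nat (count M h) * (d (x h) * T (M - {#h#}))) = (\<Sum>h\<in>H. if h = m b then Z else 0)"
    by (rule sum.cong) (use a in \<open>auto simp: dx Z_def\<close>)
  also have "\<dots> = Z" using mab by simp
  finally show ?thesis unfolding derivation_tilde[OF d] 1 by simp
qed

end

section \<open>Polynomials over a non-commutative ring and traces\<close>

text \<open>With multisets as monomials the convolution product makes the variables commute with
  each other and with all coefficients, while the coefficients keep their own order.\<close>

type_synonym 'r mpoly_ring = "nat multiset \<Rightarrow>\<^sub>0 'r"

abbreviation (input) lookup :: "('a \<Rightarrow>\<^sub>0 'r :: zero) \<Rightarrow> 'a \<Rightarrow> 'r" where "lookup \<equiv> Poly_Mapping.lookup"

definition pvar :: "nat \<Rightarrow> 'r :: ring_1 mpoly_ring" where "pvar i = Poly_Mapping.single {#i#} 1"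

abbreviation pconst :: "'r :: ring_1 \<Rightarrow> 'r mpoly_ring" where "pconst r \<equiv> Poly_Mapping.single 0 r"

lemma poly_mapping_add_induct [case_names single add]:
  fixes p :: "'a \<Rightarrow>\<^sub>0 'r :: ab_group_add"
  assumes "\<And>k v. P (Poly_Mapping.single k v)" and "\<And>p q. P p \<Longrightarrow> P q \<Longrightarrow> P (p + q)"
  shows "P p"
proof -
  have "P (\<Sum>k\<in>A. Poly_Mapping.single k (lookup p k))" if "finite A" for A
    using that
  proof induction
    case empty
    then show ?case using assms(1)[of undefined 0] by simp
  qed (simp add: assms)
  moreover have "p = (\<Sum>k\<in>Poly_Mapping.keys p. Poly_Mapping.single k (lookup p k))"
    by (rule poly_mapping_eqI) (simp add: lookup_sum lookup_single when_def in_keys_iff)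
  ultimately show ?thesis by (metis finite_keys)
qed

lemma lookup_pvar_mult: "lookup (pvar i * p) M = (if i \<in># M then lookup p (M - {#i#}) else 0)"
proof (induction p rule: poly_mapping_add_induct)
  case (single N v)
  have "{#i#} + N = M \<longleftrightarrow> i \<in># M \<and> N = M - {#i#}" by (auto simp: insert_DiffM)
  then show ?case by (auto simp: pvar_def mult_single lookup_single when_def)
next
  case (add p q)
  then show ?case by (simp add: distrib_left lookup_add)
qed

lemma lookup_pconst_mult: "lookup (pconst r * p) M = r * lookup p M"
proof (induction p rule: poly_mapping_add_induct)
  case (add p q)
  then show ?case by (simp add: distrib_left lookup_add)
qed (simp add: mult_single lookup_single when_def)

lemma lookup_mult_pconst: "lookup (p * pconst r) M = lookup p M * r"
proof (induction p rule: poly_mapping_add_induct)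
  case (add p q)
  then show ?case by (simp add: distrib_right lookup_add)
qed (simp add: mult_single lookup_single when_def)

lemma pvar_central: "pvar i * p = p * pvar i"
proof (induction p rule: poly_mapping_add_induct)
  case (add p q)
  then show ?case by (simp add: distrib_left distrib_right)
qed (simp add: pvar_def mult_single)

lemma pconst_central: "(\<And>q. r * q = q * r) \<Longrightarrow> pconst r * p = p * pconst r"
  by (rule poly_mapping_eqI) (simp add: lookup_pconst_mult lookup_mult_pconst)

definition pd :: "nat \<Rightarrow> 'r :: ring_1 mpoly_ring \<Rightarrow> 'r mpoly_ring"
  where "pd j p = (\<Sum>M\<in>Poly_Mapping.keys p. Poly_Mapping.single (M - {#j#}) (of_nat (count M j) * lookup p M))"

lemma lookup_pd: "lookup (pd j p) N = of_nat (Suc (count N j)) * lookup p (add_mset j N)"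
proof -
  have "lookup (pd j p) N = (\<Sum>M\<in>Poly_Mapping.keys p. if M = add_mset j N then of_nat (count M j) * lookup p M else 0)"
    unfolding pd_def lookup_sum
  proof (rule sum.cong)
    fix M
    have "M - {#j#} = N \<longleftrightarrow> M = add_mset j N" if "count M j \<noteq> 0"
      using that by (auto simp: insert_DiffM)
    then show "lookup (Poly_Mapping.single (M - {#j#}) (of_nat (count M j) * lookup p M)) N
      = (if M = add_mset j N then of_nat (count M j) * lookup p M else 0)"
      by (cases "count M j = 0") (auto simp: lookup_single when_def)
  qed simp
  then show ?thesis by (simp add: in_keys_iff)
qed

lemma pd_add: "pd j (p + q) = pd j p + pd j q"
  by (rule poly_mapping_eqI) (simp add: lookup_pd lookup_add distrib_left)

lemma pd_single: "pd j (Poly_Mapping.single M v) = Poly_Mapping.single (M - {#j#}) (of_nat (count M j) * v)"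
  by (cases "v = 0") (simp_all add: pd_def)

lemma derivation_pd: "derivation (pd j :: 'r :: ring_1 mpoly_ring \<Rightarrow> 'r mpoly_ring)"
proof -
  have "pd j (p * q) = pd j p * q + p * pd j q" for p q :: "'r mpoly_ring"
  proof (induction p rule: poly_mapping_add_induct)
    case (add p p')
    then show ?case by (simp add: distrib_right pd_add)
  next
    case (single M v)
    show ?case
    proof (induction q rule: poly_mapping_add_induct)
      case (add q q')
      then show ?case by (simp add: distrib_left pd_add)
    next
      case (single N w)
      have *: "Poly_Mapping.single (M + N - {#j#}) (of_nat (count M j) * q) = Poly_Mapping.single (M - {#j#} + N) (of_nat (count M j) * q)" for q :: 'r
      proof (cases "count M j = 0")
        case False
        then have "M + N - {#j#} = M - {#j#} + N" by (intro multiset_eqI) auto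
        then show ?thesis by simp
      qed simp
      have **: "Poly_Mapping.single (M + N - {#j#}) (of_nat (count N j) * q) = Poly_Mapping.single (M + (N - {#j#})) (of_nat (count N j) * q)" for q :: 'r
      proof (cases "count N j = 0")
        case False
        then have "M + N - {#j#} = M + (N - {#j#})" by (intro multiset_eqI) auto
        then show ?thesis by simp
      qed simp
      show ?case
        by (simp add: pd_single mult_single distrib_right single_add of_nat_left[of v] mult.assoc * **)
    qed
  qed
  then show ?thesis by (simp add: derivation_def pd_add)
qed

lemma pd_pvar_pconst: "pd j (pvar i * pconst r) = (if i = j then pconst r else 0)"
  by (simp add: pvar_def mult_single pd_single)

lemma pd_pvar: "pd j (pvar i) = (if i = j then 1 else 0)"
  using pd_pvar_pconst[of j i 1] by (cases "i = j") simp_all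

lemma pd_pconst: "pd j (pconst r) = 0"
  by (simp add: pd_single)

section \<open>Traces over homogeneous polynomials\<close>

definition multisets_of :: "nat set \<Rightarrow> nat \<Rightarrow> nat multiset set"
  where "multisets_of A k = {M. size M = k \<and> set_mset M \<subseteq> A}"

lemma finite_multisets_of: "finite A \<Longrightarrow> finite (multisets_of A k)"
proof -
  assume "finite A"
  then have "finite (mset ` {w. set w \<subseteq> A \<and> length w = k})" using finite_lists_length_eq by blast
  moreover have "multisets_of A k \<subseteq> mset ` {w. set w \<subseteq> A \<and> length w = k}"
  proof
    fix M assume "M \<in> multisets_of A k"
    moreover obtain w where "mset w = M" using ex_mset by blast
    ultimately show "M \<in> mset ` {w. set w \<subseteq> A \<and> length w = k}" by (auto simp: multisets_of_def)
  qed
  ultimately show ?thesis using finite_subset by blast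
qed

lemma sum_multisets_of_Suc:
  assumes "finite A" "i \<in> A"
  shows "(\<Sum>M\<in>multisets_of A (Suc k). if i \<in># M then g M else 0) = (\<Sum>P\<in>multisets_of A k. g (add_mset i P) :: 'r :: comm_monoid_add)"
proof -
  have "(\<Sum>M\<in>multisets_of A (Suc k). if i \<in># M then g M else 0) = (\<Sum>M\<in>{M \<in> multisets_of A (Suc k). i \<in># M}. g M)"
    by (rule sum.inter_filter[symmetric]) (rule finite_multisets_of[OF assms(1)])
  also have "{M \<in> multisets_of A (Suc k). i \<in># M} = add_mset i ` multisets_of A k"
  proof (intro equalityI subsetI)
    fix M assume M: "M \<in> {M \<in> multisets_of A (Suc k). i \<in># M}"
    then have "M = add_mset i (M - {#i#})" by simp
    moreover have "M - {#i#} \<in> multisets_of A k"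
      using M by (auto simp: multisets_of_def size_Diff_singleton dest: in_diffD)
    ultimately show "M \<in> add_mset i ` multisets_of A k" by blast
  qed (use assms in \<open>auto simp: multisets_of_def\<close>)
  also have "(\<Sum>M\<in>add_mset i ` multisets_of A k. g M) = (\<Sum>P\<in>multisets_of A k. g (add_mset i P))"
    by (subst sum.reindex) (auto simp: inj_on_def)
  finally show ?thesis .
qed

text \<open>\<open>G M\<close> is the image of the monomial x_M, and its coefficient at
  \<open>M\<close> is a diagonal entry in the basis of monomials of degree k.\<close>

definition poly_trace :: "nat set \<Rightarrow> nat \<Rightarrow> (nat multiset \<Rightarrow> 'r :: ring_1 mpoly_ring) \<Rightarrow> 'r"
  where "poly_trace A k G = (\<Sum>M\<in>multisets_of A k. lookup (G M) M)"

lemma trace_cong: "(\<And>M. M \<in> multisets_of A k \<Longrightarrow> G M = G' M) \<Longrightarrow> poly_trace A k G = poly_trace A k G'"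
  by (simp add: poly_trace_def)

lemma lookup_of_nat_mult: "lookup (of_nat a * p) M = of_nat a * lookup (p :: 'r :: ring_1 mpoly_ring) M"
  using lookup_pconst_mult[of "of_nat a" p M] by simp

lemma lookup_of_int_mult: "lookup (of_int a * p) M = of_int a * lookup (p :: 'r :: ring_1 mpoly_ring) M"
  using lookup_pconst_mult[of "of_int a" p M] by simp

text \<open>Cyclicity of the trace: multiplication by x_i after \<open>G\<close> in degree k + 1 is
  exchanged for multiplication by x_i before \<open>G\<close> in degree k.\<close>

lemma trace_pvar:
  assumes "finite A" "i \<in> A"
  shows "poly_trace A (Suc k) (\<lambda>M. pvar i * G M) = (\<Sum>P\<in>multisets_of A k. lookup (G (add_mset i P)) P)"
  using sum_multisets_of_Suc[OF assms, where g = "\<lambda>M. lookup (G M) (M - {#i#})"]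
  by (simp add: poly_trace_def lookup_pvar_mult)

text \<open>Cyclicity again, now for the degree-preserving operator x_i d_j. Both sides are indexed
  by the monomials \<open>P\<close> of degree k with x_i on one side and x_j on the other.\<close>

lemma trace_pvar_pd:
  assumes "finite A" "i \<in> A" "j \<in> A"
  shows "poly_trace A (Suc k) (\<lambda>M. pvar i * pd j (G M)) = poly_trace A (Suc k) (subst_index j i G)"
proof -
  have "poly_trace A (Suc k) (\<lambda>M. pvar i * pd j (G M)) = (\<Sum>P\<in>multisets_of A k. of_nat (Suc (count P j)) * lookup (G (add_mset i P)) (add_mset j P))"
    by (simp only: trace_pvar[OF assms(1,2)] lookup_pd)
  also have "\<dots> = (\<Sum>M\<in>multisets_of A (Suc k). if j \<in># M then of_nat (count M j) * lookup (G (add_mset i (M - {#j#}))) M else 0)"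
    by (subst sum_multisets_of_Suc[OF assms(1,3)]) simp
  also have "\<dots> = poly_trace A (Suc k) (subst_index j i G)"
    unfolding poly_trace_def subst_index_def lookup_of_nat_mult by (rule sum.cong) (auto simp: not_in_iff[THEN iffD1])
  finally show ?thesis .
qed

section \<open>The commutator of a trace with a root vector\<close>

locale sp_ring =
  fixes n :: nat
    and f :: "nat \<Rightarrow> nat \<Rightarrow> 'r :: ring_1"
    and s :: 'r
  assumes s_central: "s * q = q * s"
    and f_bracket: "\<lbrakk>i \<in> {1..2 * n}; j \<in> {1..2 * n}; k \<in> {1..2 * n}; l \<in> {1..2 * n}\<rbrakk> \<Longrightarrow>
      f i j * f k l - f k l * f i j
        = (if j = k then f i l else 0) - (if i = l then f k j else 0)
          - (if k = mirror n i then of_int (if i \<le> n then -1 else 1) * of_int (if j \<le> n then -1 else 1) * f (mirror n j) l else 0)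
          + (if l = mirror n j then of_int (if i \<le> n then -1 else 1) * of_int (if j \<le> n then -1 else 1) * f k (mirror n i) else 0)"
begin

sublocale sp_relations n pvar "\<lambda>i j. pconst (f i j)" "pconst s"
proof
  fix i j k l assume "i \<in> {1..2 * n}" "j \<in> {1..2 * n}" "k \<in> {1..2 * n}" "l \<in> {1..2 * n}"
  from f_bracket[OF this]
  show "pconst (f i j) * pconst (f k l) - pconst (f k l) * pconst (f i j)
        = (if j = k then pconst (f i l) else 0) - (if i = l then pconst (f k j) else 0)
          - (if k = mirror n i then of_int (if i \<le> n then -1 else 1) * of_int (if j \<le> n then -1 else 1) * pconst (f (mirror n j) l) else 0)
          + (if l = mirror n j then of_int (if i \<le> n then -1 else 1) * of_int (if j \<le> n then -1 else 1) * pconst (f k (mirror n i)) else 0)"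
    by (intro poly_mapping_eqI) (auto simp: lookup_minus lookup_add lookup_pconst_mult lookup_single when_def)
qed (simp_all add: pvar_central pconst_central s_central)

text \<open>The commutator with f_ab, corrected by the vector field that F_ab induces on the
  variables. The vector field removes the action on the summation index of \<open>\<eta> j\<close>,
  so x_j, \<open>\<eta> j\<close> and the letters undergo one and the same linear substitution of
  the free index j.\<close>

definition \<delta> :: "nat \<Rightarrow> nat \<Rightarrow> 'r mpoly_ring \<Rightarrow> 'r mpoly_ring"
  where "\<delta> a b p = pconst (f a b) * p - p * pconst (f a b) - pvar b * pd a p + e a * (e b * (pvar (m a) * pd (m b) p))"

lemma derivation_\<delta>: "derivation (\<delta> a b)"
  unfolding derivation_def
proof (intro allI conjI)
  fix p q
  show "\<delta> a b (p + q) = \<delta> a b p + \<delta> a b q"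
    by (simp add: \<delta>_def pd_add algebra_simps)
  show "\<delta> a b (p * q) = \<delta> a b p * q + p * \<delta> a b q"
    unfolding \<delta>_def derivation_simps(2)[OF derivation_pd]
    by (simp add: distrib_left distrib_right left_diff_distrib right_diff_distrib mult.assoc x_left[of p] e_left[of p])
qed

lemma pd_\<eta>: "a \<in> I \<Longrightarrow> pd a (\<eta> j) = pconst (f a j)"
  by (simp add: \<eta>_def derivation_simps(8)[OF derivation_pd] pd_pvar_pconst)

lemma \<delta>_\<eta>:
  assumes a: "a \<in> I" and b: "b \<in> I" and j: "j \<in> I"
  shows "\<delta> a b (\<eta> j) = (if j = m b then e a * (e b * \<eta> (m a)) else 0) - (if j = a then \<eta> b else 0)"
proof -
  have "pconst (f a b) * \<eta> j - \<eta> j * pconst (f a b) = (\<Sum>i\<in>I. pvar i * (pconst (f a b) * pconst (f i j) - pconst (f i j) * pconst (f a b)))"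
    by (simp add: \<eta>_def sum_distrib_left sum_distrib_right sum_subtractf[symmetric] right_diff_distrib x_left mult.assoc del: mult_single)
  also have "\<dots> = (\<Sum>i\<in>I. (if b = i then pvar i * pconst (f a j) else 0) - (if a = j then pvar i * pconst (f i b) else 0)
      - (if i = m a then e a * (e b * (pvar i * pconst (f (m b) j))) else 0) + (if j = m b then e a * (e b * (pvar i * pconst (f i (m a)))) else 0))"
    by (intro sum.cong refl) (simp only: F_comm[OF a b _ j], simp add: distrib_left right_diff_distrib pull)
  also have "\<dots> = pvar b * pconst (f a j) - (if j = a then \<eta> b else 0) - e a * (e b * (pvar (m a) * pconst (f (m b) j))) + (if j = m b then e a * (e b * \<eta> (m a)) else 0)"
    using b mirror_in[OF a] by (simp add: sum.distrib sum_subtractf \<eta>_def sum_distrib_left)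
  finally show ?thesis
    unfolding \<delta>_def pd_\<eta>[OF a] pd_\<eta>[OF mirror_in[OF b]] by simp
qed

lemma \<delta>_pvar: "\<delta> a b (pvar j) = (if j = m b then e a * (e b * pvar (m a)) else 0) - (if j = a then pvar b else 0)"
  by (simp add: \<delta>_def pd_pvar pvar_central)

lemma \<delta>_y:
  assumes "a \<in> I" "b \<in> I" "j \<in> I"
  shows "\<delta> a b (y j z) = (if j = m b then e a * (e b * y (m a) z) else 0) - (if j = a then y b z else 0)"
proof -
  have c: "pconst s + of_int z = pconst (s + of_int z)" by (simp add: single_add)
  define t where "t = pconst s + of_int z"
  have t: "e i * (t * q) = t * (e i * q)" for i q
    unfolding t_def by (rule shift_left)
  have "\<delta> a b t = 0"
    unfolding t_def c \<delta>_def pd_pconst using pconst_central[of "s + of_int z" "pconst (f a b)"] s_central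
    by (simp add: distrib_left distrib_right mult_of_int_commute)
  then show ?thesis
    unfolding y_def t_def[symmetric] derivation_simps(1,2)[OF derivation_\<delta>] \<delta>_\<eta>[OF assms] \<delta>_pvar
    by (auto simp: distrib_left right_diff_distrib t)
qed

text \<open>The vector field inside \<open>\<delta>\<close> is moved through the trace to the
  argument of \<open>G\<close>. The right-hand side therefore measures how far \<open>G\<close> is
  from being equivariant.\<close>

lemma commutator_trace:
  assumes "a \<in> I" "b \<in> I"
  shows "f a b * poly_trace I (Suc k) G - poly_trace I (Suc k) G * f a b
    = poly_trace I (Suc k) (\<lambda>M. \<delta> a b (G M) + subst_index a b G M - e a * (e b * subst_index (m b) (m a) G M))"
proof -
  \<comment> \<open>The signs are polynomials here; as an integer their product can be taken out of
    coefficients and traces.\<close>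
  have ee: "\<exists>z :: int. \<forall>p. e a * (e b * p) = of_int z * p"
    by (rule exI[of _ "(if a \<le> n then -1 else 1) * (if b \<le> n then -1 else 1)"]) (simp add: e_def)
  then obtain z :: int where z: "\<And>p. e a * (e b * p) = of_int z * p" by blast
  have "f a b * poly_trace I (Suc k) G - poly_trace I (Suc k) G * f a b
    = poly_trace I (Suc k) (\<lambda>M. pconst (f a b) * G M - G M * pconst (f a b))"
    by (simp add: poly_trace_def lookup_minus lookup_pconst_mult lookup_mult_pconst sum_distrib_left sum_distrib_right sum_subtractf)
  also have "\<dots> = poly_trace I (Suc k) (\<lambda>M. \<delta> a b (G M) + pvar b * pd a (G M) - of_int z * (pvar (m a) * pd (m b) (G M)))"
    by (rule trace_cong) (simp add: \<delta>_def z)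
  also have "\<dots> = poly_trace I (Suc k) (\<lambda>M. \<delta> a b (G M)) + poly_trace I (Suc k) (\<lambda>M. pvar b * pd a (G M)) - of_int z * poly_trace I (Suc k) (\<lambda>M. pvar (m a) * pd (m b) (G M))"
    by (simp add: poly_trace_def lookup_add lookup_minus lookup_of_int_mult sum.distrib sum_subtractf sum_distrib_left)
  also have "\<dots> = poly_trace I (Suc k) (\<lambda>M. \<delta> a b (G M)) + poly_trace I (Suc k) (subst_index a b G) - of_int z * poly_trace I (Suc k) (subst_index (m b) (m a) G)"
    using assms mirror_in by (simp add: trace_pvar_pd)
  also have "\<dots> = poly_trace I (Suc k) (\<lambda>M. \<delta> a b (G M) + subst_index a b G M - e a * (e b * subst_index (m b) (m a) G M))"
    by (simp add: poly_trace_def lookup_add lookup_minus lookup_of_int_mult sum.distrib sum_subtractf sum_distrib_left z)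
  finally show ?thesis .
qed

lemma commutes_levi:
  assumes "a \<in> {1..n}" "b \<in> {1..n}"
  shows "f a b * poly_trace I (Suc k) (tilde T) = poly_trace I (Suc k) (tilde T) * f a b"
proof -
  have I: "a \<in> I" "b \<in> I" using assms by auto
  have ee: "e a * (e b * p) = p" for p using assms by (simp add: e_def)
  have "f a b * poly_trace I (Suc k) (tilde T) - poly_trace I (Suc k) (tilde T) * f a b
     = poly_trace I (Suc k) (\<lambda>M. \<delta> a b (tilde T M) + subst_index a b (tilde T) M - subst_index (m b) (m a) (tilde T) M)"
    using commutator_trace[OF I, of k "tilde T"] unfolding ee .
  also have "\<dots> = poly_trace I (Suc k) (\<lambda>M. 0)"
  proof (rule trace_cong)
    fix M assume "M \<in> multisets_of I (Suc k)"
    then have "set_mset M \<subseteq> I" by (simp add: multisets_of_def)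
    then show "\<delta> a b (tilde T M) + subst_index a b (tilde T) M - subst_index (m b) (m a) (tilde T) M = 0"
      by (subst derivation_tilde_T_levi[OF derivation_\<delta> assms]) (simp_all add: \<delta>_y[OF I] \<delta>_pvar ee)
  qed
  finally show ?thesis by (simp add: poly_trace_def)
qed

text \<open>After the variables have been moved through the trace, the argument \<open>i\<close>,
  \<open>m i\<close> of \<open>T\<close> is symmetric under the mirror map and its signs are
  antisymmetric. Only the weight w distinguishes i from m i, and its first-order remainder meets the
  last term of \<open>derivation_tilde_T_long\<close> with the opposite sign.\<close>

lemma commutes_long:
  assumes a: "a \<in> I"
  shows "f a (m a) * poly_trace I (Suc k) (tilde T) = poly_trace I (Suc k) (tilde T) * f a (m a)"
proof -
  define b where "b = m a"
  \<comment> \<open>A fixed point of the mirror map would satisfy 2 a = 2 n + 1.\<close>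
  have "a \<noteq> b" using a unfolding b_def mirror_def by simp presburger
  then have b: "b \<in> I" "m b = a" "a \<noteq> b" "b \<noteq> a" using a mirror_in mirror_mirror by (auto simp: b_def)
  have ee: "e a * (e b * p) = - p" for p using a by (simp add: b_def e_mirror e_sq)
  define w where "w M = count M a * (count M a - 1)" for M
  define Z where "Z P = (\<Sum>i\<in>I. e i * (of_nat (w (add_mset (m i) P)) * T (add_mset i (add_mset (m i) P - {#a, a#}))))
    + 2 * (e a * (of_nat (count (add_mset b P) a) * T (add_mset b P - {#a#})))" for P
  have "f a b * poly_trace I (Suc k) (tilde T) - poly_trace I (Suc k) (tilde T) * f a b
     = poly_trace I (Suc k) (\<lambda>M. \<delta> a b (tilde T M) + subst_index a b (tilde T) M + subst_index a b (tilde T) M)"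
    using commutator_trace[OF a b(1), of k "tilde T"] unfolding ee b(2) b_def[symmetric] by simp
  also have "\<dots> = poly_trace I (Suc k) (\<lambda>M. of_nat (w M) * (\<Sum>i\<in>I. e i * (pvar (m i) * T (add_mset i (M - {#a, a#}))))
      + 2 * (e a * (of_nat (count M a) * (pvar b * T (M - {#a#})))))"
  proof (rule trace_cong)
    fix M assume "M \<in> multisets_of I (Suc k)"
    then have M: "set_mset M \<subseteq> I" by (simp add: multisets_of_def)
    have "\<delta> a b (tilde T M) + 2 * subst_index a (m a) (tilde T) M = of_nat (w M) * (\<Sum>i\<in>I. e i * (pvar (m i) * T (add_mset i (M - {#a, a#}))))
      + 2 * (e a * (of_nat (count M a) * (pvar b * T (M - {#a#}))))"
      unfolding w_def b_def
      by (rule derivation_tilde_T_long[OF derivation_\<delta> a _ _ M])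
        (simp_all add: \<delta>_y[OF a b(1)] \<delta>_pvar b_def[symmetric] b ee mult_2)
    then show "\<delta> a b (tilde T M) + subst_index a b (tilde T) M + subst_index a b (tilde T) M
      = of_nat (w M) * (\<Sum>i\<in>I. e i * (pvar (m i) * T (add_mset i (M - {#a, a#}))))
      + 2 * (e a * (of_nat (count M a) * (pvar b * T (M - {#a#}))))"
      by (simp add: b_def[symmetric] mult_2 add.assoc)
  qed
  also have "\<dots> = (\<Sum>i\<in>I. poly_trace I (Suc k) (\<lambda>M. pvar (m i) * (e i * (of_nat (w M) * T (add_mset i (M - {#a, a#}))))))
     + poly_trace I (Suc k) (\<lambda>M. pvar b * (2 * (e a * (of_nat (count M a) * T (M - {#a#})))))"
  proof -
    have pull_out: "of_nat (w M) * (e i * (pvar (m i) * p)) = pvar (m i) * (e i * (of_nat (w M) * p))"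
      "2 * (e a * (of_nat l * (pvar b * p))) = pvar b * (2 * (e a * (of_nat l * p)))" for M i l p
      by (metis x_left e_left of_nat_left)+
    show ?thesis
      by (simp add: poly_trace_def lookup_add lookup_sum sum.distrib sum_distrib_left pull_out, rule sum.swap)
  qed
  also have "\<dots> = (\<Sum>P\<in>multisets_of I k. lookup (Z P) P)"
  proof -
    have "(\<Sum>i\<in>I. poly_trace I (Suc k) (\<lambda>M. pvar (m i) * (e i * (of_nat (w M) * T (add_mset i (M - {#a, a#}))))))
      = (\<Sum>i\<in>I. \<Sum>P\<in>multisets_of I k. lookup (e i * (of_nat (w (add_mset (m i) P)) * T (add_mset i (add_mset (m i) P - {#a, a#})))) P)"
      by (intro sum.cong refl trace_pvar finite_atLeastAtMost mirror_in)
    then show ?thesis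
      unfolding trace_pvar[OF finite_atLeastAtMost b(1)] Z_def lookup_add lookup_sum sum.distrib
      by (subst sum.swap) simp
  qed
  also have "\<dots> = 0"
  proof (rule sum.neutral, rule ballI)
    fix P
    define t where "t i = T (add_mset i (add_mset (m i) P) - {#a, a#})" for i
    define l where "l = count P a"
    \<comment> \<open>A non-zero weight guarantees two copies of \<open>a\<close> before
      \<open>i\<close> is added, so adding and removing may be exchanged.\<close>
    have wt: "of_nat (w (add_mset (m i) P)) * T (add_mset i (add_mset (m i) P - {#a, a#}))
      = of_nat (w (add_mset (m i) P)) * t i" for i
    proof (cases "w (add_mset (m i) P) = 0")
      case False
      then have "add_mset i (add_mset (m i) P - {#a, a#}) = add_mset i (add_mset (m i) P) - {#a, a#}"
        unfolding w_def by (intro multiset_eqI) auto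
      then show ?thesis by (simp only: t_def)
    qed simp
    \<comment> \<open>Only i = b adds another copy of \<open>a\<close>, and (l + 1) l - l (l - 1) =
      2 l.\<close>
    have wP: "w (add_mset (m i) P) = w P + (if i = b then 2 * l else 0)" if "i \<in> I" for i
    proof (cases "i = b")
      case True
      then show ?thesis using b by (cases l) (simp_all add: w_def l_def[symmetric] algebra_simps)
    next
      case False
      then have "m i \<noteq> a" using mirror_mirror[OF that] by (auto simp: b_def)
      then show ?thesis using False by (simp add: w_def)
    qed
    have "(\<Sum>i\<in>I. e i * (of_nat (w (add_mset (m i) P)) * T (add_mset i (add_mset (m i) P - {#a, a#}))))
      = (\<Sum>i\<in>I. e i * (of_nat (w P) * t i)) + (\<Sum>i\<in>I. if i = b then e b * (of_nat (2 * l) * t b) else 0)"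
      unfolding wt sum.distrib[symmetric]
      by (rule sum.cong) (auto simp: wP distrib_left distrib_right simp del: of_nat_mult)
    \<comment> \<open>\<open>t i\<close> depends only on the unordered pair of i and m i.\<close>
    also have "(\<Sum>i\<in>I. e i * (of_nat (w P) * t i)) = 0"
      by (rule antisym_sum_zero) (simp add: t_def mirror_mirror add_mset_commute)
    also have "(\<Sum>i\<in>I. if i = b then e b * (of_nat (2 * l) * t b) else 0) = e b * (of_nat (2 * l) * t b)"
      using b by simp
    also have "t b = T (add_mset b P - {#a#})"
      unfolding t_def b(2) by (simp add: add_mset_commute[of b a])
    finally have "Z P = 0"
      unfolding Z_def e_mirror[OF a, folded b_def] using b
      by (simp add: l_def[symmetric] algebra_simps of_nat_left[of 2] e_left[of 2])
    then show "lookup (Z P) P = 0" by simp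
  qed
  finally show ?thesis by (simp add: b_def)
qed

end

section \<open>Column-permanents as coefficients of products of linear forms\<close>

definition linear_forms :: "nat set \<Rightarrow> (nat \<Rightarrow> 'r :: ring_1) list \<Rightarrow> 'r mpoly_ring"
  where "linear_forms A gs = prod_list (map (\<lambda>g. \<Sum>a\<in>A. pvar a * pconst (g a)) gs)"

lemma linear_forms_append: "linear_forms A (gs @ hs) = linear_forms A gs * linear_forms A hs"
  by (simp add: linear_forms_def)

definition word_value :: "(nat \<Rightarrow> 'r :: ring_1) list \<Rightarrow> nat list \<Rightarrow> 'r"
  where "word_value gs w = prod_list (map2 (\<lambda>g a. g a) gs w)"

text \<open>Expanding chooses one variable from each factor. The variables are central, so the
  choices with multiset \<open>M\<close> contribute to the coefficient of x_M, each with its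
  coefficients multiplied in the order of the factors, as a column-permanent requires.\<close>

lemma lookup_linear_forms:
  assumes "finite A" "M \<in> multisets_of A (length gs)"
  shows "lookup (linear_forms A gs) M = (\<Sum>w\<in>permutations_of_multiset M. word_value gs w)"
  using assms(2)
proof (induction gs arbitrary: M)
  case Nil
  then show ?case by (simp add: multisets_of_def linear_forms_def word_value_def lookup_one zero_multiset_def[symmetric])
next
  case (Cons g gs)
  have M: "size M = Suc (length gs)" "set_mset M \<subseteq> A" using Cons.prems by (auto simp: multisets_of_def)
  then have ne: "M \<noteq> {#}" by auto
  have "linear_forms A (g # gs) = (\<Sum>a\<in>A. pvar a * (pconst (g a) * linear_forms A gs))"
    by (simp add: linear_forms_def sum_distrib_right mult.assoc)
  then have "lookup (linear_forms A (g # gs)) M = (\<Sum>a\<in>A. if a \<in># M then g a * lookup (linear_forms A gs) (M - {#a#}) else 0)"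
    by (simp add: lookup_sum lookup_pvar_mult lookup_pconst_mult cong: if_cong)
  also have "\<dots> = (\<Sum>a\<in>set_mset M. g a * lookup (linear_forms A gs) (M - {#a#}))"
    using M assms(1) by (intro sum.mono_neutral_cong_right) auto
  also have "\<dots> = (\<Sum>a\<in>set_mset M. \<Sum>w\<in>(#) a ` permutations_of_multiset (M - {#a#}). word_value (g # gs) w)"
  proof (rule sum.cong)
    fix a assume a: "a \<in> set_mset M"
    then have "M - {#a#} \<in> multisets_of A (length gs)"
      using M by (auto simp: multisets_of_def size_Diff_singleton dest: in_diffD)
    then have IH: "lookup (linear_forms A gs) (M - {#a#}) = (\<Sum>w\<in>permutations_of_multiset (M - {#a#}). word_value gs w)"
      by (rule Cons.IH)
    show "g a * lookup (linear_forms A gs) (M - {#a#})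
      = (\<Sum>w\<in>(#) a ` permutations_of_multiset (M - {#a#}). word_value (g # gs) w)"
      unfolding IH by (subst sum.reindex) (auto simp: sum_distrib_left word_value_def)
  qed simp
  also have "\<dots> = (\<Sum>w\<in>(\<Union>a\<in>set_mset M. (#) a ` permutations_of_multiset (M - {#a#})). word_value (g # gs) w)"
    by (subst sum.UNION_disjoint) auto
  finally show ?case unfolding permutations_of_multiset_nonempty[OF ne] .
qed

lemma card_permute_list_fibre:
  assumes w: "w \<in> permutations_of_multiset (mset \<alpha>)"
  shows "card {p. p permutes {..<length \<alpha>} \<and> permute_list p \<alpha> = w}
    = card {p. p permutes {..<length \<alpha>} \<and> permute_list p \<alpha> = \<alpha>}"
proof -
  have "mset w = mset \<alpha>" using w by (rule permutations_of_multisetD)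
  then obtain q where q: "q permutes {..<length \<alpha>}" "permute_list q \<alpha> = w"
    by (rule mset_eq_permutation)
  have "bij_betw (\<lambda>p. p \<circ> q) {p. p permutes {..<length \<alpha>} \<and> permute_list p \<alpha> = \<alpha>}
      {p. p permutes {..<length \<alpha>} \<and> permute_list p \<alpha> = w}"
  proof (rule bij_betw_byWitness[where f' = "\<lambda>p. p \<circ> inv_into UNIV q"])
    show "\<forall>p\<in>{p. p permutes {..<length \<alpha>} \<and> permute_list p \<alpha> = \<alpha>}. p \<circ> q \<circ> inv_into UNIV q = p"
      using permutes_inv_o(1)[OF q(1)] by (simp add: comp_assoc)
    show "\<forall>p\<in>{p. p permutes {..<length \<alpha>} \<and> permute_list p \<alpha> = w}. p \<circ> inv_into UNIV q \<circ> q = p"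
      using permutes_inv_o(2)[OF q(1)] by (simp add: comp_assoc)
    show "(\<lambda>p. p \<circ> q) ` {p. p permutes {..<length \<alpha>} \<and> permute_list p \<alpha> = \<alpha>}
        \<subseteq> {p. p permutes {..<length \<alpha>} \<and> permute_list p \<alpha> = w}"
      using q by (auto simp: permutes_compose permute_list_compose)
    have "permute_list (inv_into UNIV q) w = \<alpha>"
      using q permutes_inv[OF q(1)] permutes_inv_o(1)[OF q(1)] permute_list_compose[of "inv_into UNIV q" \<alpha> q]
      by simp
    then show "(\<lambda>p. p \<circ> inv_into UNIV q) ` {p. p permutes {..<length \<alpha>} \<and> permute_list p \<alpha> = w}
        \<subseteq> {p. p permutes {..<length \<alpha>} \<and> permute_list p \<alpha> = \<alpha>}"
      using permutes_inv[OF q(1)] by (auto simp: permutes_compose permute_list_compose)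
  qed
  then show ?thesis by (rule bij_betw_same_card[symmetric])
qed

text \<open>Orbit counting: the k! permutations split into fibres of equal size over the distinct
  rearrangements of \<alpha>, whose number is k! divided by the product of the factorials.\<close>

lemma card_stabilizer:
  "card {p. p permutes {..<length \<alpha>} \<and> permute_list p \<alpha> = \<alpha>} = (\<Prod>a\<in>set \<alpha>. fact (count_list \<alpha> a))"
proof -
  define P where "P = permutations_of_multiset (mset \<alpha>)"
  define c where "c = card {p. p permutes {..<length \<alpha>} \<and> permute_list p \<alpha> = \<alpha>}"
  define d :: nat where "d = (\<Prod>a\<in>set \<alpha>. fact (count_list \<alpha> a))"
  have fin: "finite {p. p permutes {..<length \<alpha>}}" by (simp add: finite_permutations)
  have "fact (length \<alpha>) = card {p. p permutes {..<length \<alpha>}}"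
    by (subst card_permutations[where n = "length \<alpha>"]) simp_all
  also have "{p. p permutes {..<length \<alpha>}} = (\<Union>w\<in>P. {p. p permutes {..<length \<alpha>} \<and> permute_list p \<alpha> = w})"
    by (auto simp: P_def intro!: permutations_of_multisetI)
  also have "card \<dots> = (\<Sum>w\<in>P. c)"
    unfolding c_def P_def
    by (subst card_UN_disjoint) (auto intro: finite_subset[OF _ fin] simp: card_permute_list_fibre)
  finally have 1: "fact (length \<alpha>) = card P * c" by simp
  have "d dvd fact (length \<alpha>)" "card P = fact (length \<alpha>) div d"
    using card_permutations_of_multiset[of "mset \<alpha>"] by (simp_all add: P_def d_def count_mset)
  then have "card P * d = fact (length \<alpha>)" by simp
  then have "card P * d = card P * c" "card P \<noteq> 0" using 1 by (metis, metis fact_nonzero mult_zero_left)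
  then show ?thesis by (simp add: c_def d_def)
qed

text \<open>Every rearrangement of \<alpha> arises from \<alpha>! permutations. This is the
  multiplicity that the factor 1/\<alpha>! in D_k(u) removes.\<close>

lemma sum_permute_list:
  fixes h :: "nat list \<Rightarrow> 'r :: ring_1"
  shows "(\<Sum>p | p permutes {..<length \<alpha>}. h (permute_list p \<alpha>))
    = of_nat (\<Prod>a\<in>set \<alpha>. fact (count_list \<alpha> a)) * (\<Sum>w\<in>permutations_of_multiset (mset \<alpha>). h w)"
proof -
  define P where "P = permutations_of_multiset (mset \<alpha>)"
  have fin: "finite {p. p permutes {..<length \<alpha>}}" by (simp add: finite_permutations)
  have "(\<Sum>p | p permutes {..<length \<alpha>}. h (permute_list p \<alpha>))
    = (\<Sum>w\<in>P. \<Sum>p | p \<in> {p. p permutes {..<length \<alpha>}} \<and> permute_list p \<alpha> = w. h (permute_list p \<alpha>))"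
    by (rule sum.group[symmetric, OF fin]) (auto simp: P_def intro!: permutations_of_multisetI)
  also have "\<dots> = (\<Sum>w\<in>P. of_nat (\<Prod>a\<in>set \<alpha>. fact (count_list \<alpha> a)) * h w)"
    by (rule sum.cong) (simp_all add: P_def card_permute_list_fibre card_stabilizer del: of_nat_prod)
  finally show ?thesis by (simp add: P_def sum_distrib_left)
qed

lemma permutes_shift:
  "(\<Sum>\<sigma> | \<sigma> permutes {1..k}. h (map (\<lambda>p. \<sigma> (Suc p) - 1) [0..<k])) = (\<Sum>\<pi> | \<pi> permutes {..<k}. h (map \<pi> [0..<k]))"
proof -
  have b: "bij_betw Suc {..<k} {1..k}"
    by (rule bij_betw_byWitness[where f' = "\<lambda>i. i - 1"]) auto
  have inv: "inv_into {..<k} Suc (Suc p) = p" if "p < k" for p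
    using that by (intro inv_into_f_f) auto
  show ?thesis
    by (subst sum.reindex_bij_betw[OF bij_betw_permutations[OF b], symmetric])
      (intro sum.cong refl arg_cong[where f = h] map_cong, auto simp: inv)
qed

context sp_ring
begin

text \<open>The entry in the column at the 0-based position \<open>p\<close>, with row index
  \<open>a\<close>. The subtraction for indices above n is the diagonal shift of F~.\<close>

definition factor :: "nat list \<Rightarrow> nat \<Rightarrow> nat \<Rightarrow> 'r"
  where "factor \<alpha> p a = f a (\<alpha> ! p)
    + (if a = \<alpha> ! p then s + of_int (int p - (if n < \<alpha> ! p then 1 else 0)) else 0)"

lemma Y_linear_forms:
  assumes "set w \<subseteq> I"
  shows "Y z w = linear_forms I (map (\<lambda>p a. f a (w ! p) + (if a = w ! p then s + of_int (z + int p) else 0)) [0..<length w])"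
  using assms
proof (induction w arbitrary: z)
  case Nil
  then show ?case by (simp add: linear_forms_def)
next
  case (Cons j w)
  have "y j z = (\<Sum>a\<in>I. pvar a * pconst (f a j)) + pvar j * pconst (s + of_int z)"
    by (simp add: y_def \<eta>_def single_add pvar_central[of j])
  also have "pvar j * pconst (s + of_int z) = (\<Sum>a\<in>I. if a = j then pvar a * pconst (s + of_int z) else 0)"
    using Cons.prems by simp
  also have "(\<Sum>a\<in>I. pvar a * pconst (f a j)) + \<dots> = (\<Sum>a\<in>I. pvar a * pconst (f a j + (if a = j then s + of_int z else 0)))"
    unfolding sum.distrib[symmetric] by (rule sum.cong) (auto simp: single_add distrib_left)
  finally have y: "y j z = \<dots>" .
  show ?case
    using Cons by (simp add: y linear_forms_def upt_conv_Cons map_Suc_upt[symmetric] o_def add_ac del: upt_Suc cong: if_cong)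
qed

lemma sorted_lw_hw: "lw M @ hw M = sorted_list_of_multiset M"
proof -
  have "sorted (lw M @ hw M)"
    by (auto simp: sorted_append lw_def hw_def)
  then have "sort (lw M @ hw M) = lw M @ hw M" by (rule sorted_sort_id)
  moreover have "sort (lw M @ hw M) = sorted_list_of_multiset (mset (lw M @ hw M))"
    by (simp only: sorted_list_of_multiset_mset)
  ultimately show ?thesis unfolding mset_lw_hw by simp
qed

text \<open>The sorted list of \<open>M\<close> is its low word followed by its high word, so by
  \<open>tilde_T\<close> the columns of the permanent are the factors of T~ in their given
  order.\<close>

lemma lookup_tilde_T:
  assumes "M \<in> multisets_of I k"
  defines "\<alpha> \<equiv> sorted_list_of_multiset M"
  shows "lookup (tilde T M) M
    = (\<Sum>w\<in>permutations_of_multiset M. word_value (map (factor \<alpha>) [0..<k]) w)"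
proof -
  have M: "set_mset M \<subseteq> I" "size M = k" using assms by (auto simp: multisets_of_def)
  define r where "r = length (lw M)"
  have \<alpha>: "\<alpha> = lw M @ hw M" unfolding \<alpha>_def sorted_lw_hw ..
  have len: "length \<alpha> = k" using M(2) \<alpha> mset_lw_hw[of M] by (metis size_mset)
  have lh: "set (lw M) \<subseteq> I" "set (hw M) \<subseteq> I" using M by (auto simp: set_lw set_hw)
  have "map (\<lambda>p a. f a (lw M ! p) + (if a = lw M ! p then s + of_int (0 + int p) else 0)) [0..<length (lw M)]
     @ map (\<lambda>p a. f a (hw M ! p) + (if a = hw M ! p then s + of_int (int r - 1 + int p) else 0)) [0..<length (hw M)]
     = map (factor \<alpha>) [0..<k]"
  proof (rule nth_equalityI)
    show "length (map (\<lambda>p a. f a (lw M ! p) + (if a = lw M ! p then s + of_int (0 + int p) else 0)) [0..<length (lw M)]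
     @ map (\<lambda>p a. f a (hw M ! p) + (if a = hw M ! p then s + of_int (int r - 1 + int p) else 0)) [0..<length (hw M)])
     = length (map (factor \<alpha>) [0..<k])" using len \<alpha> by simp
    fix p assume "p < length (map (\<lambda>p a. f a (lw M ! p) + (if a = lw M ! p then s + of_int (0 + int p) else 0)) [0..<length (lw M)]
     @ map (\<lambda>p a. f a (hw M ! p) + (if a = hw M ! p then s + of_int (int r - 1 + int p) else 0)) [0..<length (hw M)])"
    then have p: "p < length (lw M) + length (hw M)" by simp
    have low: "lw M ! p \<le> n" if "p < r" using set_lw[of M] nth_mem[of p "lw M"] that by (auto simp: r_def)
    have high: "n < hw M ! (p - r)" if "\<not> p < r" using set_hw[of M] nth_mem[of "p - r" "hw M"] that p by (auto simp: r_def)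
    \<comment> \<open>The high word starts again at shift r - 1, which is the shift p of its
      position lowered by one.\<close>
    have i: "int r - 1 + int (p - r) = int p - 1" if "\<not> p < r" using that by simp
    show "(map (\<lambda>p a. f a (lw M ! p) + (if a = lw M ! p then s + of_int (0 + int p) else 0)) [0..<length (lw M)]
     @ map (\<lambda>p a. f a (hw M ! p) + (if a = hw M ! p then s + of_int (int r - 1 + int p) else 0)) [0..<length (hw M)]) ! p
     = map (factor \<alpha>) [0..<k] ! p"
    proof (cases "p < r")
      case True
      then show ?thesis using p len low by (auto simp: r_def \<alpha> nth_append factor_def fun_eq_iff)
    next
      case False
      then show ?thesis using p len high[OF False] i[OF False]
        by (simp add: r_def[symmetric] \<alpha> nth_append factor_def fun_eq_iff del: of_int_diff of_int_add)
    qed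
  qed
  then have "tilde T M = linear_forms I (map (factor \<alpha>) [0..<k])"
    unfolding tilde_T[OF M(1), symmetric] Y_linear_forms[OF lh(1)] Y_linear_forms[OF lh(2)]
    by (simp only: linear_forms_append[symmetric] r_def)
  then show ?thesis
    using lookup_linear_forms[of I M "map (factor \<alpha>) [0..<k]"] assms(1) by simp
qed

text \<open>The commutant of d is closed under products and differences, hence under brackets. Levi
  and long root vectors generate the rest: a short root vector is half of a bracket of one of each
  kind.\<close>

lemma commutes_all:
  assumes sym: "\<And>i j. \<lbrakk>i \<in> I; j \<in> I\<rbrakk> \<Longrightarrow> f (m j) (m i) = - (of_int (if i \<le> n then -1 else 1) * of_int (if j \<le> n then -1 else 1) * f i j)"
    and tf: "\<And>q :: 'r. 2 * q = 0 \<Longrightarrow> q = 0"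
    and ij: "i \<in> I" "j \<in> I"
  shows "f i j * poly_trace I (Suc k) (tilde T) = poly_trace I (Suc k) (tilde T) * f i j"
proof -
  define d where "d = poly_trace I (Suc k) (tilde T)"
  define Q where "Q q \<longleftrightarrow> q * d = d * q" for q
  have Qm: "Q (p * q)" if "Q p" "Q q" for p q
    using that unfolding Q_def by (metis mult.assoc)
  have Qd: "Q (p - q)" if "Q p" "Q q" for p q
    using that unfolding Q_def by (simp add: left_diff_distrib right_diff_distrib)
  have Qn: "Q (- p)" if "Q p" for p using that by (simp add: Q_def)
  have Q2: "Q p" if "Q (p + p)" for p
  proof -
    have "2 * (p * d - d * p) = 0" using that by (simp add: Q_def mult_2 algebra_simps)
    then show ?thesis using tf[of "p * d - d * p"] by (simp add: Q_def)
  qed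
  have low: "Q (f a b)" if "a \<in> {1..n}" "b \<in> {1..n}" for a b
    unfolding Q_def d_def by (rule commutes_levi[OF that])
  have long: "Q (f a (m a))" if "a \<in> I" for a
    unfolding Q_def d_def by (rule commutes_long[OF that])
  have high: "Q (f a b)" if "a \<in> H" "b \<in> H" for a b
  proof -
    have "m a \<in> {1..n}" "m b \<in> {1..n}" "a \<in> I" "b \<in> I" using that by (auto simp: mirror_def)
    then have "f a b = - f (m b) (m a)" "Q (f (m b) (m a))"
      using sym[of "m b" "m a"] low mirror_in by (auto simp: mirror_mirror)
    then show ?thesis using Qn by simp
  qed
  have lh: "Q (f a (m b))" if "a \<in> {1..n}" "b \<in> {1..n}" for a b
  proof (cases "a = b")
    case True
    then show ?thesis using long[of a] that by simp
  next
    case False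
    have I: "a \<in> I" "b \<in> I" "m a \<in> I" "m b \<in> I" "m a \<noteq> b" "m b \<noteq> a" "\<not> m a \<le> n" "\<not> m b \<le> n"
      using that by (auto simp: mirror_def)
    \<comment> \<open>The two summands coincide by \<open>sym\<close>, so the bracket is twice the
      vector wanted.\<close>
    have "f a b * f b (m b) - f b (m b) * f a b = f a (m b) + f b (m a)"
      using f_bracket[OF I(1,2,2,4)] that I by auto
    also have "f b (m a) = f a (m b)"
      using sym[OF I(1,4)] that I by (auto simp: mirror_mirror)
    finally show ?thesis using Q2 Qd Qm low[OF that] long[OF I(2)] by metis
  qed
  have hl: "Q (f (m b) a)" if "a \<in> {1..n}" "b \<in> {1..n}" for a b
  proof (cases "a = b")
    case True
    then show ?thesis using long[of "m a"] that mirror_in[of a] by (simp add: mirror_mirror)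
  next
    case False
    have I: "a \<in> I" "b \<in> I" "m a \<in> I" "m b \<in> I" "m a \<noteq> b" "m b \<noteq> a" "\<not> m a \<le> n" "\<not> m b \<le> n"
      using that by (auto simp: mirror_def)
    have "f (m b) b * f b a - f b a * f (m b) b = f (m b) a + f (m b) a"
      using f_bracket[OF I(4,2,2,1)] that I by (auto simp: mirror_mirror)
    moreover have "Q (f (m b) b)" using long[OF I(4)] I by (simp add: mirror_mirror)
    ultimately show ?thesis using Q2 Qd Qm low[OF that(2,1)] by metis
  qed
  have "Q (f i j)"
  proof -
    have mij: "i \<le> n \<or> m i \<in> {1..n}" "j \<le> n \<or> m j \<in> {1..n}" using ij by (auto simp: mirror_def)
    show ?thesis
      using low[of i j] high[of i j] lh[of i "m j"] hl[of j "m i"] ij mij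
      by (cases "i \<le> n"; cases "j \<le> n") (auto simp: mirror_mirror)
  qed
  then show ?thesis by (simp add: Q_def d_def)
qed

end

section \<open>Transfer to the enveloping algebra\<close>

abbreviation free_sp :: "nat \<Rightarrow> (complex mat free_word \<Rightarrow>\<^sub>0 complex) set"
  where "free_sp n \<equiv> carrier (free_algebra (sp n))"

lemma free_algebra_ops:
  "p \<otimes>\<^bsub>free_algebra S\<^esub> q = p * q" "p \<oplus>\<^bsub>free_algebra S\<^esub> q = p + q"
  "\<one>\<^bsub>free_algebra S\<^esub> = 1" "\<zero>\<^bsub>free_algebra S\<^esub> = 0"
  by (simp_all add: free_algebra_def)

lemma free_sp_closed:
  "p \<in> free_sp n \<Longrightarrow> q \<in> free_sp n \<Longrightarrow> p * q \<in> free_sp n"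
  "p \<in> free_sp n \<Longrightarrow> q \<in> free_sp n \<Longrightarrow> p + q \<in> free_sp n"
  "p \<in> free_sp n \<Longrightarrow> q \<in> free_sp n \<Longrightarrow> p - q \<in> free_sp n"
  "1 \<in> free_sp n" "0 \<in> free_sp n" "scalar z \<in> free_sp n" "Z \<in> sp n \<Longrightarrow> letter Z \<in> free_sp n"
proof -
  interpret ring "free_algebra (sp n)" by (rule free_algebra_ring)
  show "p * q \<in> free_sp n" if "p \<in> free_sp n" "q \<in> free_sp n"
    using m_closed[OF that] by (simp add: free_algebra_ops)
  show "p + q \<in> free_sp n" if "p \<in> free_sp n" "q \<in> free_sp n"
    using a_closed[OF that] by (simp add: free_algebra_ops)
  show "1 \<in> free_sp n" "0 \<in> free_sp n"
    using one_closed zero_closed by (simp_all add: free_algebra_ops)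
  show "p - q \<in> free_sp n" if "p \<in> free_sp n" "q \<in> free_sp n"
    using that Poly_Mapping.keys_diff[of p q] by (fastforce simp: free_algebra_def)
  show "scalar z \<in> free_sp n"
    by (simp add: scalar_def free_algebra_def zero_free_word_def)
  show "letter Z \<in> free_sp n" if "Z \<in> sp n"
    using that by (simp add: letter_def free_algebra_def)
qed

section \<open>The class map from words to the enveloping algebra\<close>

lemma uea_class_hom: "uea_class (sp n) \<in> Ring.ring_hom (free_algebra (sp n)) (uea (sp n))"
  using ideal.rcos_ring_hom[OF uea_ideal_ideal] by (simp add: uea_def uea_class_def[abs_def])

lemma uea_class_closed: "p \<in> free_sp n \<Longrightarrow> uea_class (sp n) p \<in> carrier (uea (sp n))"
  by (rule Ring.ring_hom_closed[OF uea_class_hom])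

lemma uea_class_add: "p \<in> free_sp n \<Longrightarrow> q \<in> free_sp n \<Longrightarrow>
    uea_class (sp n) (p + q) = uea_class (sp n) p \<oplus>\<^bsub>uea (sp n)\<^esub> uea_class (sp n) q"
  using Ring.ring_hom_add[OF uea_class_hom] by (simp add: free_algebra_ops)

lemma uea_class_mult: "p \<in> free_sp n \<Longrightarrow> q \<in> free_sp n \<Longrightarrow>
    uea_class (sp n) (p * q) = uea_class (sp n) p \<otimes>\<^bsub>uea (sp n)\<^esub> uea_class (sp n) q"
  using Ring.ring_hom_mult[OF uea_class_hom] by (simp add: free_algebra_ops)

lemma uea_class_one: "uea_class (sp n) 1 = \<one>\<^bsub>uea (sp n)\<^esub>"
  using Ring.ring_hom_one[OF uea_class_hom] by (simp add: free_algebra_ops)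

lemma uea_class_zero: "uea_class (sp n) 0 = \<zero>\<^bsub>uea (sp n)\<^esub>"
proof -
  interpret ring "uea (sp n)" by (rule uea_ring)
  have "uea_class (sp n) 0 \<oplus>\<^bsub>uea (sp n)\<^esub> uea_class (sp n) 0 = uea_class (sp n) 0"
    using uea_class_add[of 0 n 0] by (simp add: free_sp_closed)
  then show ?thesis
    using uea_class_closed[of 0 n] by (metis add.l_cancel_one free_sp_closed(5))
qed

lemma uea_class_eq:
  assumes "p - q \<in> uea_ideal (sp n)" "p \<in> free_sp n" "q \<in> free_sp n"
  shows "uea_class (sp n) p = uea_class (sp n) q"
proof -
  interpret R: ring "uea (sp n)" by (rule uea_ring)
  interpret A: ring "free_algebra (sp n)" by (rule free_algebra_ring)
  interpret J: ideal "uea_ideal (sp n)" "free_algebra (sp n)" by (rule uea_ideal_ideal)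
  have d: "p - q \<in> free_sp n" using free_sp_closed(3) assms by blast
  have "uea_class (sp n) (p - q) = uea_ideal (sp n)"
    unfolding uea_class_def by (rule A.a_coset_join2[OF d J.a_subgroup assms(1)])
  also have "\<dots> = \<zero>\<^bsub>uea (sp n)\<^esub>" by (simp add: uea_def FactRing_def)
  finally have "uea_class (sp n) (p - q) = \<zero>\<^bsub>uea (sp n)\<^esub>" .
  then show ?thesis
    using uea_class_add[OF d assms(3)] uea_class_closed[OF assms(3)] by simp
qed

lemma uea_class_surj:
  assumes "r \<in> carrier (uea (sp n))"
  obtains p where "p \<in> free_sp n" "r = uea_class (sp n) p"
  using assms by (auto simp: uea_def FactRing_def A_RCOSETS_def' uea_class_def)

lemma uea_relation: "r \<in> uea_relations (sp n) \<Longrightarrow> r \<in> uea_ideal (sp n)"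
  unfolding uea_ideal_def
  using ring.genideal_self[OF free_algebra_ring uea_relations_carrier] by blast

lemma uea_embed_add:
  assumes "X \<in> sp n" "Y \<in> sp n"
  shows "uea_embed (sp n) (X + Y) = uea_embed (sp n) X \<oplus>\<^bsub>uea (sp n)\<^esub> uea_embed (sp n) Y"
proof -
  have "letter (X + Y) - letter X - letter Y \<in> uea_relations (sp n)"
    using assms by (auto simp: uea_relations_def)
  then have "uea_class (sp n) (letter (X + Y)) = uea_class (sp n) (letter X + letter Y)"
    using assms sp_add[OF assms] by (intro uea_class_eq free_sp_closed) (auto dest: uea_relation simp: diff_diff_add)
  then show ?thesis using assms by (simp add: uea_embed_def uea_class_add free_sp_closed)
qed

lemma uea_embed_smult:
  assumes "X \<in> sp n"
  shows "uea_embed (sp n) (z \<cdot>\<^sub>m X) = uea_scalar (sp n) z \<otimes>\<^bsub>uea (sp n)\<^esub> uea_embed (sp n) X"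
proof -
  have "letter (z \<cdot>\<^sub>m X) - scalar z * letter X \<in> uea_relations (sp n)"
    using assms by (auto simp: uea_relations_def)
  then have "uea_class (sp n) (letter (z \<cdot>\<^sub>m X)) = uea_class (sp n) (scalar z * letter X)"
    using assms sp_smult[OF assms] by (intro uea_class_eq free_sp_closed) (auto dest: uea_relation)
  then show ?thesis using assms by (simp add: uea_embed_def uea_scalar_def uea_class_mult free_sp_closed)
qed

lemma uea_embed_bracket:
  assumes "X \<in> sp n" "Y \<in> sp n"
  shows "uea_embed (sp n) X \<otimes>\<^bsub>uea (sp n)\<^esub> uea_embed (sp n) Y
    = uea_embed (sp n) (X * Y - Y * X) \<oplus>\<^bsub>uea (sp n)\<^esub> (uea_embed (sp n) Y \<otimes>\<^bsub>uea (sp n)\<^esub> uea_embed (sp n) X)"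
proof -
  have "letter X * letter Y - letter Y * letter X - letter (X * Y - Y * X) \<in> uea_relations (sp n)"
    unfolding uea_relations_def using assms by blast
  then have "letter X * letter Y - (letter (X * Y - Y * X) + letter Y * letter X) \<in> uea_ideal (sp n)"
    by (metis uea_relation diff_diff_add add.commute)
  then have "uea_class (sp n) (letter X * letter Y) = uea_class (sp n) (letter (X * Y - Y * X) + letter Y * letter X)"
    using assms sp_bracket[OF assms] by (intro uea_class_eq free_sp_closed) auto
  then show ?thesis using assms sp_bracket[OF assms] by (simp add: uea_embed_def uea_class_add uea_class_mult free_sp_closed)
qed

lemma uea_embed_closed: "X \<in> sp n \<Longrightarrow> uea_embed (sp n) X \<in> carrier (uea (sp n))"
  by (simp add: uea_embed_def uea_class_closed free_sp_closed)

lemma uea_scalar_closed: "uea_scalar (sp n) z \<in> carrier (uea (sp n))"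
  by (simp add: uea_scalar_def uea_class_closed free_sp_closed)

lemma uea_scalar_simps:
  "uea_scalar (sp n) (a + b) = uea_scalar (sp n) a \<oplus>\<^bsub>uea (sp n)\<^esub> uea_scalar (sp n) b"
  "uea_scalar (sp n) (a * b) = uea_scalar (sp n) a \<otimes>\<^bsub>uea (sp n)\<^esub> uea_scalar (sp n) b"
  "uea_scalar (sp n) 1 = \<one>\<^bsub>uea (sp n)\<^esub>"
  "uea_scalar (sp n) 0 = \<zero>\<^bsub>uea (sp n)\<^esub>"
  unfolding uea_scalar_def uea_class_one[symmetric] uea_class_zero[symmetric]
  by (simp_all add: uea_class_add[symmetric] uea_class_mult[symmetric] free_sp_closed)
    (simp_all add: scalar_def single_add mult_single)

lemma uea_scalar_uminus: "uea_scalar (sp n) (- a) = \<ominus>\<^bsub>uea (sp n)\<^esub> uea_scalar (sp n) a"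
proof -
  interpret ring "uea (sp n)" by (rule uea_ring)
  have "uea_scalar (sp n) (- a) \<oplus>\<^bsub>uea (sp n)\<^esub> uea_scalar (sp n) a = \<zero>\<^bsub>uea (sp n)\<^esub>"
    by (simp add: uea_scalar_simps[symmetric])
  then show ?thesis by (simp add: minus_equality uea_scalar_closed)
qed

lemma scalar_central: "scalar z * p = p * scalar z"
proof (induction p rule: poly_mapping_add_induct)
  case (add p q)
  then show ?case by (simp add: distrib_left distrib_right)
qed (simp add: scalar_def mult_single mult.commute)

lemma uea_scalar_central:
  assumes "r \<in> carrier (uea (sp n))"
  shows "uea_scalar (sp n) z \<otimes>\<^bsub>uea (sp n)\<^esub> r = r \<otimes>\<^bsub>uea (sp n)\<^esub> uea_scalar (sp n) z"
proof -
  obtain p where "p \<in> free_sp n" "r = uea_class (sp n) p"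
    using assms by (rule uea_class_surj)
  then show ?thesis
    by (simp add: uea_scalar_def uea_class_mult[symmetric] free_sp_closed scalar_central)
qed

text \<open>Since \<open>n\<close> is a term variable, no single \<open>U(\<ss>\<pp>)\<close> is a type. The product of all of
  them is one, and it carries the type class \<open>ring_1\<close>; the integer factor only makes it nontrivial.\<close>

typedef uea_family =
  "{p :: int \<times> (nat \<Rightarrow> (complex mat free_word \<Rightarrow>\<^sub>0 complex) set). \<forall>n. snd p n \<in> carrier (uea (sp n))}"
  by (rule exI[of _ "(0, \<lambda>n. \<zero>\<^bsub>uea (sp n)\<^esub>)"]) (simp add: ring.ring_simprules(2)[OF uea_ring])

definition tag :: "uea_family \<Rightarrow> int" where "tag a = fst (Rep_uea_family a)"

definition component :: "nat \<Rightarrow> uea_family \<Rightarrow> (complex mat free_word \<Rightarrow>\<^sub>0 complex) set"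
  where "component n a = snd (Rep_uea_family a) n"

lemma component_closed: "component n a \<in> carrier (uea (sp n))"
  using Rep_uea_family[of a] by (simp add: component_def)

lemma uea_family_eqI: "\<lbrakk>tag a = tag b; \<And>n. component n a = component n b\<rbrakk> \<Longrightarrow> a = b"
  by (simp add: tag_def component_def Rep_uea_family_inject[symmetric] prod_eq_iff fun_eq_iff)

definition family :: "int \<Rightarrow> (nat \<Rightarrow> (complex mat free_word \<Rightarrow>\<^sub>0 complex) set) \<Rightarrow> uea_family"
  where "family z F = Abs_uea_family (z, F)"

lemma family_simps:
  assumes "\<And>n. F n \<in> carrier (uea (sp n))"
  shows "tag (family z F) = z" "component n (family z F) = F n"
  using assms by (simp_all add: tag_def component_def family_def Abs_uea_family_inverse)

instantiation uea_family :: ring_1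
begin

definition "0 = family 0 (\<lambda>n. \<zero>\<^bsub>uea (sp n)\<^esub>)"
definition "1 = family 1 (\<lambda>n. \<one>\<^bsub>uea (sp n)\<^esub>)"
definition "a + b = family (tag a + tag b) (\<lambda>n. component n a \<oplus>\<^bsub>uea (sp n)\<^esub> component n b)"
definition "a * b = family (tag a * tag b) (\<lambda>n. component n a \<otimes>\<^bsub>uea (sp n)\<^esub> component n b)"
definition "- a = family (- tag a) (\<lambda>n. \<ominus>\<^bsub>uea (sp n)\<^esub> component n a)"
definition "a - b = family (tag a - tag b) (\<lambda>n. component n a \<ominus>\<^bsub>uea (sp n)\<^esub> component n b)"

lemma tag_simps: "tag 0 = 0" "tag 1 = 1" "tag (a + b) = tag a + tag b" "tag (a * b) = tag a * tag b"
    "tag (- a) = - tag a" "tag (a - b) = tag a - tag b"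
  and component_simps: "component n 0 = \<zero>\<^bsub>uea (sp n)\<^esub>" "component n 1 = \<one>\<^bsub>uea (sp n)\<^esub>"
    "component n (a + b) = component n a \<oplus>\<^bsub>uea (sp n)\<^esub> component n b"
    "component n (a * b) = component n a \<otimes>\<^bsub>uea (sp n)\<^esub> component n b"
    "component n (- a) = \<ominus>\<^bsub>uea (sp n)\<^esub> component n a"
    "component n (a - b) = component n a \<ominus>\<^bsub>uea (sp n)\<^esub> component n b"
  unfolding zero_uea_family_def one_uea_family_def plus_uea_family_def times_uea_family_def
    uminus_uea_family_def minus_uea_family_def
  by (simp_all add: family_simps component_closed ring.ring_simprules[OF uea_ring])

instance
proof
  fix a b c :: uea_family
  note simps = monoid.r_one[OF ring.is_monoid[OF uea_ring]] tag_simps component_simps component_closed ring.ring_simprules[OF uea_ring] algebra_simps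
  show "a * b * c = a * (b * c)" "1 * a = a" "a * 1 = a" "a + b + c = a + (b + c)" "a + b = b + a"
    "0 + a = a" "- a + a = 0" "a - b = a + - b" "(a + b) * c = a * c + b * c" "a * (b + c) = a * b + a * c"
    by (rule uea_family_eqI; simp add: simps)+
  show "(0 :: uea_family) \<noteq> 1" using tag_simps(1,2) by force
qed

end

text \<open>Extension by zero to the other components. It is additive and multiplicative but not
  unital, which is enough for commutation relations.\<close>

definition lift :: "nat \<Rightarrow> (complex mat free_word \<Rightarrow>\<^sub>0 complex) set \<Rightarrow> uea_family"
  where "lift n r = family 0 (\<lambda>k. if k = n then r else \<zero>\<^bsub>uea (sp k)\<^esub>)"

text \<open>The integer tag is 0, so \<open>family_scalar 1\<close> differs from 1; the two agree in
  every component. Multiplied with lifted elements, whose tag is also 0, it acts as the scalar it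
  stands for.\<close>

definition family_scalar :: "complex \<Rightarrow> uea_family"
  where "family_scalar z = family 0 (\<lambda>k. uea_scalar (sp k) z)"

lemma lift_simps:
  assumes "r \<in> carrier (uea (sp n))"
  shows "tag (lift n r) = 0" "component k (lift n r) = (if k = n then r else \<zero>\<^bsub>uea (sp k)\<^esub>)"
  unfolding lift_def using assms by (auto simp: family_simps ring.ring_simprules[OF uea_ring])

lemma family_scalar_simps: "tag (family_scalar z) = 0" "component k (family_scalar z) = uea_scalar (sp k) z"
  unfolding family_scalar_def by (auto simp: family_simps uea_scalar_closed)

lemma family_scalar_central: "family_scalar z * a = a * family_scalar z"
  by (rule uea_family_eqI)
    (simp_all add: tag_simps component_simps family_scalar_simps uea_scalar_central component_closed)

definition emb :: "nat \<Rightarrow> complex mat \<Rightarrow> uea_family" where "emb n Z = lift n (uea_embed (sp n) Z)"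

lemma emb_simps:
  assumes "Z \<in> sp n"
  shows "tag (emb n Z) = 0" "component k (emb n Z) = (if k = n then uea_embed (sp n) Z else \<zero>\<^bsub>uea (sp k)\<^esub>)"
  unfolding emb_def using assms by (simp_all add: lift_simps uea_embed_closed)

lemma emb_add: "Z \<in> sp n \<Longrightarrow> W \<in> sp n \<Longrightarrow> emb n (Z + W) = emb n Z + emb n W"
  by (rule uea_family_eqI)
    (simp_all add: tag_simps component_simps emb_simps sp_add uea_embed_add ring.ring_simprules[OF uea_ring])

lemma emb_smult: "Z \<in> sp n \<Longrightarrow> emb n (z \<cdot>\<^sub>m Z) = family_scalar z * emb n Z"
  by (rule uea_family_eqI)
    (simp_all add: tag_simps component_simps emb_simps sp_smult uea_embed_smult family_scalar_simps
      uea_scalar_closed ring.ring_simprules[OF uea_ring])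

lemma emb_bracket:
  assumes "Z \<in> sp n" "W \<in> sp n"
  shows "emb n Z * emb n W - emb n W * emb n Z = emb n (Z * W - W * Z)"
proof -
  have "emb n Z * emb n W = emb n (Z * W - W * Z) + emb n W * emb n Z"
    using assms sp_bracket[OF assms]
    by (intro uea_family_eqI)
      (simp_all add: tag_simps component_simps emb_simps uea_embed_bracket[OF assms] ring.ring_simprules[OF uea_ring])
  then show ?thesis by simp
qed

lemma emb_scaled:
  assumes "Z \<in> sp n"
  shows "emb n (0 \<cdot>\<^sub>m Z) = 0" "emb n (1 \<cdot>\<^sub>m Z) = emb n Z" "emb n ((-1) \<cdot>\<^sub>m Z) = - emb n Z"
  using assms uea_embed_closed[OF assms]
  by (auto intro!: uea_family_eqI simp: emb_smult tag_simps component_simps emb_simps family_scalar_simps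
      uea_scalar_simps uea_scalar_uminus[of _ 1] ring.ring_simprules[OF uea_ring])

text \<open>The tag is an integer, and each component is an algebra over the complex numbers, where
  one can multiply by 1/2.\<close>

lemma family_torsion_free:
  assumes "2 * (q :: uea_family) = 0"
  shows "q = 0"
proof (rule uea_family_eqI)
  have qq: "q + q = 0" using assms by (simp add: mult_2)
  then have "tag q + tag q = 0" by (metis tag_simps(1,3))
  then show "tag q = tag 0" by (simp add: tag_simps)
  fix n
  interpret R: ring "uea (sp n)" by (rule uea_ring)
  let ?r = "component n q"
  have r: "?r \<in> carrier (uea (sp n))" by (rule component_closed)
  have "?r \<oplus>\<^bsub>uea (sp n)\<^esub> ?r = \<zero>\<^bsub>uea (sp n)\<^esub>" using qq by (metis component_simps(1,3))
  moreover have "?r = uea_scalar (sp n) (1 / 2) \<otimes>\<^bsub>uea (sp n)\<^esub> (?r \<oplus>\<^bsub>uea (sp n)\<^esub> ?r)"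
  proof -
    have "?r = (uea_scalar (sp n) (1 / 2) \<oplus>\<^bsub>uea (sp n)\<^esub> uea_scalar (sp n) (1 / 2)) \<otimes>\<^bsub>uea (sp n)\<^esub> ?r"
      unfolding uea_scalar_simps(1)[symmetric] using r by (simp add: uea_scalar_simps)
    then show ?thesis using r by (simp add: R.l_distr R.r_distr uea_scalar_closed)
  qed
  ultimately show "?r = component n 0"
    by (simp add: component_simps uea_scalar_closed)
qed

section \<open>The matrices F_ij: brackets, symmetry and span\<close>

lemma F_mat_entry:
  assumes "r < 2 * n" "q < 2 * n"
  shows "F_mat n i j $$ (r, q) = (if Suc r = i \<and> Suc q = j then 1 else 0)
    - (if Suc r = mirror n j \<and> Suc q = mirror n i then sp_sign n i * sp_sign n j else 0)"
  using assms by (simp add: F_mat_def E_mat_def)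

lemma F_mat_carrier [simp]: "F_mat n i j \<in> carrier_mat (2 * n) (2 * n)"
  by (rule carrier_matI) (simp_all add: F_mat_def E_mat_def)

lemma F_mat_dim [simp]: "dim_row (F_mat n i j) = 2 * n" "dim_col (F_mat n i j) = 2 * n"
  using F_mat_carrier[of n i j] by (auto simp del: F_mat_carrier)

text \<open>F_ij is a combination of the matrix units at (i, j) and (j', i'), so the sum over the
  middle index has at most two terms.\<close>

lemma F_mat_mult_entry:
  assumes "i \<in> {1..2 * n}" "j \<in> {1..2 * n}" "r < 2 * n" "q < 2 * n"
  shows "(F_mat n i j * F_mat n k l) $$ (r, q)
    = (if Suc r = i then F_mat n k l $$ (j - 1, q) else 0)
      - (if Suc r = mirror n j then sp_sign n i * sp_sign n j * F_mat n k l $$ (mirror n i - 1, q) else 0)"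
proof -
  have m: "mirror n i \<in> {1..2 * n}" using assms by (auto simp: mirror_def)
  have "(F_mat n i j * F_mat n k l) $$ (r, q) = (\<Sum>t\<in>{0..<2 * n}. F_mat n i j $$ (r, t) * F_mat n k l $$ (t, q))"
    using assms by (simp add: scalar_prod_def)
  also have "\<dots> = (\<Sum>t\<in>{0..<2 * n}. (if t = j - 1 then if Suc r = i then F_mat n k l $$ (t, q) else 0 else 0)
      - (if t = mirror n i - 1 then if Suc r = mirror n j then sp_sign n i * sp_sign n j * F_mat n k l $$ (t, q) else 0 else 0))"
  proof (rule sum.cong)
    fix t assume "t \<in> {0..<2 * n}"
    then have t: "t < 2 * n" by simp
    have e: "Suc t = j \<longleftrightarrow> t = j - 1" "Suc t = mirror n i \<longleftrightarrow> t = mirror n i - 1" using assms(2) m by auto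
    have split: "((if A \<and> B then 1 else 0) - (if A' \<and> B' then w else 0)) * v
        = (if B then if A then v else 0 else 0) - (if B' then if A' then w * v else 0 else 0)" for A B A' B' and w v :: complex
      by (simp add: left_diff_distrib)
    show "F_mat n i j $$ (r, t) * F_mat n k l $$ (t, q)
        = (if t = j - 1 then if Suc r = i then F_mat n k l $$ (t, q) else 0 else 0)
          - (if t = mirror n i - 1 then if Suc r = mirror n j then sp_sign n i * sp_sign n j * F_mat n k l $$ (t, q) else 0 else 0)"
      unfolding F_mat_entry[OF assms(3) t] e by (rule split)
  qed simp
  also have "\<dots> = (if Suc r = i then F_mat n k l $$ (j - 1, q) else 0)
      - (if Suc r = mirror n j then sp_sign n i * sp_sign n j * F_mat n k l $$ (mirror n i - 1, q) else 0)"
  proof -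
    have "j - 1 \<in> {0..<2 * n}" "mirror n i - 1 \<in> {0..<2 * n}" using assms m by auto
    then show ?thesis
      unfolding sum_subtractf by (simp only: sum.delta finite_atLeastLessThan if_True)
  qed
  finally show ?thesis .
qed

lemma sp_sign_mirror: "i \<in> {1..2 * n} \<Longrightarrow> sp_sign n (mirror n i) = - sp_sign n i"
  by (auto simp: sp_sign_def mirror_def)

lemma sp_sign_sq: "sp_sign n i * sp_sign n i = 1" "sp_sign n i * (sp_sign n i * z) = z"
  by (simp_all add: sp_sign_def)

text \<open>The case distinctions are scalar coefficients 0 or \<plusminus>1, so the right-hand side
  is a linear combination to which \<open>emb_add\<close> and \<open>emb_smult\<close>
  apply.\<close>

lemma F_mat_bracket:
  assumes ij: "i \<in> {1..2 * n}" "j \<in> {1..2 * n}" and kl: "k \<in> {1..2 * n}" "l \<in> {1..2 * n}"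
  shows "F_mat n i j * F_mat n k l - F_mat n k l * F_mat n i j
    = (if j = k then 1 else 0) \<cdot>\<^sub>m F_mat n i l + (- (if i = l then 1 else 0)) \<cdot>\<^sub>m F_mat n k j
      + (- (if k = mirror n i then sp_sign n i * sp_sign n j else 0)) \<cdot>\<^sub>m F_mat n (mirror n j) l
      + (if l = mirror n j then sp_sign n i * sp_sign n j else 0) \<cdot>\<^sub>m F_mat n k (mirror n i)"
    (is "?L = ?R")
proof (rule eq_matI)
  fix r q assume "r < dim_row ?R" "q < dim_col ?R"
  then have rq: "r < 2 * n" "q < 2 * n" by simp_all
  define P Q where "P = Suc r" and "Q = Suc q"
  define m where "m = mirror n"
  define g where "g = sp_sign n"
  have PQ: "P \<in> {1..2 * n}" "Q \<in> {1..2 * n}" using rq by (auto simp: P_def Q_def)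
  define \<phi> where "\<phi> a b p = (if p = a \<and> Q = b then 1 else 0) - (if p = m b \<and> Q = m a then g a * g b else 0)" for a b p
  have mI: "m a \<in> {1..2 * n}" "m (m a) = a" if "a \<in> {1..2 * n}" for a
    using mirror_in[OF that] mirror_mirror[OF that] by (simp_all add: m_def)
  have m_eq: "m a = m b \<longleftrightarrow> a = b" "a = m b \<longleftrightarrow> b = m a" if "a \<in> {1..2 * n}" "b \<in> {1..2 * n}" for a b
    using mI[OF that(1)] mI[OF that(2)] by metis+
  have g: "g (m a) = - g a" if "a \<in> {1..2 * n}" for a
    unfolding g_def m_def by (rule sp_sign_mirror[OF that])
  have gg: "g a * g a = 1" "g a * (g a * z) = z" for a z by (simp_all add: g_def sp_sign_sq)
  have ent: "F_mat n a b $$ (p - 1, q) = \<phi> a b p" if "p \<in> {1..2 * n}" for a b p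
    using that rq by (subst F_mat_entry) (auto simp: \<phi>_def Q_def m_def g_def)
  have ent': "F_mat n a b $$ (r, q) = \<phi> a b P" for a b
    using ent[OF PQ(1)] by (simp add: P_def)
  have prod: "(F_mat n a b * F_mat n a' b') $$ (r, q) = (if P = a then \<phi> a' b' b else 0) - (if P = m b then g a * g b * \<phi> a' b' (m a) else 0)"
    if "a \<in> {1..2 * n}" "b \<in> {1..2 * n}" for a b a' b'
    unfolding F_mat_mult_entry[OF that rq] P_def[symmetric] m_def[symmetric] g_def[symmetric]
      ent[OF that(2)] ent[OF mI(1)[OF that(1)]] ..
  have "?L $$ (r, q) = (if P = i then \<phi> k l j else 0) - (if P = m j then g i * g j * \<phi> k l (m i) else 0)
      - ((if P = k then \<phi> i j l else 0) - (if P = m l then g k * g l * \<phi> i j (m k) else 0))"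
    unfolding prod[OF ij, symmetric] prod[OF kl, symmetric] using rq by (simp del: index_mult_mat(1))
  also have "\<dots> = (if j = k then \<phi> i l P else 0) - (if i = l then \<phi> k j P else 0)
      - (if k = m i then g i * g j * \<phi> (m j) l P else 0) + (if l = m j then g i * g j * \<phi> k (m i) P else 0)"
  proof -
    \<comment> \<open>The two matrix products yield eight products of Kronecker symbols. They are
      paired so that each of 1 to 4 is the entry of one term of the bracket.\<close>
    have 1: "(if P = i \<and> j = k \<and> Q = l then 1 else 0) - (if P = m l \<and> m k = m j \<and> Q = m i then g k * g l * (g i * g j) else 0)
        = (if j = k then \<phi> i l P else (0 :: complex))"
      using m_eq(1)[OF kl(1) ij(2)] by (auto simp: \<phi>_def gg mult_ac)
    have 2: "(if P = m j \<and> m i = m l \<and> Q = m k then g i * g j * (g k * g l) else 0) - (if P = k \<and> l = i \<and> Q = j then 1 else 0)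
        = - (if i = l then \<phi> k j P else (0 :: complex))"
      using m_eq(1)[OF ij(1) kl(2)] by (auto simp: \<phi>_def gg mult_ac)
    have 3: "(if P = m l \<and> m k = i \<and> Q = j then g k * g l else 0) - (if P = m j \<and> m i = k \<and> Q = l then g i * g j else 0)
        = - (if k = m i then g i * g j * \<phi> (m j) l P else (0 :: complex))"
    proof (cases "k = m i")
      case True
      then have f: "m i = k" "m k = i" "g k = - g i" "m (m j) = j" "g (m j) = - g j"
        using mI g ij by auto
      define A B where "A \<longleftrightarrow> P = m l \<and> Q = j" and "B \<longleftrightarrow> P = m j \<and> Q = l"
      have phi: "\<phi> (m j) l P = (if B then 1 else 0) - (if A then - g j * g l else 0)"
        unfolding \<phi>_def f A_def B_def ..
      have eqs: "P = m l \<and> m k = i \<and> Q = j \<longleftrightarrow> A" "P = m j \<and> m i = k \<and> Q = l \<longleftrightarrow> B"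
        using f by (auto simp: A_def B_def)
      show ?thesis
        unfolding eqs phi if_P[OF True] f(3) by (cases A; cases B) (simp_all add: algebra_simps gg)
    next
      case False
      then have "m k \<noteq> i" using mI(2)[OF kl(1)] by auto
      then show ?thesis using False by simp
    qed
    have 4: "(if P = k \<and> l = m j \<and> Q = m i then g i * g j else 0) - (if P = i \<and> j = m l \<and> Q = m k then g k * g l else 0)
        = (if l = m j then g i * g j * \<phi> k (m i) P else (0 :: complex))"
    proof (cases "l = m j")
      case True
      then have f: "m j = l" "m l = j" "g l = - g j" "m (m i) = i" "g (m i) = - g i"
        using mI g ij by auto
      define A B where "A \<longleftrightarrow> P = k \<and> Q = m i" and "B \<longleftrightarrow> P = i \<and> Q = m k"
      have phi: "\<phi> k (m i) P = (if A then 1 else 0) - (if B then g k * - g i else 0)"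
        unfolding \<phi>_def f A_def B_def ..
      have eqs: "P = k \<and> l = m j \<and> Q = m i \<longleftrightarrow> A" "P = i \<and> j = m l \<and> Q = m k \<longleftrightarrow> B"
        using f by (auto simp: A_def B_def)
      show ?thesis
        unfolding eqs phi if_P[OF True] f(3) by (cases A; cases B) (simp_all add: algebra_simps gg)
    next
      case False
      then have "j \<noteq> m l" using mI(2)[OF kl(2)] by auto
      then show ?thesis using False by simp
    qed
    have "(if P = i then \<phi> k l j else 0) - (if P = m j then g i * g j * \<phi> k l (m i) else 0)
      - ((if P = k then \<phi> i j l else 0) - (if P = m l then g k * g l * \<phi> i j (m k) else 0))
      = ((if P = i \<and> j = k \<and> Q = l then 1 else 0) - (if P = m l \<and> m k = m j \<and> Q = m i then g k * g l * (g i * g j) else 0))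
      + ((if P = m j \<and> m i = m l \<and> Q = m k then g i * g j * (g k * g l) else 0) - (if P = k \<and> l = i \<and> Q = j then 1 else 0))
      + ((if P = m l \<and> m k = i \<and> Q = j then g k * g l else 0) - (if P = m j \<and> m i = k \<and> Q = l then g i * g j else 0))
      + ((if P = k \<and> l = m j \<and> Q = m i then g i * g j else 0) - (if P = i \<and> j = m l \<and> Q = m k then g k * g l else 0))"
    proof -
      have split: "(if p then w * ((if A then 1 else 0) - (if B then v else 0)) else 0)
          = (if p \<and> A then w else 0) - (if p \<and> B then w * v else 0)" for p A B and w v :: complex
        by (simp add: right_diff_distrib)
      have a: "(if p then \<phi> x y z else 0) = (if p \<and> z = x \<and> Q = y then 1 else 0) - (if p \<and> z = m y \<and> Q = m x then g x * g y else 0)" for p x y z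
        unfolding \<phi>_def using split[where w = 1] by (simp only: mult_1)
      have b: "(if p then w * \<phi> x y z else 0) = (if p \<and> z = x \<and> Q = y then w else 0) - (if p \<and> z = m y \<and> Q = m x then w * (g x * g y) else 0)" for p w x y z
        unfolding \<phi>_def by (rule split)
      show ?thesis unfolding a b by (simp only: diff_conv_add_uminus minus_add_distrib minus_minus ac_simps)
    qed
    then show ?thesis unfolding 1 2 3 4 by simp
  qed
  also have "\<dots> = ?R $$ (r, q)"
    using rq by (simp add: ent' m_def[symmetric] g_def[symmetric])
  finally show "?L $$ (r, q) = ?R $$ (r, q)" .
qed simp_all

lemma F_mat_mirror:
  assumes "i \<in> {1..2 * n}" "j \<in> {1..2 * n}"
  shows "F_mat n (mirror n j) (mirror n i) = (- (sp_sign n i * sp_sign n j)) \<cdot>\<^sub>m F_mat n i j"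
proof (rule eq_matI)
  fix r q
  assume "r < dim_row ((- (sp_sign n i * sp_sign n j)) \<cdot>\<^sub>m F_mat n i j)" "q < dim_col ((- (sp_sign n i * sp_sign n j)) \<cdot>\<^sub>m F_mat n i j)"
  then have rq: "r < 2 * n" "q < 2 * n" by simp_all
  define w where "w = sp_sign n i * sp_sign n j"
  have w: "w * w = 1" "sp_sign n (mirror n j) * sp_sign n (mirror n i) = w"
    using assms by (simp_all add: w_def sp_sign_mirror) (simp add: sp_sign_def)
  have ind: "(if A then 1 else 0) - (if B then w else 0) = - w * ((if B then 1 else 0) - (if A then w else 0))" for A B
    using w(1) by (simp add: algebra_simps)
  show "F_mat n (mirror n j) (mirror n i) $$ (r, q) = ((- (sp_sign n i * sp_sign n j)) \<cdot>\<^sub>m F_mat n i j) $$ (r, q)"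
    unfolding w_def[symmetric] using rq
    by (subst index_smult_mat(1)) (simp_all only: F_mat_dim F_mat_entry w(2) w_def[symmetric]
        mirror_mirror[OF assms(1)] mirror_mirror[OF assms(2)] ind[symmetric])
qed simp_all

lemma emb_sign:
  assumes "Z \<in> sp n"
  shows "emb n ((sp_sign n i * sp_sign n j) \<cdot>\<^sub>m Z) = of_int (if i \<le> n then -1 else 1) * of_int (if j \<le> n then -1 else 1) * emb n Z"
    "emb n ((- (sp_sign n i * sp_sign n j)) \<cdot>\<^sub>m Z) = - (of_int (if i \<le> n then -1 else 1) * of_int (if j \<le> n then -1 else 1) * emb n Z)"
proof -
  define t where "t = (i \<le> n \<longleftrightarrow> j \<le> n)"
  have s: "sp_sign n i * sp_sign n j = (if t then 1 else -1)"
    by (simp add: sp_sign_def t_def)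
  have o: "of_int (if i \<le> n then -1 else 1) * of_int (if j \<le> n then -1 else 1) = (if t then 1 else - 1 :: uea_family)"
    by (simp add: t_def)
  show "emb n ((sp_sign n i * sp_sign n j) \<cdot>\<^sub>m Z) = of_int (if i \<le> n then -1 else 1) * of_int (if j \<le> n then -1 else 1) * emb n Z"
    "emb n ((- (sp_sign n i * sp_sign n j)) \<cdot>\<^sub>m Z) = - (of_int (if i \<le> n then -1 else 1) * of_int (if j \<le> n then -1 else 1) * emb n Z)"
    unfolding s o by (cases t; simp only: if_True if_False minus_minus emb_scaled[OF assms]; simp)+
qed

lemma sp_ring_uea: "sp_ring n (\<lambda>i j. emb n (F_mat n i j)) (family_scalar z)"
proof
  fix q show "family_scalar z * q = q * family_scalar z" by (rule family_scalar_central)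
next
  fix i j k l assume I: "i \<in> {1..2 * n}" "j \<in> {1..2 * n}" "k \<in> {1..2 * n}" "l \<in> {1..2 * n}"
  have M: "mirror n i \<in> {1..2 * n}" "mirror n j \<in> {1..2 * n}" using I mirror_in by blast+
  have S: "F_mat n i l \<in> sp n" "F_mat n k j \<in> sp n" "F_mat n (mirror n j) l \<in> sp n" "F_mat n k (mirror n i) \<in> sp n"
    by (intro F_mat_in_sp I M)+
  have c1: "emb n ((if b then 1 else 0) \<cdot>\<^sub>m Z) = (if b then emb n Z else 0)"
    "emb n ((- (if b then 1 else 0)) \<cdot>\<^sub>m Z) = - (if b then emb n Z else 0)" if "Z \<in> sp n" for b Z
    using emb_scaled[OF that] by auto
  have c2: "emb n ((if b then sp_sign n i * sp_sign n j else 0) \<cdot>\<^sub>m Z) = (if b then of_int (if i \<le> n then -1 else 1) * of_int (if j \<le> n then -1 else 1) * emb n Z else 0)"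
    "emb n ((- (if b then sp_sign n i * sp_sign n j else 0)) \<cdot>\<^sub>m Z) = - (if b then of_int (if i \<le> n then -1 else 1) * of_int (if j \<le> n then -1 else 1) * emb n Z else 0)" if "Z \<in> sp n" for b Z
    using emb_scaled[OF that] emb_sign[OF that] by (cases b; simp)+
  show "emb n (F_mat n i j) * emb n (F_mat n k l) - emb n (F_mat n k l) * emb n (F_mat n i j)
    = (if j = k then emb n (F_mat n i l) else 0) - (if i = l then emb n (F_mat n k j) else 0)
      - (if k = mirror n i then of_int (if i \<le> n then -1 else 1) * of_int (if j \<le> n then -1 else 1) * emb n (F_mat n (mirror n j) l) else 0)
      + (if l = mirror n j then of_int (if i \<le> n then -1 else 1) * of_int (if j \<le> n then -1 else 1) * emb n (F_mat n k (mirror n i)) else 0)"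
    unfolding emb_bracket[OF F_mat_in_sp[OF I(1,2)] F_mat_in_sp[OF I(3,4)]] F_mat_bracket[OF I]
    using S by (simp only: emb_add sp_add sp_smult c1 c2) simp
qed

text \<open>This is the entry in row i' and column j of the defining equation: J0 has a single
  non-zero entry in each row and column, so each product contributes one term.\<close>

lemma sp_entry:
  assumes Z: "Z \<in> sp n" and ij: "i < 2 * n" "j < 2 * n"
  shows "Z $$ (2 * n - 1 - j, 2 * n - 1 - i) = - (sp_sign n (Suc i) * sp_sign n (Suc j)) * Z $$ (i, j)"
proof -
  have C: "Z \<in> carrier_mat (2 * n) (2 * n)" "J0 n \<in> carrier_mat (2 * n) (2 * n)"
    and eq: "transpose_mat Z * J0 n + J0 n * Z = 0\<^sub>m (2 * n) (2 * n)"
    using Z by (auto simp: sp_def J0_def)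
  define r where "r = 2 * n - 1 - i"
  have r: "r < 2 * n" using ij by (simp add: r_def)
  have J: "J0 n $$ (a, b) = (if a = 2 * n - 1 - b then sp_sign n (Suc b) else 0)" if "a < 2 * n" "b < 2 * n" for a b
    using that by (auto simp: J0_def mirror_def)
  have "(transpose_mat Z * J0 n) $$ (r, j) = (\<Sum>t\<in>{0..<2 * n}. Z $$ (t, r) * J0 n $$ (t, j))"
    using C r ij by (auto simp: scalar_prod_def)
  also have "\<dots> = (\<Sum>t\<in>{0..<2 * n}. if t = 2 * n - 1 - j then Z $$ (t, r) * sp_sign n (Suc j) else 0)"
    using ij by (intro sum.cong) (auto simp: J)
  also have "\<dots> = Z $$ (2 * n - 1 - j, r) * sp_sign n (Suc j)" using ij by (simp add: sum.delta)
  finally have 1: "(transpose_mat Z * J0 n) $$ (r, j) = Z $$ (2 * n - 1 - j, r) * sp_sign n (Suc j)" .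
  have "(J0 n * Z) $$ (r, j) = (\<Sum>t\<in>{0..<2 * n}. J0 n $$ (r, t) * Z $$ (t, j))"
    using C r ij by (auto simp: scalar_prod_def)
  also have "\<dots> = (\<Sum>t\<in>{0..<2 * n}. if t = i then sp_sign n (Suc i) * Z $$ (t, j) else 0)"
    using ij r by (intro sum.cong) (auto simp: J r_def)
  also have "\<dots> = sp_sign n (Suc i) * Z $$ (i, j)" using ij by (simp add: sum.delta)
  finally have 2: "(J0 n * Z) $$ (r, j) = sp_sign n (Suc i) * Z $$ (i, j)" .
  have "(transpose_mat Z * J0 n + J0 n * Z) $$ (r, j) = 0" unfolding eq using r ij by simp
  then have 0: "Z $$ (2 * n - 1 - j, r) * sp_sign n (Suc j) + sp_sign n (Suc i) * Z $$ (i, j) = 0"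
    using C r ij unfolding 1[symmetric] 2[symmetric] by simp
  have "Z $$ (2 * n - 1 - j, r) = Z $$ (2 * n - 1 - j, r) * sp_sign n (Suc j) * sp_sign n (Suc j)"
    by (simp add: mult.assoc sp_sign_sq)
  also have "Z $$ (2 * n - 1 - j, r) * sp_sign n (Suc j) = - (sp_sign n (Suc i) * Z $$ (i, j))"
    using 0 by (simp add: add_eq_0_iff2)
  finally show ?thesis by (simp add: r_def mult_ac)
qed

text \<open>Z is the sum of Z_ij / 2 times F_ij over all index pairs. The half is due to F_ij and
  F_j'i' being proportional, so every entry of Z is produced twice.\<close>

lemma sp_span_induct:
  assumes Z: "Z \<in> sp n"
    and F: "\<And>i j. \<lbrakk>i \<in> {1..2 * n}; j \<in> {1..2 * n}\<rbrakk> \<Longrightarrow> Q (F_mat n i j)"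
    and add: "\<And>A B. \<lbrakk>A \<in> sp n; B \<in> sp n; Q A; Q B\<rbrakk> \<Longrightarrow> Q (A + B)"
    and smult: "\<And>c A. \<lbrakk>A \<in> sp n; Q A\<rbrakk> \<Longrightarrow> Q (c \<cdot>\<^sub>m A)"
    and n: "n \<ge> 1"
  shows "Q Z"
proof -
  define N where "N = {0..<2 * n} \<times> {0..<2 * n}"
  have "\<exists>W. W \<in> sp n \<and> Q W \<and> (\<forall>r q. r < 2 * n \<longrightarrow> q < 2 * n \<longrightarrow>
      W $$ (r, q) = (\<Sum>(i, j)\<in>S. Z $$ (i, j) / 2 * F_mat n (Suc i) (Suc j) $$ (r, q)))"
    if "finite S" "S \<subseteq> N" for S
    using that
  proof induction
    case empty
    \<comment> \<open>The empty sum is represented as 0 times F_11, so that \<open>smult\<close>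
      gives the property for the zero matrix.\<close>
    have "F_mat n 1 1 \<in> sp n" using n by (intro F_mat_in_sp) auto
    moreover have "Q (F_mat n 1 1)" using n by (intro F) auto
    ultimately show ?case
      by (intro exI[of _ "0 \<cdot>\<^sub>m F_mat n 1 1"]) (auto intro: sp_smult smult)
  next
    case (insert s S)
    then obtain W where W: "W \<in> sp n" "Q W" "\<forall>r q. r < 2 * n \<longrightarrow> q < 2 * n \<longrightarrow>
      W $$ (r, q) = (\<Sum>(i, j)\<in>S. Z $$ (i, j) / 2 * F_mat n (Suc i) (Suc j) $$ (r, q))" by auto
    obtain i j where s: "s = (i, j)" by force
    have ij: "Suc i \<in> {1..2 * n}" "Suc j \<in> {1..2 * n}" using insert s by (auto simp: N_def)
    define V where "V = (Z $$ (i, j) / 2) \<cdot>\<^sub>m F_mat n (Suc i) (Suc j)"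
    have V: "V \<in> sp n" "Q V" unfolding V_def by (intro sp_smult smult F_mat_in_sp F ij)+
    have "W \<in> carrier_mat (2 * n) (2 * n)" using W by (simp add: sp_def)
    then have "\<forall>r q. r < 2 * n \<longrightarrow> q < 2 * n \<longrightarrow> (V + W) $$ (r, q) = (\<Sum>(i, j)\<in>insert s S. Z $$ (i, j) / 2 * F_mat n (Suc i) (Suc j) $$ (r, q))"
      using insert W(3) by (auto simp: V_def s)
    moreover have "V + W \<in> sp n" "Q (V + W)" using V W by (auto intro: sp_add add)
    ultimately show ?case by blast
  qed
  from this[of N] obtain W where W: "W \<in> sp n" "Q W" "\<And>r q. r < 2 * n \<Longrightarrow> q < 2 * n \<Longrightarrow>
      W $$ (r, q) = (\<Sum>(i, j)\<in>N. Z $$ (i, j) / 2 * F_mat n (Suc i) (Suc j) $$ (r, q))" by (auto simp: N_def)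
  have "W = Z"
  proof (rule eq_matI)
    fix r q assume "r < dim_row Z" "q < dim_col Z"
    then have rq: "r < 2 * n" "q < 2 * n" using Z by (auto simp: sp_def)
    define r' q' where "r' = 2 * n - 1 - r" and "q' = 2 * n - 1 - q"
    have rq': "r' < 2 * n" "q' < 2 * n" using rq by (auto simp: r'_def q'_def)
    have "W $$ (r, q) = (\<Sum>(i, j)\<in>N. (if (i, j) = (r, q) then Z $$ (r, q) / 2 else 0)
      - (if (i, j) = (q', r') then Z $$ (q', r') / 2 * (sp_sign n (Suc q') * sp_sign n (Suc r')) else 0))"
      unfolding W(3)[OF rq]
    proof (rule sum.cong)
      fix s assume "s \<in> N"
      then obtain i j where s: "s = (i, j)" "i < 2 * n" "j < 2 * n" by (auto simp: N_def)
      have e: "Suc r = mirror n (Suc j) \<longleftrightarrow> j = r'" "Suc q = mirror n (Suc i) \<longleftrightarrow> i = q'"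
        using s rq by (auto simp: mirror_def r'_def q'_def)
      show "(case s of (i, j) \<Rightarrow> Z $$ (i, j) / 2 * F_mat n (Suc i) (Suc j) $$ (r, q))
        = (case s of (i, j) \<Rightarrow> (if (i, j) = (r, q) then Z $$ (r, q) / 2 else 0)
      - (if (i, j) = (q', r') then Z $$ (q', r') / 2 * (sp_sign n (Suc q') * sp_sign n (Suc r')) else 0))"
        using rq by (auto simp: s F_mat_entry e right_diff_distrib)
    qed simp
    also have "\<dots> = (\<Sum>s\<in>N. if s = (r, q) then Z $$ (r, q) / 2 else 0)
      - (\<Sum>s\<in>N. if s = (q', r') then Z $$ (q', r') / 2 * (sp_sign n (Suc q') * sp_sign n (Suc r')) else 0)"
      by (simp add: sum_subtractf[symmetric] case_prod_beta prod_eq_iff)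
    also have "\<dots> = Z $$ (r, q) / 2 - Z $$ (q', r') / 2 * (sp_sign n (Suc q') * sp_sign n (Suc r'))"
      using rq rq' by (simp add: N_def)
    also have "Z $$ (q', r') = - (sp_sign n (Suc r) * sp_sign n (Suc q)) * Z $$ (r, q)"
      unfolding q'_def r'_def by (rule sp_entry[OF Z rq])
    also have "sp_sign n (Suc q') * sp_sign n (Suc r') = sp_sign n (Suc q) * sp_sign n (Suc r)"
    proof -
      have "Suc q' = mirror n (Suc q)" "Suc r' = mirror n (Suc r)" using rq by (auto simp: mirror_def r'_def q'_def)
      then show ?thesis using rq by (simp add: sp_sign_mirror)
    qed
    finally show "W $$ (r, q) = Z $$ (r, q)" by (simp add: sp_sign_sq mult_ac)
  qed (use W(1) Z in \<open>auto simp: sp_def\<close>)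
  then show ?thesis using W by simp
qed

section \<open>The elements D_k(u) as components of traces\<close>

lemma component_of_nat: "component n (of_nat a) = uea_scalar (sp n) (of_nat a)"
  by (induction a) (simp_all add: component_simps uea_scalar_simps)

lemma component_of_int: "component n (of_int z) = uea_scalar (sp n) (of_int z)"
  by (cases z rule: int_cases2) (simp_all add: component_simps component_of_nat uea_scalar_uminus)

lemma component_sum:
  assumes "finite A"
  shows "component n (\<Sum>a\<in>A. g a) = (\<Oplus>\<^bsub>uea (sp n)\<^esub>a\<in>A. component n (g a))"
proof -
  interpret R: ring "uea (sp n)" by (rule uea_ring)
  show ?thesis
    using assms by induction (simp_all add: component_simps component_closed Pi_def)
qed

lemma component_prod_list:
  "component n (prod_list (map g l)) = foldr (\<lambda>j p. component n (g j) \<otimes>\<^bsub>uea (sp n)\<^esub> p) l \<one>\<^bsub>uea (sp n)\<^esub>"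
  by (induction l) (simp_all add: component_simps)

lemma multi_indicesD:
  assumes "\<alpha> \<in> multi_indices N k"
  shows "length \<alpha> = k" "set \<alpha> \<subseteq> {1..N}" "sorted_list_of_multiset (mset \<alpha>) = \<alpha>"
    "mset \<alpha> \<in> multisets_of {1..N} k"
  using assms by (auto simp: multi_indices_def multisets_of_def sorted_sort_id)

lemma bij_betw_multi_indices: "bij_betw mset (multi_indices N k) (multisets_of {1..N} k)"
  by (rule bij_betw_byWitness[where f' = sorted_list_of_multiset])
    (auto dest: multi_indicesD(3,4) simp: multi_indices_def multisets_of_def sorted_sort_id
      simp flip: size_mset set_mset_mset)

lemma finite_multi_indices: "finite (multi_indices N k)"
  using bij_betw_finite[OF bij_betw_multi_indices] finite_multisets_of[of "{1..N}"] by simp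

lemma multi_fact_eq:
  assumes "set \<alpha> \<subseteq> {1..N}"
  shows "multi_fact N \<alpha> = of_nat (\<Prod>a\<in>set \<alpha>. fact (count_list \<alpha> a))"
proof -
  have "(\<Prod>i = 1..N. fact (count_list \<alpha> i) :: complex) = (\<Prod>a\<in>set \<alpha>. fact (count_list \<alpha> a))"
    using assms by (intro prod.mono_neutral_right) (auto simp: count_list_0_iff)
  then show ?thesis by (simp add: multi_fact_def)
qed

text \<open>The diagonal entry u - (k/2 - j) of the first column j = 1. Later columns add the
  0-based position j - 1, in agreement with the shifts of a word starting at 0.\<close>

definition D_shift :: "nat \<Rightarrow> complex \<Rightarrow> uea_family"
  where "D_shift k u = family_scalar (u - of_nat k / 2 + 1)"

interpretation uea: sp_ring n "\<lambda>i j. emb n (F_mat n i j)" "D_shift k u" for n k u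
  unfolding D_shift_def by (rule sp_ring_uea)

lemma component_factor:
  assumes \<alpha>: "\<alpha> \<in> multi_indices (2 * n) k" and i: "i \<in> {1..k}" and j: "j \<in> {1..k}"
  shows "component n (uea.factor n k u \<alpha> (j - 1) (\<alpha> ! (i - 1))) = D_matrix n k u \<alpha> i j"
proof -
  interpret R: ring "uea (sp n)" by (rule uea_ring)
  define a b where "a = \<alpha> ! (i - 1)" and "b = \<alpha> ! (j - 1)"
  have len: "i - 1 < length \<alpha>" "j - 1 < length \<alpha>" using multi_indicesD(1)[OF \<alpha>] i j by auto
  have ab: "a \<in> {1..2 * n}" "b \<in> {1..2 * n}"
    using multi_indicesD(2)[OF \<alpha>] nth_mem[OF len(1)] nth_mem[OF len(2)] unfolding a_def b_def by blast+
  have F: "F_mat n a b \<in> sp n" by (rule F_mat_in_sp[OF ab])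
  let ?E = "uea_embed (sp n) (F_mat n a b)"
  let ?s = "uea_scalar (sp n)"
  have E: "?E \<in> carrier (uea (sp n))" by (rule uea_embed_closed[OF F])
  have lin: "?E \<ominus>\<^bsub>uea (sp n)\<^esub> ?s x \<oplus>\<^bsub>uea (sp n)\<^esub> ?s y \<ominus>\<^bsub>uea (sp n)\<^esub> ?s z = ?E \<oplus>\<^bsub>uea (sp n)\<^esub> ?s (- x + y + - z)" for x y z
    unfolding uea_scalar_simps(1) R.minus_eq uea_scalar_uminus[symmetric]
    using E by (simp add: uea_scalar_closed R.a_assoc)
  have "D_matrix n k u \<alpha> i j = ?E \<ominus>\<^bsub>uea (sp n)\<^esub> ?s (if a = b \<and> n < a then 1 else 0)
      \<oplus>\<^bsub>uea (sp n)\<^esub> ?s (u * (if a = b then 1 else 0))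
      \<ominus>\<^bsub>uea (sp n)\<^esub> ?s ((if a = b then 1 else 0) * (of_nat k / 2 - of_nat j))"
    by (simp only: D_matrix_def Let_def a_def b_def F_tilde_def)
  also have "\<dots> = ?E \<oplus>\<^bsub>uea (sp n)\<^esub> ?s (if a = b then u - of_nat k / 2 + 1 + of_int (int (j - 1) - (if n < b then 1 else 0)) else 0)"
    unfolding lin using j by (intro arg_cong2[where f = "\<lambda>x y. x \<oplus>\<^bsub>uea (sp n)\<^esub> ?s y"]) (auto simp: of_nat_diff)
  also have "\<dots> = component n (uea.factor n k u \<alpha> (j - 1) a)"
  proof (cases "a = b")
    case True
    then show ?thesis
      using F unfolding uea.factor_def b_def[symmetric]
      by (simp add: component_simps emb_simps D_shift_def family_scalar_simps component_of_int
          uea_scalar_simps(1)[symmetric] del: of_int_diff)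
  next
    case False
    then show ?thesis
      using F E unfolding uea.factor_def b_def[symmetric]
      by (simp add: component_simps emb_simps uea_scalar_simps(4))
  qed
  finally show ?thesis by (simp add: a_def)
qed

text \<open>Permuting the rows rearranges \<alpha>, so the permanent sums one word value per
  permutation. Grouping by rearrangements gives \<alpha>! times a coefficient of T~.\<close>

lemma column_permanent_D_matrix:
  assumes \<alpha>: "\<alpha> \<in> multi_indices (2 * n) k"
  shows "column_permanent (uea (sp n)) k (D_matrix n k u \<alpha>)
    = component n (of_nat (\<Prod>a\<in>set \<alpha>. fact (count_list \<alpha> a))
        * lookup (uea.tilde n (uea.T n k u) (mset \<alpha>)) (mset \<alpha>))"
proof -
  interpret R: ring "uea (sp n)" by (rule uea_ring)
  let ?f = "uea.factor n k u \<alpha>"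
  have len: "length \<alpha> = k" by (rule multi_indicesD(1)[OF \<alpha>])
  define h where "h l = prod_list (map (\<lambda>p. ?f p (\<alpha> ! (l ! p))) [0..<k])" for l
  have "column_permanent (uea (sp n)) k (D_matrix n k u \<alpha>)
    = (\<Oplus>\<^bsub>uea (sp n)\<^esub>\<sigma>\<in>{\<sigma>. \<sigma> permutes {1..k}}. component n (h (map (\<lambda>p. \<sigma> (Suc p) - 1) [0..<k])))"
    unfolding column_permanent_def
  proof (rule R.finsum_cong')
    fix \<sigma> assume "\<sigma> \<in> {\<sigma>. \<sigma> permutes {1..k}}"
    then have \<sigma>: "\<sigma> permutes {1..k}" by simp
    have "h (map (\<lambda>p. \<sigma> (Suc p) - 1) [0..<k]) = prod_list (map (\<lambda>j. ?f (j - 1) (\<alpha> ! (\<sigma> j - 1))) [1..<Suc k])"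
      unfolding h_def One_nat_def map_Suc_upt[symmetric] by (simp add: o_def, intro arg_cong[where f = prod_list] map_cong refl) simp
    then have "component n (h (map (\<lambda>p. \<sigma> (Suc p) - 1) [0..<k]))
      = foldr (\<lambda>j p. component n (?f (j - 1) (\<alpha> ! (\<sigma> j - 1))) \<otimes>\<^bsub>uea (sp n)\<^esub> p) [1..<Suc k] \<one>\<^bsub>uea (sp n)\<^esub>"
      by (simp only: component_prod_list)
    also have "\<dots> = foldr (\<lambda>j p. D_matrix n k u \<alpha> (\<sigma> j) j \<otimes>\<^bsub>uea (sp n)\<^esub> p) [1..<Suc k] \<one>\<^bsub>uea (sp n)\<^esub>"
    proof (rule foldr_cong)
      fix j p assume "j \<in> set [1..<Suc k]"
      then have j: "j \<in> {1..k}" by auto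
      then have "\<sigma> j \<in> {1..k}" using permutes_in_image[OF \<sigma>] by blast
      then show "component n (?f (j - 1) (\<alpha> ! (\<sigma> j - 1))) \<otimes>\<^bsub>uea (sp n)\<^esub> p = D_matrix n k u \<alpha> (\<sigma> j) j \<otimes>\<^bsub>uea (sp n)\<^esub> p"
        by (simp only: component_factor[OF \<alpha> _ j])
    qed simp_all
    finally show "foldr (\<lambda>j p. D_matrix n k u \<alpha> (\<sigma> j) j \<otimes>\<^bsub>uea (sp n)\<^esub> p) [1..<Suc k] \<one>\<^bsub>uea (sp n)\<^esub>
      = component n (h (map (\<lambda>p. \<sigma> (Suc p) - 1) [0..<k]))" by simp
  qed (auto simp: component_closed)
  also have "\<dots> = component n (\<Sum>\<sigma> | \<sigma> permutes {1..k}. h (map (\<lambda>p. \<sigma> (Suc p) - 1) [0..<k]))"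
    by (rule component_sum[symmetric]) (simp add: finite_permutations)
  also have "(\<Sum>\<sigma> | \<sigma> permutes {1..k}. h (map (\<lambda>p. \<sigma> (Suc p) - 1) [0..<k])) = (\<Sum>\<pi> | \<pi> permutes {..<k}. h (map \<pi> [0..<k]))"
    by (rule permutes_shift)
  also have "\<dots> = (\<Sum>\<pi> | \<pi> permutes {..<length \<alpha>}. word_value (map ?f [0..<k]) (permute_list \<pi> \<alpha>))"
    unfolding len by (rule sum.cong)
      (simp_all add: h_def word_value_def permute_list_def len zip_map_map zip_same_conv_map o_def,
        intro arg_cong[where f = prod_list] map_cong refl, simp)
  also have "\<dots> = of_nat (\<Prod>a\<in>set \<alpha>. fact (count_list \<alpha> a)) * (\<Sum>w\<in>permutations_of_multiset (mset \<alpha>). word_value (map ?f [0..<k]) w)"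
    by (rule sum_permute_list)
  also have "(\<Sum>w\<in>permutations_of_multiset (mset \<alpha>). word_value (map ?f [0..<k]) w)
      = lookup (uea.tilde n (uea.T n k u) (mset \<alpha>)) (mset \<alpha>)"
    using uea.lookup_tilde_T[OF multi_indicesD(4)[OF \<alpha>]] unfolding multi_indicesD(3)[OF \<alpha>] by simp
  finally show ?thesis .
qed

lemma D_elem_eq_trace:
  "D_elem n k u = component n (poly_trace {1..2 * n} k (uea.tilde n (uea.T n k u)))"
proof -
  interpret R: ring "uea (sp n)" by (rule uea_ring)
  let ?t = "\<lambda>M. lookup (uea.tilde n (uea.T n k u) M) M"
  have "D_elem n k u = (\<Oplus>\<^bsub>uea (sp n)\<^esub>\<alpha>\<in>multi_indices (2 * n) k. component n (?t (mset \<alpha>)))"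
    unfolding D_elem_def
  proof (rule R.finsum_cong')
    fix \<alpha> assume \<alpha>: "\<alpha> \<in> multi_indices (2 * n) k"
    define c :: nat where "c = (\<Prod>a\<in>set \<alpha>. fact (count_list \<alpha> a))"
    have c: "multi_fact (2 * n) \<alpha> = of_nat c" "c \<noteq> 0"
      unfolding c_def by (rule multi_fact_eq[OF multi_indicesD(2)[OF \<alpha>]]) simp
    have "uea_scalar (sp n) (1 / multi_fact (2 * n) \<alpha>) \<otimes>\<^bsub>uea (sp n)\<^esub> column_permanent (uea (sp n)) k (D_matrix n k u \<alpha>)
      = (uea_scalar (sp n) (1 / of_nat c) \<otimes>\<^bsub>uea (sp n)\<^esub> uea_scalar (sp n) (of_nat c)) \<otimes>\<^bsub>uea (sp n)\<^esub> component n (?t (mset \<alpha>))"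
      unfolding column_permanent_D_matrix[OF \<alpha>] c(1) c_def[symmetric] component_simps(4) component_of_nat
      by (simp add: R.m_assoc uea_scalar_closed component_closed)
    also have "\<dots> = component n (?t (mset \<alpha>))"
      unfolding uea_scalar_simps(2)[symmetric] using c(2) by (simp add: uea_scalar_simps(3) component_closed)
    finally show "uea_scalar (sp n) (1 / multi_fact (2 * n) \<alpha>) \<otimes>\<^bsub>uea (sp n)\<^esub> column_permanent (uea (sp n)) k (D_matrix n k u \<alpha>)
      = component n (?t (mset \<alpha>))" .
  qed (auto simp: component_closed)
  also have "\<dots> = component n (\<Sum>\<alpha>\<in>multi_indices (2 * n) k. ?t (mset \<alpha>))"
    by (rule component_sum[symmetric, OF finite_multi_indices])
  also have "(\<Sum>\<alpha>\<in>multi_indices (2 * n) k. ?t (mset \<alpha>)) = (\<Sum>M\<in>multisets_of {1..2 * n} k. ?t M)"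
    by (rule sum.reindex_bij_betw[OF bij_betw_multi_indices])
  finally show ?thesis by (simp add: poly_trace_def)
qed

text \<open>The words whose class commutes with \<open>z\<close> are closed under sums and products
  and contain scalars and letters, hence exhaust the free algebra; the class map is onto.\<close>

lemma uea_generated:
  assumes z: "z \<in> carrier (uea (sp n))"
    and emb: "\<And>Z. Z \<in> sp n \<Longrightarrow> uea_embed (sp n) Z \<otimes>\<^bsub>uea (sp n)\<^esub> z = z \<otimes>\<^bsub>uea (sp n)\<^esub> uea_embed (sp n) Z"
  shows "z \<in> ring_center (uea (sp n))"
proof -
  interpret R: ring "uea (sp n)" by (rule uea_ring)
  define Q where "Q p \<longleftrightarrow> p \<in> free_sp n \<and> uea_class (sp n) p \<otimes>\<^bsub>uea (sp n)\<^esub> z = z \<otimes>\<^bsub>uea (sp n)\<^esub> uea_class (sp n) p" for p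
  have Qs: "Q (scalar c)" for c
    using uea_scalar_central[OF z, of c] by (simp add: Q_def free_sp_closed uea_scalar_def)
  have Ql: "Q (letter Z)" if "Z \<in> sp n" for Z
    using emb[OF that] that by (simp add: Q_def free_sp_closed uea_embed_def)
  have Qm: "Q (p * q)" if "Q p" "Q q" for p q
  proof -
    have c: "uea_class (sp n) p \<in> carrier (uea (sp n))" "uea_class (sp n) q \<in> carrier (uea (sp n))"
      using that by (auto simp: Q_def uea_class_closed)
    have "uea_class (sp n) p \<otimes>\<^bsub>uea (sp n)\<^esub> uea_class (sp n) q \<otimes>\<^bsub>uea (sp n)\<^esub> z
      = uea_class (sp n) p \<otimes>\<^bsub>uea (sp n)\<^esub> (z \<otimes>\<^bsub>uea (sp n)\<^esub> uea_class (sp n) q)"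
      using that c z by (simp add: Q_def R.m_assoc)
    also have "\<dots> = z \<otimes>\<^bsub>uea (sp n)\<^esub> uea_class (sp n) p \<otimes>\<^bsub>uea (sp n)\<^esub> uea_class (sp n) q"
      using that c z by (simp add: Q_def R.m_assoc[symmetric])
    also have "\<dots> = z \<otimes>\<^bsub>uea (sp n)\<^esub> (uea_class (sp n) p \<otimes>\<^bsub>uea (sp n)\<^esub> uea_class (sp n) q)"
      by (rule R.m_assoc[OF z c])
    finally show ?thesis using that by (simp add: Q_def free_sp_closed uea_class_mult)
  qed
  have Qa: "Q (p + q)" if "Q p" "Q q" for p q
    using that z by (auto simp: Q_def free_sp_closed uea_class_add uea_class_closed R.l_distr R.r_distr)
  have Qw: "Q (Poly_Mapping.single (Word w) c)" if "set w \<subseteq> sp n" for w c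
    using that
  proof (induction w)
    case Nil
    then show ?case using Qs[of c] by (simp add: scalar_def zero_free_word_def)
  next
    case (Cons Z w)
    have "Poly_Mapping.single (Word (Z # w)) c = letter Z * Poly_Mapping.single (Word w) c"
      by (simp add: letter_def mult_single plus_free_word_def)
    then show ?case using Cons Ql Qm by simp
  qed
  have Q: "Q p" if p: "p \<in> free_sp n" for p
  proof -
    have "Q (\<Sum>w\<in>A. Poly_Mapping.single w (lookup p w))" if "finite A" "A \<subseteq> Poly_Mapping.keys p" for A
      using that
    proof induction
      case empty
      then show ?case using Qs[of 0] by (simp add: scalar_def)
    next
      case (insert w A)
      have "set (letters w) \<subseteq> sp n" using p insert by (auto simp: free_algebra_def)
      then have "Q (Poly_Mapping.single w (lookup p w))" using Qw[of "letters w"] by simp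
      then show ?case using insert Qa by simp
    qed
    moreover have "p = (\<Sum>w\<in>Poly_Mapping.keys p. Poly_Mapping.single w (lookup p w))"
      by (rule poly_mapping_eqI) (simp add: lookup_sum lookup_single when_def in_keys_iff)
    ultimately show ?thesis by (metis finite_keys order_refl)
  qed
  have "z \<otimes>\<^bsub>uea (sp n)\<^esub> r = r \<otimes>\<^bsub>uea (sp n)\<^esub> z" if "r \<in> carrier (uea (sp n))" for r
    using uea_class_surj[OF that] Q by (metis Q_def)
  then show ?thesis using z by (simp add: ring_center_def)
qed

theorem theoremA:
  fixes n k :: nat and u :: complex
  assumes "n \<ge> 1" and "k \<ge> 1"
  shows "D_elem n k u \<in> ring_center (uea (sp n))"
proof -
  interpret R: ring "uea (sp n)" by (rule uea_ring)
  \<comment> \<open>The trace lemmas work in positive degree, since moving a variable cyclically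
    lowers the degree by one.\<close>
  obtain l where k: "k = Suc l" using assms(2) by (cases k) auto
  define d where "d = poly_trace {1..2 * n} k (uea.tilde n (uea.T n k u))"
  have comm: "emb n Z * d = d * emb n Z" if "Z \<in> sp n" for Z
    using that
  proof (rule sp_span_induct)
    fix i j assume ij: "i \<in> {1..2 * n}" "j \<in> {1..2 * n}"
    show "emb n (F_mat n i j) * d = d * emb n (F_mat n i j)"
      unfolding d_def k
    proof (rule uea.commutes_all[OF _ family_torsion_free ij])
      fix i j assume ij: "i \<in> {1..2 * n}" "j \<in> {1..2 * n}"
      show "emb n (F_mat n (mirror n j) (mirror n i)) = - (of_int (if i \<le> n then -1 else 1) * of_int (if j \<le> n then -1 else 1) * emb n (F_mat n i j))"
        unfolding F_mat_mirror[OF ij] by (rule emb_sign(2)[OF F_mat_in_sp[OF ij]])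
    qed
  next
    fix A B assume "A \<in> sp n" "B \<in> sp n" "emb n A * d = d * emb n A" "emb n B * d = d * emb n B"
    then show "emb n (A + B) * d = d * emb n (A + B)"
      by (simp add: emb_add distrib_left distrib_right)
  next
    fix c A assume A: "A \<in> sp n" "emb n A * d = d * emb n A"
    have "family_scalar c * emb n A * d = family_scalar c * (d * emb n A)"
      by (simp add: mult.assoc A)
    also have "\<dots> = d * (family_scalar c * emb n A)"
      by (metis family_scalar_central mult.assoc)
    finally show "emb n (c \<cdot>\<^sub>m A) * d = d * emb n (c \<cdot>\<^sub>m A)"
      by (simp add: emb_smult A(1))
  qed (rule assms(1))
  have D: "D_elem n k u = component n d"
    unfolding d_def by (rule D_elem_eq_trace)
  show ?thesis
    unfolding D
  proof (rule uea_generated)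
    fix Z assume Z: "Z \<in> sp n"
    have "component n (emb n Z * d) = component n (d * emb n Z)" using comm[OF Z] by simp
    then show "uea_embed (sp n) Z \<otimes>\<^bsub>uea (sp n)\<^esub> component n d = component n d \<otimes>\<^bsub>uea (sp n)\<^esub> uea_embed (sp n) Z"
      by (simp add: component_simps emb_simps[OF Z])
  qed (rule component_closed)
qed


end
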